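(* Let $L\subset L'$ be free $\mathbb{Z}$-modules of the same finite rank, $H=L'/L$, and let $\{E_v\}_{v\in\mathcal{V}}$ be a basis of $L$. Let $$z(\mathbf{t})=\frac{\sum_{k=1}^r\iota_k\mathbf{t}^{b_k}}{\prod_{i=1}^n(1-\mathbf{t}^{a_i})},$$ where $\iota_k\in\mathbb{Z}$, $b_k,a_i\in L'$, and all coordinates $a_{i,v}$ of each $a_i=\sum_v a_{i,v}E_v$ are strictly positive. Fix $h\in H$ and a non-empty subset $\mathcal{I}\subset\mathcal{V}$. Assume that there exists a chamber $\mathfrak{c}\subset\mathbb{R}^{|\mathcal{I}|}$ (of the chamber decomposition associated with $\{a_i\}_i$ and $\mathcal{I}$) such that $b_k|_{\mathcal{I}}\in\mathfrak{c}$ for all $k$. Write the $h$-component of the Taylor expansion of $z$ at infinity, reduced to the variables $\mathbf{t}_{\mathcal{I}}$, as $$(T^{\infty}z)_h(\mathbf{t}_{\mathcal{I}})=\sum_{\tilde l}r^{(h)}_{\mathcal{I}}(\tilde l)\,\mathbf{t}_{\mathcal{I}}^{\tilde l}.$$ Then the modified periodic constant of $Tz_h(\mathbf{t}_{\mathcal{I}})$ associated with $\mathfrak{c}$ satisfies $$\mathrm{mpc}^{\mathfrak{c}}(Tz_h(\mathbf{t}_{\mathcal{I}}))=\sum_{\tilde l\geq 0}r^{(h)}_{\mathcal{I}}(\tilde l).$$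
   Context: Notation. For $l'\in L'$ write $l'=\sum_{v\in\mathcal{V}}l'_vE_v$ with $l'_v\in\mathbb{Q}$, $\mathbf{t}^{l'}=\prod_{v\in\mathcal{V}}t_v^{l'_v}$, $\mathbf{t}_{\mathcal{I}}^{l'}=\prod_{v\in\mathcal{I}}t_v^{l'_v}$, and $l'|_{\mathcal{I}}=(l'_v)_{v\in\mathcal{I}}\in\mathbb{R}^{|\mathcal{I}|}$. The class of $l'$ in $H$ is $[l']$. For $h\in H$, $r_h\in L'$ is the unique element with $[r_h]=h$ and all coordinates in $[0,1)$. For vectors $a,b$: $a\ge b$ means $a_v\ge b_v$ for all coordinates $v$, and $a\prec b$ means $a_v<b_v$ for all coordinates $v$. Expansions. $Tz(\mathbf{t})=\sum_{l'\in L'}z(l')\mathbf{t}^{l'}$ is the Taylor expansion of $z$ at the origin. $T^\infty z(\mathbf{t})=\sum_{\tilde l\in L'}r(\tilde l)\mathbf{t}^{\tilde l}$ is the Taylor expansion of $z$ at infinity: substitute $\mathbf{s}=1/\mathbf{t}$ into the expansion at $\mathbf{s}=0$ of $z(1/\mathbf{s})$ (so each $1/(1-\mathbf{t}^{a_i})$ is expanded as $-\sum_{x\ge 1}\mathbf{t}^{-xa_i}$). The $h$-component of a series keeps exactly the terms whose exponent has class $h$. Reduction to $\mathbf{t}_{\mathcal{I}}$ means first taking the $h$-component and then setting $t_v=1$ for all $v\notin\mathcal{I}$ (the resulting sums of coefficients are finite). Modified counting function. For $x\in L'$ with $[x]=h$, $$q_{h,\mathcal{I}}(x)=\sum_{l'|_{\mathcal{I}}\prec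 x|_{\mathcal{I}},\ [l']=h}z(l').$$ Chambers. Let $\mathcal{B}_{\mathcal{I}}$ be the set of all bases $\sigma$ of $\mathbb{R}^{|\mathcal{I}|}$ contained in $\{a_i|_{\mathcal{I}},E_v|_{\mathcal{I}}: 1\le i\le n,\ v\in\mathcal{I}\}$. A (big, open) chamber is a connected component of $\mathbb{R}^{|\mathcal{I}|}\setminus\bigcup_{\sigma\in\mathcal{B}_{\mathcal{I}}}\partial\,\mathbb{R}_{\ge0}\sigma$, where $\partial\,\mathbb{R}_{\ge 0}\sigma$ is the boundary of the closed cone generated by $\sigma$. Modified periodic constant. For a top-dimensional cone $\mathcal{K}\subset\mathbb{R}^{|\mathcal{I}|}$, suppose there are $l'_*\in\mathcal{K}$, a finite index sublattice $\widetilde L\subset L$ and a quasipolynomial $\mathfrak{q}$ on $\widetilde L$ with $q_{h,\mathcal{I}}(l+r_h)=\mathfrak{q}(l)$ for all $l\in\widetilde L$ with $(l+r_h)|_{\mathcal{I}}\in l'_*+\mathcal{K}$. Then $\mathrm{mpc}^{\mathcal{K}}(Tz_h(\mathbf{t}_{\mathcal{I}})):=\mathfrak{q}(0)$; this does not depend on the choices of $\widetilde L$ and $l'_*$. (For every chamber $\mathfrak{c}$ such a quasipolynomial exists for $\mathcal{K}=\mathfrak{c}$.) *)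

theory Defs
  imports "HOL-Analysis.Analysis" "HOL-Library.Poly_Mapping"
begin

text \<open>
  The index set of the basis is the finite type \<^typ>\<open>'v\<close>, and \<open>\<real>\<^sup>I\<close> for a subset \<open>I\<close> of it is the
  coordinate subspace of \<^typ>\<open>real ^ 'v\<close> of vectors vanishing outside \<open>I\<close>; topological notions are
  relative to that subspace.
\<close>

definition coord_space :: "'v::finite set \<Rightarrow> (real ^ 'v) set" where
  "coord_space I = {x. \<forall>v. v \<notin> I \<longrightarrow> x $ v = 0}"

definition bases_in :: "'v::finite set \<Rightarrow> (real ^ 'v) set \<Rightarrow> (real ^ 'v) set set" where
  "bases_in I G = {\<sigma>. \<sigma> \<subseteq> G \<and> independent \<sigma> \<and> span \<sigma> = coord_space I}"

definition chambers :: "'v::finite set \<Rightarrow> (real ^ 'v) set \<Rightarrow> (real ^ 'v) set set" where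
  "chambers I G = components (coord_space I -
     (\<Union>\<sigma>\<in>bases_in I G. subtopology euclidean (coord_space I) frontier_of (convex_cone hull \<sigma>)))"

text \<open>
  Laurent polynomials with integer coefficients and exponents in a group are the elements of the
  group ring \<^typ>\<open>'a \<Rightarrow>\<^sub>0 int\<close>; the monomial with exponent \<open>b\<close> is \<open>Poly_Mapping.single b 1\<close>.
\<close>

definition numerator :: "nat \<Rightarrow> (nat \<Rightarrow> int) \<Rightarrow> (nat \<Rightarrow> 'a::ab_group_add) \<Rightarrow> 'a \<Rightarrow>\<^sub>0 int" where
  "numerator r \<iota> b = (\<Sum>k = 1..r. Poly_Mapping.single (b k) (\<iota> k))"

definition denominator :: "nat \<Rightarrow> (nat \<Rightarrow> 'a::ab_group_add) \<Rightarrow> 'a \<Rightarrow>\<^sub>0 int" where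
  "denominator n a = (\<Prod>i = 1..n. 1 - Poly_Mapping.single (a i) 1)"

text \<open>The product of a Laurent polynomial and a formal series given by its coefficients.\<close>

definition series_mult :: "('a::ab_group_add \<Rightarrow>\<^sub>0 int) \<Rightarrow> ('a \<Rightarrow> int) \<Rightarrow> 'a \<Rightarrow> int" where
  "series_mult Q f l = (\<Sum>u\<in>Poly_Mapping.keys Q. Poly_Mapping.lookup Q u * f (l - u))"

text \<open>
  Free \<open>\<int>\<close>-modules \<open>L \<subseteq> L'\<close> of the same finite rank with a basis \<open>E\<close> of \<open>L\<close>. Within the locale,
  \<open>span\<close>, \<open>dependent\<close> and \<open>subspace\<close> refer to the \<open>\<int>\<close>-module structure, so a subspace is a
  subgroup.
\<close>

locale lattice_pair = module scale
  for scale :: "int \<Rightarrow> 'a::ab_group_add \<Rightarrow> 'a" +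
  fixes L L' :: "'a set" and E :: "'v::finite \<Rightarrow> 'a"
  assumes free_L': "\<exists>B. finite B \<and> card B = CARD('v) \<and> \<not> dependent B \<and> span B = L'"
    and basis_L: "inj E" "\<not> dependent (range E)" "span (range E) = L"
    and L_subset: "L \<subseteq> L'"
begin

text \<open>
  The rational coordinates of \<open>x \<in> L'\<close> in the basis \<open>E\<close>, obtained by clearing denominators: some
  positive multiple of \<open>x\<close> lies in \<open>L\<close>.
\<close>

definition coord :: "'a \<Rightarrow> 'v \<Rightarrow> rat" where
  "coord x = (THE c. \<exists>m>0. \<exists>k :: 'v \<Rightarrow> int.
     scale m x = (\<Sum>v\<in>UNIV. scale (k v) (E v)) \<and> (\<forall>v. c v = of_int (k v) / of_int m))"

definition restr :: "'v set \<Rightarrow> 'a \<Rightarrow> real ^ 'v" where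
  "restr I x = (\<chi> v. if v \<in> I then of_rat (coord x v) else 0)"

definition cls :: "'a \<Rightarrow> 'a set" where
  "cls x = {x + l |l. l \<in> L}"

definition class_group :: "'a set set" where
  "class_group = cls ` L'"

definition rep :: "'a set \<Rightarrow> 'a" where
  "rep h = (THE x. x \<in> L' \<and> cls x = h \<and> (\<forall>v. 0 \<le> coord x v \<and> coord x v < 1))"

text \<open>
  The expansion of \<open>P/Q\<close> at the origin is its expansion in the ring of formal series with exponents
  in \<open>L'\<close> bounded from below: the unique such series \<open>f\<close> with \<open>Q f = P\<close>. It exists and is unique
  when \<open>Q\<close> is a product of factors \<open>1 - t\<^sup>a\<close> or \<open>1 - t\<^sup>-\<^sup>a\<close> where \<open>a \<in> L'\<close> has positive
  coordinates.
\<close>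

definition expansion :: "('a \<Rightarrow>\<^sub>0 int) \<Rightarrow> ('a \<Rightarrow>\<^sub>0 int) \<Rightarrow> 'a \<Rightarrow> int" where
  "expansion P Q = (THE f. (\<forall>l. f l \<noteq> 0 \<longrightarrow> l \<in> L') \<and>
     (\<exists>m. \<forall>l v. f l \<noteq> 0 \<longrightarrow> m \<le> coord l v) \<and>
     series_mult Q f = Poly_Mapping.lookup P)"

text \<open>Here \<open>Poly_Mapping.map_key uminus\<close> is the substitution of \<open>1/s\<close> for \<open>t\<close>.\<close>

definition expansion_infinity :: "('a \<Rightarrow>\<^sub>0 int) \<Rightarrow> ('a \<Rightarrow>\<^sub>0 int) \<Rightarrow> 'a \<Rightarrow> int" where
  "expansion_infinity P Q l =
     expansion (Poly_Mapping.map_key uminus P) (Poly_Mapping.map_key uminus Q) (- l)"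

text \<open>
  The coefficient at \<open>y \<in> \<real>\<^sup>I\<close> of the \<open>h\<close>-component of the series \<open>f\<close>, reduced to the variables
  in \<open>I\<close>.
\<close>

definition reduced_coeff :: "('a \<Rightarrow> int) \<Rightarrow> 'a set \<Rightarrow> 'v set \<Rightarrow> real ^ 'v \<Rightarrow> int" where
  "reduced_coeff f h I y = (\<Sum>l | l \<in> L' \<and> cls l = h \<and> restr I l = y \<and> f l \<noteq> 0. f l)"

definition mod_counting :: "('a \<Rightarrow> int) \<Rightarrow> 'a set \<Rightarrow> 'v set \<Rightarrow> 'a \<Rightarrow> int" where
  "mod_counting f h I x =
     (\<Sum>l | l \<in> L' \<and> cls l = h \<and> (\<forall>v\<in>I. coord l v < coord x v) \<and> f l \<noteq> 0. f l)"

definition finite_index :: "'a set \<Rightarrow> 'a set \<Rightarrow> bool" where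
  "finite_index M N \<longleftrightarrow> subspace M \<and> M \<subseteq> N \<and> finite ((\<lambda>x. {x + m |m. m \<in> M}) ` N)"

text \<open>Polynomials in the coordinates whose coefficients are periodic on \<open>M\<close>.\<close>

definition quasipolynomial_on :: "'a set \<Rightarrow> ('a \<Rightarrow> real) \<Rightarrow> bool" where
  "quasipolynomial_on M g \<longleftrightarrow>
     (\<exists>(A :: ('v \<Rightarrow> nat) set) (c :: ('v \<Rightarrow> nat) \<Rightarrow> 'a \<Rightarrow> real) N.
        finite A \<and> finite_index N M \<and>
        (\<forall>\<alpha>\<in>A. \<forall>l\<in>M. \<forall>m\<in>N. c \<alpha> (l + m) = c \<alpha> l) \<and>
        (\<forall>l\<in>M. g l = (\<Sum>\<alpha>\<in>A. c \<alpha> l * (\<Prod>v\<in>UNIV. of_rat (coord l v) ^ \<alpha> v))))"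

definition is_mpc :: "('a \<Rightarrow> int) \<Rightarrow> 'a set \<Rightarrow> 'v set \<Rightarrow> (real ^ 'v) set \<Rightarrow> real \<Rightarrow> bool" where
  "is_mpc f h I K p \<longleftrightarrow>
     (\<exists>l0\<in>K. \<exists>M g. finite_index M L \<and> quasipolynomial_on M g \<and>
        (\<forall>l\<in>M. restr I (l + rep h) \<in> (\<lambda>y. l0 + y) ` K \<longrightarrow>
           of_int (mod_counting f h I (l + rep h)) = g l) \<and>
        p = g 0)"

definition mpc :: "('a \<Rightarrow> int) \<Rightarrow> 'a set \<Rightarrow> 'v set \<Rightarrow> (real ^ 'v) set \<Rightarrow> real" where
  "mpc f h I K = (THE p. is_mpc f h I K p)"

end

end

theory Submission
  imports Defs
begin

text \<open>
  Both sides of the formula are values of one vector partition function. Let \<open>X\<close> be the list of the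
  \<open>a\<^sub>i\<close> followed by the \<open>E\<^sub>v\<close> with \<open>v \<in> I\<close>, and let \<open>pf X x\<close> be the number of ways to write \<open>x\<close> as a
  combination of \<open>X\<close> with coefficients in the natural numbers, modulo the subgroup spanned by the
  \<open>E\<^sub>v\<close> with \<open>v \<notin> I\<close>. Summing all coefficients of \<open>Tz\<close> whose exponent is congruent to \<open>x\<close> modulo
  \<open>L\<close> and lies strictly below \<open>x\<close> on \<open>I\<close> amounts to admitting the \<open>E\<^sub>v\<close> as further generators, so
  the modified counting function at \<open>x\<close> is \<open>\<Sum>\<^sub>k \<iota>\<^sub>k pf X (x - b\<^sub>k - e)\<close> where \<open>e = \<Sum>\<^sub>v\<^sub>\<in>\<^sub>I E\<^sub>v\<close>
  (\<open>counting_formula\<close>). The expansion at infinity is an ordinary expansion in the inverse variables,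
  and the same computation turns the right-hand side into \<open>(-1)\<^sup>n \<Sum>\<^sub>k \<iota>\<^sub>k pf X (b\<^sub>k - r\<^sub>h - \<Sum>\<^sub>i a\<^sub>i)\<close>
  (\<open>sum_reduced_coeff\<close>).

  Far inside the chamber \<open>pf X\<close> is equal to a quasi-polynomial \<open>T\<close>, so the modified periodic constant
  is \<open>\<Sum>\<^sub>k \<iota>\<^sub>k T (r\<^sub>h - b\<^sub>k - e)\<close>, and it suffices to show that
  \<open>T (r\<^sub>h - b\<^sub>k - e) = (-1)\<^sup>n pf X (b\<^sub>k - r\<^sub>h - \<Sum>\<^sub>i a\<^sub>i)\<close>. Two facts give this.

  Reciprocity (\<open>reciprocity\<close>): \<open>(-1)\<^bsup>|X|\<^esup> T (- x - \<Sum>X) = (-1)\<^bsup>|I|\<^esup> T x\<close>. By partial fractions the rational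
  function \<open>1 / \<Prod>\<^sub>g\<^sub>\<in>\<^sub>X (1 - t\<^sup>g)\<close> is a combination of monomials times functions of the same kind whose
  exponents \<open>g\<close> are linearly independent up to repetition (\<open>partial_fractions\<close>). For those, the
  coefficients of the expansions at the origin and at infinity are the same product of binomial
  coefficients up to a sign, on opposite cones (\<open>asymptotic_simplicial\<close>).

  Exactness (\<open>pf_exact\<close>): \<open>pf X x = T x\<close> as soon as \<open>x\<close> restricts to a point \<open>y - z\<close> with \<open>y\<close> in the
  chamber and \<open>z\<close> in the zonotope of \<open>X\<close>, that is, a combination of \<open>X\<close> with coefficients in
  \<open>[0,1]\<close>. By induction on \<open>X\<close>, the difference \<open>pf X - T\<close> does not change along a generator \<open>g\<close> at
  the points where the assertion for \<open>X\<close> without \<open>g\<close> applies, and from every \<open>x\<close> as above one can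
  walk along generators, staying at such points, to points where the difference is known to be \<open>0\<close>.
  The point \<open>b\<^sub>k - r\<^sub>h - \<Sum>\<^sub>i a\<^sub>i\<close> qualifies because \<open>b\<^sub>k\<close> restricts to a point of the chamber and the
  coordinates of \<open>r\<^sub>h\<close> lie in \<open>[0,1)\<close>.

  This argument needs the chamber to be closed under addition, which is true for the chambers inside
  the positive orthant (\<open>C_add\<close>). A chamber that is not contained in the orthant is disjoint from it, and then
  both sides are \<open>0\<close> because \<open>pf X\<close> is supported over the orthant (\<open>mpc_outside\<close>).

  The modified periodic constant is well defined because two quasi-polynomials that agree far inside
  the chamber agree along the multiples of a lattice vector that points into the chamber, hence at
  \<open>0\<close> (\<open>mpc_unique\<close>).
\<close>

section \<open>Simplicial cones\<close>

text \<open>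
  Caratheodory's theorem for cones, with control of a linear cost. Along a linear relation between
  the vectors one can move in the direction that does not increase the cost until a coefficient
  vanishes; such a coefficient exists because the functional \<open>\<xi>\<close> forces the relation to have
  coefficients of both signs.
\<close>

lemma conic_caratheodory_cost:
  fixes S :: "'e::real_vector set"
  assumes "finite S" "linear \<xi>" "\<And>s. s \<in> S \<Longrightarrow> 0 < (\<xi> s :: real)" "\<And>s. s \<in> S \<Longrightarrow> 0 \<le> l s"
  shows "\<exists>T \<mu>. T \<subseteq> S \<and> independent T \<and> (\<forall>s\<in>T. 0 \<le> \<mu> s) \<and>
    (\<Sum>s\<in>T. \<mu> s *\<^sub>R s) = (\<Sum>s\<in>S. l s *\<^sub>R s) \<and>
    (\<Sum>s\<in>T. cost s * \<mu> s) \<le> (\<Sum>s\<in>S. cost s * (l s :: real))"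
  using assms(1,3,4)
proof (induction S arbitrary: l rule: finite_psubset_induct)
  case (psubset S)
  show ?case
  proof (cases "independent S")
    case True
    then show ?thesis using psubset.prems(2) by (intro exI[of _ S] exI[of _ l]) simp
  next
    case False
    then obtain u0 where u0: "\<exists>s\<in>S. u0 s \<noteq> 0" "(\<Sum>s\<in>S. u0 s *\<^sub>R s) = 0"
      using dependent_finite[OF psubset.hyps] by auto
    \<comment> \<open>the sign that makes the relation not increase the cost\<close>
    define \<epsilon> :: real where "\<epsilon> = (if 0 \<le> (\<Sum>s\<in>S. cost s * u0 s) then 1 else -1)"
    define u where "u s = \<epsilon> * u0 s" for s
    have "(\<Sum>s\<in>S. u s *\<^sub>R s) = \<epsilon> *\<^sub>R (\<Sum>s\<in>S. u0 s *\<^sub>R s)"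
      "(\<Sum>s\<in>S. cost s * u s) = \<epsilon> * (\<Sum>s\<in>S. cost s * u0 s)"
      by (simp_all add: u_def scaleR_sum_right sum_distrib_left mult.left_commute)
    moreover have "\<epsilon> \<noteq> 0" "0 \<le> \<epsilon> * (\<Sum>s\<in>S. cost s * u0 s)" by (simp_all add: \<epsilon>_def)
    ultimately have u: "\<exists>s\<in>S. u s \<noteq> 0" "(\<Sum>s\<in>S. u s *\<^sub>R s) = 0" "0 \<le> (\<Sum>s\<in>S. cost s * u s)"
      using u0 by (auto simp: u_def)
    have "\<exists>s\<in>S. 0 < u s"
    proof (rule ccontr)
      assume "\<not> (\<exists>s\<in>S. 0 < u s)"
      then have le: "\<forall>s\<in>S. u s \<le> 0" by force
      have "0 = \<xi> (\<Sum>s\<in>S. u s *\<^sub>R s)" by (simp add: u(2) linear_0[OF assms(2)])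
      also have "\<dots> = (\<Sum>s\<in>S. u s * \<xi> s)" by (simp add: linear_sum[OF assms(2)] linear_scale[OF assms(2)])
      finally have "(\<Sum>s\<in>S. - (u s * \<xi> s)) = 0" by (simp add: sum_negf)
      then have "\<forall>s\<in>S. - (u s * \<xi> s) = 0"
        using le psubset.prems(1) psubset.hyps
        by (subst (asm) sum_nonneg_eq_0_iff) (auto intro: mult_nonpos_nonneg less_imp_le)
      then show False using u(1) psubset.prems(1) by force
    qed
    then have ne: "(\<lambda>s. l s / u s) ` {s \<in> S. 0 < u s} \<noteq> {}" by blast
    define t where "t = Min ((\<lambda>s. l s / u s) ` {s \<in> S. 0 < u s})"
    have "t \<in> (\<lambda>s. l s / u s) ` {s \<in> S. 0 < u s}"
      unfolding t_def using ne psubset.hyps by (intro Min_in) auto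
    then obtain s0 where s0: "s0 \<in> S" "0 < u s0" "t = l s0 / u s0" by auto
    have t0: "0 \<le> t" using s0 psubset.prems(2) by simp
    define l' where "l' s = l s - t * u s" for s
    have l'0: "l' s0 = 0" using s0 by (simp add: l'_def)
    have l': "0 \<le> l' s" if s: "s \<in> S" for s
    proof (cases "0 < u s")
      case True
      then have "t \<le> l s / u s" unfolding t_def using s psubset.hyps by (intro Min_le) auto
      then show ?thesis using True by (simp add: l'_def field_simps)
    next
      case False
      then have "t * u s \<le> 0" using t0 by (simp add: mult_nonneg_nonpos)
      then show ?thesis using psubset.prems(2)[OF s] by (simp add: l'_def)
    qed
    have "S - {s0} \<subset> S" using s0(1) by blast
    from psubset.IH[OF this, of l'] obtain T \<mu> where T: "T \<subseteq> S - {s0}" "independent T" "\<forall>s\<in>T. 0 \<le> \<mu> s"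
      "(\<Sum>s\<in>T. \<mu> s *\<^sub>R s) = (\<Sum>s\<in>S - {s0}. l' s *\<^sub>R s)"
      "(\<Sum>s\<in>T. cost s * \<mu> s) \<le> (\<Sum>s\<in>S - {s0}. cost s * l' s)"
      using psubset.prems(1) l' by auto
    have "(\<Sum>s\<in>S - {s0}. l' s *\<^sub>R s) = (\<Sum>s\<in>S. l' s *\<^sub>R s)"
      using sum.remove[OF psubset.hyps s0(1), of "\<lambda>s. l' s *\<^sub>R s"] l'0 by simp
    also have "\<dots> = (\<Sum>s\<in>S. l s *\<^sub>R s) - t *\<^sub>R (\<Sum>s\<in>S. u s *\<^sub>R s)"
      by (simp add: l'_def scaleR_diff_left sum_subtractf scaleR_sum_right)
    finally have 1: "(\<Sum>s\<in>S - {s0}. l' s *\<^sub>R s) = (\<Sum>s\<in>S. l s *\<^sub>R s)" by (simp add: u(2))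
    have "(\<Sum>s\<in>S - {s0}. cost s * l' s) = (\<Sum>s\<in>S. cost s * l' s)"
      using sum.remove[OF psubset.hyps s0(1), of "\<lambda>s. cost s * l' s"] l'0 by simp
    also have "\<dots> = (\<Sum>s\<in>S. cost s * l s) - t * (\<Sum>s\<in>S. cost s * u s)"
      by (simp add: l'_def right_diff_distrib sum_subtractf sum_distrib_left mult.left_commute)
    also have "\<dots> \<le> (\<Sum>s\<in>S. cost s * l s)" using t0 u(3) by simp
    finally show ?thesis using T 1 by (intro exI[of _ T] exI[of _ \<mu>]) auto
  qed
qed

text \<open>
  The functionals \<open>dual \<sigma> u\<close> with \<open>u \<in> \<sigma>\<close> are a dual basis of the independent set \<open>\<sigma>\<close>, extended
  to the whole space in an arbitrary way.
\<close>

definition dual :: "'e::real_vector set \<Rightarrow> 'e \<Rightarrow> 'e \<Rightarrow> real" where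
  "dual \<sigma> u = (SOME f. linear f \<and> (\<forall>y\<in>\<sigma>. f y = (if y = u then 1 else 0)))"

lemma dual:
  assumes "independent \<sigma>"
  shows "linear (dual \<sigma> u)" "y \<in> \<sigma> \<Longrightarrow> dual \<sigma> u y = (if y = u then 1 else 0)"
proof -
  have "\<exists>f. linear f \<and> (\<forall>y\<in>\<sigma>. f y = (if y = u then 1 else 0 :: real))"
    by (rule linear_independent_extend[OF assms, of "\<lambda>y. if y = u then 1 else 0"])
  then have "linear (dual \<sigma> u) \<and> (\<forall>y\<in>\<sigma>. dual \<sigma> u y = (if y = u then 1 else 0))"
    unfolding dual_def by (rule someI_ex)
  then show "linear (dual \<sigma> u)" "y \<in> \<sigma> \<Longrightarrow> dual \<sigma> u y = (if y = u then 1 else 0)" by auto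
qed

lemma dual_simps:
  assumes "independent \<sigma>"
  shows "dual \<sigma> u (x + y) = dual \<sigma> u x + dual \<sigma> u y" "dual \<sigma> u (x - y) = dual \<sigma> u x - dual \<sigma> u y"
    "dual \<sigma> u (r *\<^sub>R x) = r * dual \<sigma> u x" "dual \<sigma> u 0 = 0"
  using dual(1)[OF assms, of u] by (auto simp: linear_add linear_diff linear_scale linear_0)

lemma dual_combination:
  assumes "independent \<sigma>" "finite \<sigma>" "\<tau> \<subseteq> \<sigma>" "u \<in> \<sigma>"
  shows "dual \<sigma> u (\<Sum>y\<in>\<tau>. l y *\<^sub>R y) = (if u \<in> \<tau> then l u else 0)"
proof -
  have fin: "finite \<tau>" using assms finite_subset by blast
  have "dual \<sigma> u (\<Sum>y\<in>\<tau>. l y *\<^sub>R y) = (\<Sum>y\<in>\<tau>. l y * dual \<sigma> u y)"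
    by (simp add: linear_sum[OF dual(1)[OF assms(1)]] linear_scale[OF dual(1)[OF assms(1)]])
  also have "\<dots> = (\<Sum>y\<in>\<tau>. if y = u then l y else 0)"
    using assms(3) dual(2)[OF assms(1)] by (intro sum.cong) auto
  finally show ?thesis using fin by simp
qed

lemma dual_expand:
  assumes "independent \<sigma>" "finite \<sigma>" "x \<in> span \<sigma>"
  shows "x = (\<Sum>u\<in>\<sigma>. dual \<sigma> u x *\<^sub>R u)"
proof -
  obtain l where l: "x = (\<Sum>u\<in>\<sigma>. l u *\<^sub>R u)" using assms(3) span_finite[OF assms(2)] by auto
  have "dual \<sigma> u x = l u" if "u \<in> \<sigma>" for u
    unfolding l using dual_combination[OF assms(1,2) order_refl that] that by simp
  then show ?thesis using l by simp
qed

lemma combination_in_cone: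
  "finite \<sigma> \<Longrightarrow> (\<And>u. u \<in> \<sigma> \<Longrightarrow> 0 \<le> l u) \<Longrightarrow> (\<Sum>u\<in>\<sigma>. l u *\<^sub>R u) \<in> convex_cone hull \<sigma>"
proof -
  assume *: "finite \<sigma>" "\<And>u. u \<in> \<sigma> \<Longrightarrow> 0 \<le> l u"
  have "(\<Sum>u\<in>\<tau>. l u *\<^sub>R u) \<in> convex_cone hull \<sigma>" if "finite \<tau>" "\<tau> \<subseteq> \<sigma>" for \<tau>
    using that
    by induction (auto intro!: convex_cone_hull_add convex_cone_hull_mul convex_cone_hull_contains_0
        intro: hull_inc *)
  then show ?thesis using * by blast
qed

lemma simplicial_cone_iff:
  assumes "independent \<sigma>" "finite \<sigma>"
  shows "x \<in> convex_cone hull \<sigma> \<longleftrightarrow> x \<in> span \<sigma> \<and> (\<forall>u\<in>\<sigma>. 0 \<le> dual \<sigma> u x)"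
proof
  assume x: "x \<in> convex_cone hull \<sigma>"
  have "convex_cone {x. x \<in> span \<sigma> \<and> (\<forall>u\<in>\<sigma>. 0 \<le> dual \<sigma> u x)}"
    unfolding convex_cone_iff by (auto simp: dual_simps[OF assms(1)] span_add span_scale span_zero)
  moreover have "\<sigma> \<subseteq> {x. x \<in> span \<sigma> \<and> (\<forall>u\<in>\<sigma>. 0 \<le> dual \<sigma> u x)}"
    using dual(2)[OF assms(1)] by (auto simp: span_base)
  ultimately have "convex_cone hull \<sigma> \<subseteq> {x. x \<in> span \<sigma> \<and> (\<forall>u\<in>\<sigma>. 0 \<le> dual \<sigma> u x)}"
    by (rule hull_minimal[rotated])
  then show "x \<in> span \<sigma> \<and> (\<forall>u\<in>\<sigma>. 0 \<le> dual \<sigma> u x)" using x by blast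
next
  assume x: "x \<in> span \<sigma> \<and> (\<forall>u\<in>\<sigma>. 0 \<le> dual \<sigma> u x)"
  then have "(\<Sum>u\<in>\<sigma>. dual \<sigma> u x *\<^sub>R u) \<in> convex_cone hull \<sigma>"
    by (intro combination_in_cone[OF assms(2)]) blast
  then show "x \<in> convex_cone hull \<sigma>" using dual_expand[OF assms] x by simp
qed

lemma continuous_dual:
  fixes \<sigma> :: "'e::euclidean_space set"
  shows "independent \<sigma> \<Longrightarrow> continuous_on A (dual \<sigma> u)"
  by (rule linear_continuous_on[OF linear_conv_bounded_linear[THEN iffD1, OF dual(1)]])

text \<open>
  In dual coordinates a simplicial cone is an orthant. It is closed, and a point with a vanishing
  coordinate is not interior, since one leaves the cone by subtracting a small multiple of the
  corresponding generator.
\<close>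

lemma frontier_simplicial_cone:
  fixes \<sigma> :: "'e::euclidean_space set"
  assumes ind: "independent \<sigma>" and V: "span \<sigma> = V"
  shows "top_of_set V frontier_of (convex_cone hull \<sigma>)
    = {x \<in> V. (\<forall>u\<in>\<sigma>. 0 \<le> dual \<sigma> u x) \<and> (\<exists>u\<in>\<sigma>. dual \<sigma> u x = 0)}"
proof -
  have fin: "finite \<sigma>" using ind by (rule independent_imp_finite)
  let ?K = "convex_cone hull \<sigma>"
  have K: "?K = {x \<in> V. \<forall>u\<in>\<sigma>. 0 \<le> dual \<sigma> u x}"
    using simplicial_cone_iff[OF ind fin] V by blast
  have "closed ?K" using fin by (rule closed_convex_cone_hull)
  moreover have KV: "?K \<subseteq> V" using K by blast
  ultimately have "closedin (top_of_set V) ?K" by (rule closed_subset[rotated])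
  then have clo: "top_of_set V closure_of ?K = ?K" by (simp add: closure_of_closedin)
  have "top_of_set V interior_of ?K = {x \<in> V. \<forall>u\<in>\<sigma>. 0 < dual \<sigma> u x}" (is "_ = ?P")
  proof
    have "openin (top_of_set V) ?P"
    proof -
      have "open (\<Inter>u\<in>\<sigma>. {x. 0 < dual \<sigma> u x})"
        using fin by (intro open_INT ballI open_Collect_less continuous_on_const continuous_dual[OF ind]) auto
      moreover have "?P = V \<inter> (\<Inter>u\<in>\<sigma>. {x. 0 < dual \<sigma> u x})" by auto
      ultimately show ?thesis by (metis openin_open)
    qed
    then show "?P \<subseteq> top_of_set V interior_of ?K"
      using K by (intro interior_of_maximal) (auto intro: less_imp_le)
    show "top_of_set V interior_of ?K \<subseteq> ?P"
    proof
      fix x assume x: "x \<in> top_of_set V interior_of ?K"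
      have op: "openin (top_of_set V) (top_of_set V interior_of ?K)" by simp
      have sub: "top_of_set V interior_of ?K \<subseteq> ?K" by (rule interior_of_subset)
      obtain e where e: "e > 0" "\<And>y. y \<in> V \<Longrightarrow> dist y x < e \<Longrightarrow> y \<in> ?K"
        using op x sub unfolding openin_euclidean_subtopology_iff by (meson subsetD)
      have xK: "x \<in> V" "\<forall>u\<in>\<sigma>. 0 \<le> dual \<sigma> u x" using x sub K by blast+
      have "0 < dual \<sigma> u x" if u: "u \<in> \<sigma>" for u
      proof -
        have "u \<noteq> 0" using ind u dependent_zero by blast
        define t where "t = e / (2 * norm u)"
        have t: "t > 0" "t * norm u < e" using e(1) \<open>u \<noteq> 0\<close> by (simp_all add: t_def)
        have "x - t *\<^sub>R u \<in> V"
          using xK(1) u V by (metis span_base span_diff span_scale)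
        moreover have "dist (x - t *\<^sub>R u) x < e" using t by (simp add: dist_norm)
        ultimately have "x - t *\<^sub>R u \<in> ?K" by (rule e(2))
        then have "0 \<le> dual \<sigma> u (x - t *\<^sub>R u)" using K u by blast
        then show ?thesis using t(1) dual(2)[OF ind u, of u] by (simp add: dual_simps[OF ind])
      qed
      then show "x \<in> ?P" using xK by blast
    qed
  qed
  then show ?thesis unfolding frontier_of_def clo using K by force
qed

section \<open>Difference equations and vector partition functions\<close>

text \<open>
  Multiplication of a formal series with coefficients \<open>f\<close> by \<open>1 - t\<^sup>g\<close>.
\<close>

definition diff_op :: "'a::ab_group_add \<Rightarrow> ('a \<Rightarrow> 'b::ab_group_add) \<Rightarrow> 'a \<Rightarrow> 'b" where
  "diff_op g f x = f x - f (x - g)"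

lemma diff_op_comm: "diff_op g (diff_op h f) = diff_op h (diff_op g f)"
  by (auto simp: diff_op_def fun_eq_iff algebra_simps)

lemma diff_op_shift: "diff_op g (\<lambda>x. f (x - b)) = (\<lambda>x. diff_op g f (x - b))"
  by (auto simp: diff_op_def fun_eq_iff algebra_simps)

text \<open>
  Exponents are taken from \<open>G\<close> modulo \<open>K\<close>. The map \<open>w\<close> gives their position in a real vector space,
  and \<open>\<xi>\<close> is a functional that is positive on the generators that occur, so that the series
  supported above some level of \<open>\<xi>\<close> can be divided by \<open>1 - t\<^sup>g\<close>.
\<close>

locale graded_group = module scale
  for scale :: "int \<Rightarrow> 'a::ab_group_add \<Rightarrow> 'a" +
  fixes G K :: "'a set" and w :: "'a \<Rightarrow> 'e::real_vector" and \<xi> :: "'e \<Rightarrow> real"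
  assumes subspace_G: "subspace G" and subspace_K: "subspace K" and K_subset: "K \<subseteq> G"
    and w_add: "\<And>x y. x \<in> G \<Longrightarrow> y \<in> G \<Longrightarrow> w (x + y) = w x + w y"
    and w_K: "\<And>x. x \<in> K \<Longrightarrow> w x = 0"
    and linear_xi: "linear \<xi>"
begin

lemma G_add: "x \<in> G \<Longrightarrow> y \<in> G \<Longrightarrow> x + y \<in> G"
  and G_diff: "x \<in> G \<Longrightarrow> y \<in> G \<Longrightarrow> x - y \<in> G"
  and G_neg: "x \<in> G \<Longrightarrow> - x \<in> G"
  and G_scale: "x \<in> G \<Longrightarrow> scale k x \<in> G"
  and G_0: "0 \<in> G"
  and G_sum: "(\<And>i. i \<in> A \<Longrightarrow> f i \<in> G) \<Longrightarrow> sum f A \<in> G"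
  using subspace_G
  by (auto intro: subspace_add subspace_diff subspace_neg subspace_scale subspace_0 subspace_sum)

lemma K_add: "x \<in> K \<Longrightarrow> y \<in> K \<Longrightarrow> x + y \<in> K"
  and K_diff: "x \<in> K \<Longrightarrow> y \<in> K \<Longrightarrow> x - y \<in> K"
  and K_neg: "x \<in> K \<Longrightarrow> - x \<in> K"
  and K_scale: "x \<in> K \<Longrightarrow> scale k x \<in> K"
  and K_0: "0 \<in> K"
  using subspace_K
  by (auto intro: subspace_add subspace_diff subspace_neg subspace_scale subspace_0)

lemma G_sum_list: "set Y \<subseteq> G \<Longrightarrow> sum_list Y \<in> G"
  by (induction Y) (auto intro: G_0 G_add)

lemma w_0: "w 0 = 0"
  using w_K[OF K_0] .

lemma w_neg: "x \<in> G \<Longrightarrow> w (- x) = - w x"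
  using w_add[of x "- x"] by (simp add: G_neg w_0 add_eq_0_iff)

lemma w_diff: "x \<in> G \<Longrightarrow> y \<in> G \<Longrightarrow> w (x - y) = w x - w y"
  using w_add[of x "- y"] by (simp add: G_neg w_neg)

lemma w_scale: "x \<in> G \<Longrightarrow> w (scale k x) = of_int k *\<^sub>R w x"
proof (induction k rule: int_induct[where k = 0])
  case base then show ?case by (simp add: w_0)
next
  case (step1 i) then show ?case
    by (simp add: scale_left_distrib w_add G_scale algebra_simps)
next
  case (step2 i) then show ?case
    by (simp add: scale_left_diff_distrib w_diff G_scale algebra_simps)
qed

lemma w_sum: "(\<And>i. i \<in> A \<Longrightarrow> f i \<in> G) \<Longrightarrow> w (sum f A) = (\<Sum>i\<in>A. w (f i))"
  by (induction A rule: infinite_finite_induct) (auto simp: w_0 w_add G_sum)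

lemma xi_simps: "\<xi> (x + y) = \<xi> x + \<xi> y" "\<xi> (x - y) = \<xi> x - \<xi> y" "\<xi> (- x) = - \<xi> x"
  "\<xi> (r *\<^sub>R x) = r * \<xi> x" "\<xi> 0 = 0" "\<xi> (sum f A) = (\<Sum>i\<in>A. \<xi> (f i))"
  using linear_xi
  by (auto simp: linear_add linear_diff linear_neg linear_scale linear_0 linear_sum)

definition pos :: "'a \<Rightarrow> bool" where
  "pos g \<longleftrightarrow> g \<in> G \<and> 0 < \<xi> (w g)"

definition bounded_supp :: "('a \<Rightarrow> 'b::zero) \<Rightarrow> bool" where
  "bounded_supp f \<longleftrightarrow> (\<exists>m. \<forall>x. f x \<noteq> 0 \<longrightarrow> x \<in> G \<and> m \<le> \<xi> (w x))"

lemma bounded_supp_combine: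
  assumes "bounded_supp f" "bounded_supp h" "\<And>x. f x = 0 \<Longrightarrow> h x = 0 \<Longrightarrow> k x = 0"
  shows "bounded_supp k"
proof -
  obtain m m' where m: "\<And>x. f x \<noteq> 0 \<Longrightarrow> x \<in> G \<and> m \<le> \<xi> (w x)"
    and m': "\<And>x. h x \<noteq> 0 \<Longrightarrow> x \<in> G \<and> m' \<le> \<xi> (w x)"
    using assms by (auto simp: bounded_supp_def)
  have "x \<in> G \<and> min m m' \<le> \<xi> (w x)" if "k x \<noteq> 0" for x
    using m[of x] m'[of x] assms(3)[of x] that by (cases "f x = 0") (auto simp: min_le_iff_disj)
  then show ?thesis by (auto simp: bounded_supp_def)
qed

lemma bounded_supp_shift:
  assumes "bounded_supp f" "b \<in> G"
  shows "bounded_supp (\<lambda>x. f (x - b))"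
proof -
  obtain m where m: "\<And>x. f x \<noteq> 0 \<Longrightarrow> x \<in> G \<and> m \<le> \<xi> (w x)"
    using assms by (auto simp: bounded_supp_def)
  have "x \<in> G \<and> m + \<xi> (w b) \<le> \<xi> (w x)" if "f (x - b) \<noteq> 0" for x
  proof -
    have "x = (x - b) + b" by simp
    then have "x \<in> G" using m[OF that] assms(2) G_add by metis
    then show ?thesis using m[OF that] assms(2) by (simp add: w_diff xi_simps)
  qed
  then show ?thesis by (auto simp: bounded_supp_def)
qed

lemma bounded_supp_diff_op:
  assumes "bounded_supp f" "g \<in> G" shows "bounded_supp (diff_op g f)"
  by (rule bounded_supp_combine[OF assms(1) bounded_supp_shift[OF assms]])
    (auto simp: diff_op_def)

lemma bounded_supp_add:
  fixes f h :: "'a \<Rightarrow> 'b::monoid_add"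
  shows "bounded_supp f \<Longrightarrow> bounded_supp h \<Longrightarrow> bounded_supp (\<lambda>x. f x + h x)"
  by (erule bounded_supp_combine) auto

lemma bounded_supp_uminus:
  fixes f :: "'a \<Rightarrow> 'b::group_add"
  shows "bounded_supp f \<Longrightarrow> bounded_supp (\<lambda>x. - f x)"
  by (rule bounded_supp_combine[of f f]) auto

lemma bounded_supp_mult:
  fixes f :: "'a \<Rightarrow> 'b::mult_zero"
  shows "bounded_supp f \<Longrightarrow> bounded_supp (\<lambda>x. k * f x)"
  by (rule bounded_supp_combine[of f f]) auto

lemma bounded_supp_sum:
  fixes f :: "'i \<Rightarrow> 'a \<Rightarrow> 'b::comm_monoid_add"
  assumes "\<And>i. i \<in> A \<Longrightarrow> bounded_supp (f i)"
  shows "bounded_supp (\<lambda>x. \<Sum>i\<in>A. f i x)"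
  using assms
  by (induction A rule: infinite_finite_induct)
    (simp_all add: bounded_supp_add, simp_all add: bounded_supp_def)

lemma eventually_zero:
  assumes "bounded_supp f" "pos g"
  obtains N where "\<And>j. j \<ge> N \<Longrightarrow> f (x - scale (int j) g) = 0"
proof -
  obtain m where m: "\<And>x. f x \<noteq> 0 \<Longrightarrow> x \<in> G \<and> m \<le> \<xi> (w x)"
    using assms by (auto simp: bounded_supp_def)
  have g: "g \<in> G" "0 < \<xi> (w g)" using assms by (auto simp: pos_def)
  obtain N :: nat where N: "(\<xi> (w x) - m) / \<xi> (w g) < real N"
    using reals_Archimedean2 by blast
  have "f (x - scale (int j) g) = 0" if "j \<ge> N" for j
  proof (rule ccontr)
    assume nz: "f (x - scale (int j) g) \<noteq> 0"
    have "(x - scale (int j) g) + scale (int j) g \<in> G"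
      using m[OF nz] G_scale[OF g(1)] G_add by blast
    then have x: "x \<in> G" by simp
    have "m \<le> \<xi> (w x) - real j * \<xi> (w g)"
      using m[OF nz] x g by (simp add: w_diff w_scale G_scale xi_simps)
    moreover have "\<xi> (w x) - m < real N * \<xi> (w g)" using N g(2) by (simp add: divide_simps)
    moreover have "real N * \<xi> (w g) \<le> real j * \<xi> (w g)" using that g(2) by simp
    ultimately show False by linarith
  qed
  then show ?thesis using that by blast
qed

text \<open>
  The equation says that \<open>f\<close> is constant along the direction \<open>g\<close>, and far down in this direction \<open>f\<close>
  vanishes. This is why all the series below can be handled through the difference equations that
  they satisfy.
\<close>

lemma diff_op_eq_0:
  assumes "bounded_supp f" "pos g" "diff_op g f = (\<lambda>x. 0)"
  shows "f = (\<lambda>x. 0)"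
proof
  fix x
  have step: "f y = f (y - g)" for y
    using fun_cong[OF assms(3), of y] by (simp add: diff_op_def)
  have iter: "f x = f (x - scale (int j) g)" for j
  proof (induction j)
    case (Suc j)
    have "x - scale (int (Suc j)) g = x - scale (int j) g - g"
      by (simp add: scale_left_distrib algebra_simps)
    then show ?case using step[of "x - scale (int j) g"] Suc by (simp only:)
  qed simp
  obtain N where N: "\<And>j. j \<ge> N \<Longrightarrow> f (x - scale (int j) g) = 0"
    using eventually_zero[OF assms(1,2)] by blast
  show "f x = 0" using iter[of N] N[of N] by (simp only: order_refl)
qed

lemma diff_op_unique:
  assumes "bounded_supp f" "bounded_supp f'" "pos g" "diff_op g f = diff_op g f'"
  shows "f = f'"
proof -
  have "bounded_supp (\<lambda>x. f x - f' x)"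
    by (rule bounded_supp_combine[OF assms(1,2)]) simp
  moreover have "diff_op g (\<lambda>x. f x - f' x) = (\<lambda>x. 0)"
    using fun_cong[OF assms(4)] by (simp add: diff_op_def fun_eq_iff algebra_simps)
  ultimately have "(\<lambda>x. f x - f' x) = (\<lambda>x. 0)" using diff_op_eq_0 assms(3) by blast
  then show ?thesis by (auto simp: fun_eq_iff)
qed

text \<open>
  The same uniqueness for series that are bounded from above, the expansions at infinity.
\<close>

lemma diff_op_unique_reflected:
  assumes "bounded_supp (\<lambda>x. f (- x))" "bounded_supp (\<lambda>x. f' (- x))" "pos g"
    "diff_op g f = diff_op g f'"
  shows "f = f'"
proof -
  have "f (- x) - f (- (x - g)) = f' (- x) - f' (- (x - g))" for x
    using fun_cong[OF assms(4), of "g - x"] by (simp add: diff_op_def algebra_simps)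
  then have "diff_op g (\<lambda>x. f (- x)) = diff_op g (\<lambda>x. f' (- x))"
    by (auto simp: diff_op_def fun_eq_iff)
  from diff_op_unique[OF assms(1-3) this] have "f (- (- x)) = f' (- (- x))" for x
    by (rule fun_cong)
  then show ?thesis by auto
qed

text \<open>
  Multiplication of a series by \<open>1/(1 - t\<^sup>g) = \<Sum>\<^sub>j t\<^sup>j\<^sup>g\<close>. Only the nonzero terms are summed, which makes
  the sum finite.
\<close>

definition cumul :: "'a \<Rightarrow> ('a \<Rightarrow> 'b::ab_group_add) \<Rightarrow> 'a \<Rightarrow> 'b" where
  "cumul g f x = (\<Sum>j | f (x - scale (int j) g) \<noteq> 0. f (x - scale (int j) g))"

lemma cumul_nonzero:
  assumes "cumul g f x \<noteq> 0"
  obtains j where "f (x - scale (int j) g) \<noteq> 0"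
  using assms by (auto simp: cumul_def elim: sum.not_neutral_contains_not_neutral)

lemma diff_op_cumul:
  assumes "bounded_supp f" "pos g"
  shows "diff_op g (cumul g f) = f"
proof
  fix x
  obtain N where N: "\<And>j. j \<ge> N \<Longrightarrow> f (x - scale (int j) g) = 0"
    using eventually_zero[OF assms] by blast
  obtain N' where N': "\<And>j. j \<ge> N' \<Longrightarrow> f (x - g - scale (int j) g) = 0"
    using eventually_zero[OF assms] by blast
  define M where "M = max N N'"
  have "cumul g f x = (\<Sum>j<Suc M. f (x - scale (int j) g))"
    unfolding cumul_def
  proof (rule sum.mono_neutral_left)
    have "j < Suc M" if "f (x - scale (int j) g) \<noteq> 0" for j
      using N[of j] that unfolding M_def by (cases "N \<le> j") auto
    then show "{j. f (x - scale (int j) g) \<noteq> 0} \<subseteq> {..<Suc M}" by blast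
  qed simp_all
  also have "\<dots> = f x + (\<Sum>j<M. f (x - g - scale (int j) g))"
    by (simp only: sum.lessThan_Suc_shift) (simp add: scale_left_distrib diff_diff_eq)
  also have "(\<Sum>j<M. f (x - g - scale (int j) g)) = cumul g f (x - g)"
    unfolding cumul_def
  proof (rule sum.mono_neutral_right)
    have "j < M" if "f (x - g - scale (int j) g) \<noteq> 0" for j
      using N'[of j] that unfolding M_def by (cases "N' \<le> j") auto
    then show "{j. f (x - g - scale (int j) g) \<noteq> 0} \<subseteq> {..<M}" by blast
  qed simp_all
  finally show "diff_op g (cumul g f) x = f x" by (simp add: diff_op_def)
qed

lemma bounded_supp_cumul:
  assumes "bounded_supp f" "pos g"
  shows "bounded_supp (cumul g f)"
proof -
  obtain m where m: "\<And>x. f x \<noteq> 0 \<Longrightarrow> x \<in> G \<and> m \<le> \<xi> (w x)"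
    using assms by (auto simp: bounded_supp_def)
  have g: "g \<in> G" "0 < \<xi> (w g)" using assms by (auto simp: pos_def)
  have "x \<in> G \<and> m \<le> \<xi> (w x)" if nz: "cumul g f x \<noteq> 0" for x
  proof -
    obtain j where j: "f (x - scale (int j) g) \<noteq> 0" using cumul_nonzero[OF nz] .
    have "(x - scale (int j) g) + scale (int j) g \<in> G"
      using m[OF j] G_scale[OF g(1)] G_add by blast
    then have x: "x \<in> G" by simp
    have "m \<le> \<xi> (w x) - real j * \<xi> (w g)"
      using m[OF j] x g by (simp add: w_diff w_scale G_scale xi_simps)
    moreover have "0 \<le> real j * \<xi> (w g)" using g by simp
    ultimately show ?thesis using x by linarith
  qed
  then show ?thesis by (auto simp: bounded_supp_def)
qed

text \<open>
  The vector partition function of a list of generators: the coefficients of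
  \<open>1 / \<Prod>\<^sub>g\<^sub>\<in>\<^sub>Y (1 - t\<^sup>g)\<close> as a series with exponents modulo \<open>K\<close>.
\<close>

definition pf :: "'a list \<Rightarrow> 'a \<Rightarrow> real" where
  "pf Y = foldr cumul Y (indicator K)"

lemma pf_Nil: "pf [] = indicator K" and pf_Cons: "pf (g # Y) = cumul g (pf Y)"
  by (simp_all add: pf_def)

lemma bounded_supp_indicator: "bounded_supp (indicator K :: 'a \<Rightarrow> real)"
  using K_subset w_K by (force simp: bounded_supp_def indicator_def xi_simps)

lemma bounded_supp_pf: "list_all pos Y \<Longrightarrow> bounded_supp (pf Y)"
  by (induction Y) (auto simp: pf_Nil pf_Cons bounded_supp_indicator bounded_supp_cumul)

lemma diff_op_pf_Cons: "list_all pos (g # Y) \<Longrightarrow> diff_op g (pf (g # Y)) = pf Y"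
  by (simp add: pf_Cons diff_op_cumul bounded_supp_pf)

lemma list_all_remove1: "list_all P Y \<Longrightarrow> list_all P (remove1 x Y)"
  by (induction Y) auto

lemma pos_G: "pos g \<Longrightarrow> g \<in> G" by (simp add: pos_def)

lemma diff_op_pf: "list_all pos Y \<Longrightarrow> g \<in> set Y \<Longrightarrow> diff_op g (pf Y) = pf (remove1 g Y)"
proof (induction Y)
  case (Cons a Z)
  show ?case
  proof (cases "g = a")
    case True
    then show ?thesis using diff_op_pf_Cons[of a Z] Cons.prems by simp
  next
    case False
    then have gZ: "g \<in> set Z" using Cons.prems by simp
    have posZ: "list_all pos Z" "pos a" and posg: "pos g"
      using Cons.prems by (auto simp: list_all_iff)
    have "diff_op a (diff_op g (pf (a # Z))) = diff_op g (pf Z)"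
      using diff_op_pf_Cons[OF Cons.prems(1)] by (metis diff_op_comm)
    also have "\<dots> = pf (remove1 g Z)" using Cons.IH[OF posZ(1) gZ] .
    also have "\<dots> = diff_op a (pf (a # remove1 g Z))"
      using posZ by (simp add: diff_op_pf_Cons list_all_remove1)
    finally have eq: "diff_op a (diff_op g (pf (a # Z))) = diff_op a (pf (a # remove1 g Z))" .
    have "bounded_supp (diff_op g (pf (a # Z)))"
      using bounded_supp_diff_op bounded_supp_pf[OF Cons.prems(1)] pos_G[OF posg] by blast
    moreover have "bounded_supp (pf (a # remove1 g Z))"
      using posZ by (intro bounded_supp_pf) (simp add: list_all_remove1)
    ultimately have "diff_op g (pf (a # Z)) = pf (a # remove1 g Z)"
      using diff_op_unique[OF _ _ posZ(2) eq] by blast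
    then show ?thesis using False by simp
  qed
qed simp

lemma pf_perm: "list_all pos Y \<Longrightarrow> mset Y = mset Y' \<Longrightarrow> pf Y = pf Y'"
proof (induction Y arbitrary: Y')
  case (Cons g Z)
  have sets: "set Y' = set (g # Z)" using mset_eq_setD[OF Cons.prems(2)] by simp
  have posY': "list_all pos Y'" using Cons.prems(1) sets by (simp add: list_all_iff)
  have gY': "g \<in> set Y'" using sets by simp
  have "mset Z = mset (remove1 g Y')" using Cons.prems(2)[symmetric] by simp
  then have "pf Z = pf (remove1 g Y')"
    using Cons.IH[of "remove1 g Y'"] Cons.prems(1) by simp
  then have eq: "diff_op g (pf (g # Z)) = diff_op g (pf Y')"
    using diff_op_pf[OF posY' gY'] diff_op_pf_Cons[OF Cons.prems(1)] by simp
  have "pos g" using Cons.prems(1) by simp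
  then show ?case
    using diff_op_unique[OF bounded_supp_pf[OF Cons.prems(1)] bounded_supp_pf[OF posY'] _ eq] by blast
qed simp

lemma pf_periodic: "k \<in> K \<Longrightarrow> pf Y (x + k) = pf Y x"
proof (induction Y arbitrary: x)
  case Nil
  have "x + k \<in> K \<longleftrightarrow> x \<in> K" using K_add[of x k] K_diff[of "x + k" k] Nil by auto
  then show ?case by (simp add: pf_Nil indicator_def)
next
  case (Cons g Y)
  have "pf Y (x + k - scale (int j) g) = pf Y (x - scale (int j) g)" for j
    using Cons.IH[of "x - scale (int j) g"] Cons.prems by (simp add: algebra_simps)
  then show ?case by (simp add: pf_Cons cumul_def)
qed

lemma pf_supp:
  assumes "set Y \<subseteq> G" "pf Y x \<noteq> 0"
  shows "x \<in> G \<and> w x \<in> convex_cone hull (w ` set Y)"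
  using assms
proof (induction Y arbitrary: x)
  case Nil
  then show ?case using w_K K_subset by (auto simp: pf_Nil indicator_def split: if_splits)
next
  case (Cons g Y)
  obtain j where "pf Y (x - scale (int j) g) \<noteq> 0"
    using Cons.prems(2) unfolding pf_Cons by (rule cumul_nonzero)
  then have *: "x - scale (int j) g \<in> G" "w (x - scale (int j) g) \<in> convex_cone hull (w ` set Y)"
    using Cons by auto
  have g: "g \<in> G" using Cons.prems by simp
  have "(x - scale (int j) g) + scale (int j) g \<in> G" using * g G_add G_scale by blast
  then have x: "x \<in> G" by simp
  have "w (x - scale (int j) g) \<in> convex_cone hull (w ` set (g # Y))"
    using *(2) hull_mono[of "w ` set Y" "w ` set (g # Y)"] by auto
  moreover have "real j *\<^sub>R w g \<in> convex_cone hull (w ` set (g # Y))"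
    by (intro convex_cone_hull_mul hull_inc) auto
  ultimately have "w (x - scale (int j) g) + real j *\<^sub>R w g \<in> convex_cone hull (w ` set (g # Y))"
    by (rule convex_cone_hull_add)
  then show ?case using x g by (simp add: w_diff w_scale G_scale)
qed

text \<open>
  The coefficients of the expansion of the same rational function at infinity, because
  \<open>1/(1 - t\<^sup>g) = - t\<^sup>-\<^sup>g / (1 - t\<^sup>-\<^sup>g)\<close>.
\<close>

definition reflected_pf :: "'a list \<Rightarrow> 'a \<Rightarrow> real" where
  "reflected_pf Y x = (-1) ^ length Y * pf Y (- x - sum_list Y)"

lemma sum_list_remove1_eq: "g \<in> set Y \<Longrightarrow> sum_list Y = g + sum_list (remove1 g (Y :: 'a list))"
  by (induction Y) (auto simp: algebra_simps)

lemma diff_op_reflected_pf: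
  assumes "list_all pos Y" "g \<in> set Y"
  shows "diff_op g (reflected_pf Y) = reflected_pf (remove1 g Y)"
proof
  fix x
  let ?y = "- x - sum_list (remove1 g Y)"
  have s: "- x - sum_list Y = ?y - g" "- (x - g) - sum_list Y = ?y"
    using sum_list_remove1_eq[OF assms(2)] by (simp_all add: algebra_simps)
  have len: "length Y = Suc (length (remove1 g Y))"
    using length_pos_if_in_set[OF assms(2)] assms(2) by (simp add: length_remove1)
  have "diff_op g (reflected_pf Y) x = (-1) ^ length (remove1 g Y) * diff_op g (pf Y) ?y"
    unfolding diff_op_def reflected_pf_def s len by (simp add: algebra_simps)
  then show "diff_op g (reflected_pf Y) x = reflected_pf (remove1 g Y) x"
    using diff_op_pf[OF assms] by (simp add: reflected_pf_def)
qed

lemma reflected_pf_perm: "list_all pos Y \<Longrightarrow> mset Y = mset Y' \<Longrightarrow> reflected_pf Y = reflected_pf Y'"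
proof -
  assume *: "list_all pos Y" "mset Y = mset Y'"
  have "length Y = length Y'" "sum_list Y = sum_list Y'"
    using mset_eq_length[OF *(2)] arg_cong[OF *(2), of sum_mset] by (simp_all add: sum_mset_sum_list)
  then show "reflected_pf Y = reflected_pf Y'" using pf_perm[OF *] by (simp add: reflected_pf_def fun_eq_iff)
qed

lemma reflected_pf_periodic: "k \<in> K \<Longrightarrow> reflected_pf Y (x + k) = reflected_pf Y x"
  using pf_periodic[OF K_neg, of k Y "- x - sum_list Y"] by (simp add: reflected_pf_def algebra_simps)

lemma bounded_supp_reflected_pf:
  assumes "list_all pos Y" shows "bounded_supp (\<lambda>x. reflected_pf Y (- x))"
proof -
  have "set Y \<subseteq> G" using assms by (auto simp: list_all_iff pos_def)
  then show ?thesis unfolding reflected_pf_def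
    using assms by (simp add: bounded_supp_mult bounded_supp_shift bounded_supp_pf G_sum_list)
qed

end

section \<open>Partial fractions\<close>

context graded_group
begin

text \<open>
  Linear independence over the integers modulo \<open>K\<close>. It will imply linear independence over the
  reals of the images under \<open>w\<close>, because these are rational vectors.
\<close>

definition indep :: "'a set \<Rightarrow> bool" where
  "indep \<sigma> \<longleftrightarrow> (\<forall>k :: 'a \<Rightarrow> int. (\<Sum>u\<in>\<sigma>. scale (k u) u) \<in> K \<longrightarrow> (\<forall>u\<in>\<sigma>. k u = 0))"

lemma indep_empty: "indep {}"
  by (simp add: indep_def)

lemma indep_mono:
  assumes "indep \<tau>" "finite \<tau>" "\<sigma> \<subseteq> \<tau>"
  shows "indep \<sigma>"
  unfolding indep_def
proof (intro allI impI)
  fix k :: "'a \<Rightarrow> int"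
  assume k: "(\<Sum>u\<in>\<sigma>. scale (k u) u) \<in> K"
  have "(\<Sum>u\<in>\<tau>. scale (if u \<in> \<sigma> then k u else 0) u) = (\<Sum>u\<in>\<sigma>. scale (k u) u)"
    using assms(2,3) by (intro sum.mono_neutral_cong_right) auto
  then have "\<forall>u\<in>\<tau>. (if u \<in> \<sigma> then k u else 0) = 0"
    using k assms(1)[unfolded indep_def, THEN spec, of "\<lambda>u. if u \<in> \<sigma> then k u else 0"] by simp
  then show "\<forall>u\<in>\<sigma>. k u = 0" using assms(3) by (metis subsetD)
qed

lemma dependent_insert_obtains:
  assumes "finite \<sigma>" "indep \<sigma>" "\<not> indep (insert g \<sigma>)"
  obtains D k where "D > 0" "scale D g - (\<Sum>u\<in>\<sigma>. scale (k u) u) \<in> K"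
proof -
  have g: "g \<notin> \<sigma>" using assms by (metis insert_absorb)
  obtain k where k: "(\<Sum>u\<in>insert g \<sigma>. scale (k u) u) \<in> K" "\<not> (\<forall>u\<in>insert g \<sigma>. k u = 0)"
    using assms(3) unfolding indep_def by blast
  have k': "scale (k g) g + (\<Sum>u\<in>\<sigma>. scale (k u) u) \<in> K"
    using k(1) g assms(1) by simp
  have "k g \<noteq> 0"
  proof
    assume "k g = 0"
    then have "(\<Sum>u\<in>\<sigma>. scale (k u) u) \<in> K" using k' by simp
    then show False using assms(2) k(2) \<open>k g = 0\<close> unfolding indep_def by blast
  qed
  then consider "k g > 0" | "k g < 0" by linarith
  then show ?thesis
  proof cases
    case 1
    then show ?thesis using k' by (intro that[of "k g" "\<lambda>u. - k u"]) (simp_all add: sum_negf)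
  next
    case 2
    then show ?thesis using K_neg[OF k'] by (intro that[of "- k g" k]) simp_all
  qed
qed

lemma indep_exchange:
  assumes "finite \<sigma>" "indep \<sigma>" "u0 - (\<Sum>u\<in>\<sigma>. scale (k u) u) \<in> K"
    and "j \<in> \<sigma>" "k j \<noteq> 0" "j \<notin> \<tau>" "\<tau> \<subseteq> \<sigma>"
  shows "indep (insert u0 \<tau>)"
proof (cases "u0 \<in> \<tau>")
  case True
  then show ?thesis using indep_mono[OF assms(2,1,7)] by (simp add: insert_absorb)
next
  case False
  have fin: "finite \<tau>" using assms finite_subset by blast
  show ?thesis
    unfolding indep_def
  proof (intro allI impI)
    fix c :: "'a \<Rightarrow> int"
    assume "(\<Sum>u\<in>insert u0 \<tau>. scale (c u) u) \<in> K"
    then have c: "scale (c u0) u0 + (\<Sum>u\<in>\<tau>. scale (c u) u) \<in> K"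
      using False fin by simp
    have "(\<Sum>u\<in>\<tau>. scale (c u) u) = (\<Sum>u\<in>\<sigma>. scale (if u \<in> \<tau> then c u else 0) u)"
      using assms(1,7) by (intro sum.mono_neutral_cong_left) auto
    then have "(\<Sum>u\<in>\<sigma>. scale (c u0 * k u + (if u \<in> \<tau> then c u else 0)) u)
        = scale (c u0) (\<Sum>u\<in>\<sigma>. scale (k u) u) + (\<Sum>u\<in>\<tau>. scale (c u) u)"
      by (simp add: scale_left_distrib sum.distrib scale_sum_right)
    also have "\<dots> = (scale (c u0) u0 + (\<Sum>u\<in>\<tau>. scale (c u) u))
        - scale (c u0) (u0 - (\<Sum>u\<in>\<sigma>. scale (k u) u))"
      by (simp add: scale_right_diff_distrib)
    also have "\<dots> \<in> K" using K_diff[OF c K_scale[OF assms(3)]] .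
    finally have z: "\<forall>u\<in>\<sigma>. c u0 * k u + (if u \<in> \<tau> then c u else 0) = 0"
      using assms(2)[unfolded indep_def, THEN spec, of "\<lambda>u. c u0 * k u + (if u \<in> \<tau> then c u else 0)"]
      by blast
    have "c u0 = 0" using bspec[OF z assms(4)] assms(5,6) by simp
    then have "c u = 0" if "u \<in> \<tau>" for u using bspec[OF z, of u] that assms(7) by auto
    then show "\<forall>u\<in>insert u0 \<tau>. c u = 0" using \<open>c u0 = 0\<close> by simp
  qed
qed

end

locale generated_group = graded_group +
  fixes gens :: "'a set"
  assumes gens_pos: "\<And>g. g \<in> gens \<Longrightarrow> pos g"
    and gens_multiple: "\<And>g k. g \<in> gens \<Longrightarrow> 0 < k \<Longrightarrow> scale k g \<in> gens"
begin

lemma gens_G: "g \<in> gens \<Longrightarrow> g \<in> G" using gens_pos pos_def by blast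

lemma gens_list: "set Y \<subseteq> gens \<Longrightarrow> list_all pos Y"
  using gens_pos by (auto simp: list_all_iff)

text \<open>
  The pairs of expansions, at the origin and at infinity, of the rational functions that are
  combinations of monomials times \<open>1 / \<Prod>\<^sub>g\<^sub>\<in>\<^sub>Y (1 - t\<^sup>g)\<close> with independent exponents. Carrying both
  expansions along transports the partial fraction decomposition from the origin to infinity.
\<close>

inductive partial_fraction :: "('a \<Rightarrow> real) \<Rightarrow> ('a \<Rightarrow> real) \<Rightarrow> bool" where
  base: "set Y \<subseteq> gens \<Longrightarrow> indep (set Y) \<Longrightarrow> partial_fraction (pf Y) (reflected_pf Y)"
| add: "partial_fraction f f' \<Longrightarrow> partial_fraction h h' \<Longrightarrow> partial_fraction (\<lambda>x. f x + h x) (\<lambda>x. f' x + h' x)"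
| neg: "partial_fraction f f' \<Longrightarrow> partial_fraction (\<lambda>x. - f x) (\<lambda>x. - f' x)"
| shift: "partial_fraction f f' \<Longrightarrow> b \<in> G \<Longrightarrow> partial_fraction (\<lambda>x. f (x - b)) (\<lambda>x. f' (x - b))"

lemma partial_fraction_zero: "partial_fraction (\<lambda>x. 0) (\<lambda>x. 0)"
  using partial_fraction.add[OF partial_fraction.base[of "[]"] partial_fraction.neg[OF partial_fraction.base[of "[]"]]]
  by (simp add: indep_empty)

text \<open>
  This replaces explicit algebra with the factors \<open>1 - t\<^sup>g\<close>: it is the statement that
  \<open>1 - t\<^sup>g\<^sup>+\<^sup>h = (1 - t\<^sup>g) + t\<^sup>g (1 - t\<^sup>h)\<close> and \<open>1 - t\<^sup>-\<^sup>g = - t\<^sup>-\<^sup>g (1 - t\<^sup>g)\<close>, so that \<open>1 - t\<^sup>u\<close> lies in the ideal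
  generated by the \<open>1 - t\<^sup>g\<close> whenever \<open>u\<close> is an integral combination of the \<open>g\<close>.
\<close>

lemma subspace_diff_op:
  assumes "\<And>x k. k \<in> K \<Longrightarrow> f (x + k) = f x" "\<And>x k. k \<in> K \<Longrightarrow> f' (x + k) = f' x"
  shows "subspace {g \<in> G. partial_fraction (diff_op g f) (diff_op g f')}" (is "subspace ?S")
    and "K \<subseteq> {g \<in> G. partial_fraction (diff_op g f) (diff_op g f')}"
proof -
  have 0: "0 \<in> ?S" using partial_fraction_zero G_0 by (simp add: diff_op_def[abs_def])
  have add: "x + y \<in> ?S" if "x \<in> ?S" "y \<in> ?S" for x y
  proof -
    have "partial_fraction (\<lambda>z. diff_op x f z + diff_op y f (z - x)) (\<lambda>z. diff_op x f' z + diff_op y f' (z - x))"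
      using that by (auto intro: partial_fraction.add partial_fraction.shift)
    also have "(\<lambda>z. diff_op x f z + diff_op y f (z - x)) = diff_op (x + y) f"
      by (auto simp: diff_op_def fun_eq_iff diff_diff_eq)
    also have "(\<lambda>z. diff_op x f' z + diff_op y f' (z - x)) = diff_op (x + y) f'"
      by (auto simp: diff_op_def fun_eq_iff diff_diff_eq)
    finally show ?thesis using that G_add by simp
  qed
  have neg: "- x \<in> ?S" if "x \<in> ?S" for x
  proof -
    have "partial_fraction (\<lambda>z. - diff_op x f (z - (- x))) (\<lambda>z. - diff_op x f' (z - (- x)))"
      using that G_neg by (intro partial_fraction.neg partial_fraction.shift) auto
    then show ?thesis using that G_neg by (simp add: diff_op_def[abs_def])
  qed
  have scale: "scale k x \<in> ?S" if x: "x \<in> ?S" for k x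
  proof (induction k rule: int_induct[where k = 0])
    case base
    show ?case using 0 by simp
  next
    case (step1 i)
    then show ?case using add[OF step1(2) x] by (simp add: scale_left_distrib)
  next
    case (step2 i)
    then show ?case using add[OF step2(2) neg[OF x]] by (simp add: scale_left_diff_distrib)
  qed
  show "subspace ?S" unfolding subspace_def using 0 add scale by blast
  show "K \<subseteq> ?S"
  proof
    fix k assume k: "k \<in> K"
    have "diff_op k f = (\<lambda>x. 0)" "diff_op k f' = (\<lambda>x. 0)"
      using assms(1)[OF K_neg[OF k]] assms(2)[OF K_neg[OF k]] by (auto simp: diff_op_def fun_eq_iff)
    then show "k \<in> ?S" using partial_fraction_zero k K_subset by auto
  qed
qed

text \<open>
  The factor \<open>1 - t\<^sup>g\<close> of the denominator may be replaced by \<open>1 - t\<^sup>D\<^sup>g\<close>, since the former divides the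
  latter.
\<close>

lemma partial_fraction_Cons_multiple:
  assumes "set (g # Y) \<subseteq> gens" "0 < D" "partial_fraction (pf (scale D g # Y)) (reflected_pf (scale D g # Y))"
  shows "partial_fraction (pf (g # Y)) (reflected_pf (g # Y))"
proof -
  let ?Z = "scale D g # g # Y"
  let ?S = "{x \<in> G. partial_fraction (diff_op x (pf ?Z)) (diff_op x (reflected_pf ?Z))}"
  have Z: "list_all pos ?Z" using assms gens_multiple by (intro gens_list) auto
  have S: "subspace ?S" by (rule subspace_diff_op(1)) (auto simp: pf_periodic reflected_pf_periodic)
  have perm: "mset (remove1 g ?Z) = mset (scale D g # Y)" by (cases "scale D g = g") auto
  have posR: "list_all pos (remove1 g ?Z)" by (rule list_all_remove1[OF Z])
  have "diff_op g (pf ?Z) = pf (scale D g # Y)" "diff_op g (reflected_pf ?Z) = reflected_pf (scale D g # Y)"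
    using trans[OF diff_op_pf[OF Z] pf_perm[OF posR perm]]
      trans[OF diff_op_reflected_pf[OF Z] reflected_pf_perm[OF posR perm]] by simp_all
  then have "g \<in> ?S" using assms gens_G by auto
  then have "scale D g \<in> ?S" using S subspace_scale by blast
  then show ?thesis
    using diff_op_pf[OF Z, of "scale D g"] diff_op_reflected_pf[OF Z, of "scale D g"] by simp
qed

text \<open>
  The reduction step. If \<open>u0 = \<Sum> k\<^sub>u u\<close> modulo \<open>K\<close>, then \<open>1 - t\<^bsup>u0\<^esup>\<close> is a combination of the
  \<open>1 - t\<^sup>u\<close> with \<open>k\<^sub>u \<noteq> 0\<close>. Multiplying numerator and denominator by \<open>1 - t\<^bsup>u0\<^esup>\<close> therefore trades
  one factor \<open>1 - t\<^sup>u\<close> for a factor \<open>1 - t\<^bsup>u0\<^esup>\<close>. After finitely many steps one of these \<open>u\<close> has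
  disappeared, and \<open>u0\<close> together with the remaining ones is independent.
\<close>

lemma partial_fraction_replicate:
  assumes \<sigma>: "finite \<sigma>" "indep \<sigma>" "\<sigma> \<subseteq> gens" and u0: "u0 \<in> gens"
    and rel: "u0 - (\<Sum>u\<in>\<sigma>. scale (k u) u) \<in> K" and Z: "set Z \<subseteq> \<sigma>"
  shows "partial_fraction (pf (replicate (Suc p) u0 @ Z)) (reflected_pf (replicate (Suc p) u0 @ Z))"
  using Z
proof (induction "length Z" arbitrary: Z p rule: less_induct)
  case less
  show ?case
  proof (cases "\<exists>j\<in>\<sigma>. k j \<noteq> 0 \<and> j \<notin> set Z")
    case True
    then have "indep (insert u0 (set Z))"
      using indep_exchange[OF \<sigma>(1,2) rel] less.prems by blast
    moreover have "set (replicate (Suc p) u0 @ Z) = insert u0 (set Z)" by auto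
    ultimately show ?thesis using less.prems \<sigma>(3) u0 by (intro partial_fraction.base) (auto simp del: replicate.simps)
  next
    case False
    let ?Z = "replicate (Suc (Suc p)) u0 @ Z"
    let ?S = "{x \<in> G. partial_fraction (diff_op x (pf ?Z)) (diff_op x (reflected_pf ?Z))}"
    have pos: "list_all pos ?Z"
      using less.prems \<sigma>(3) u0 by (intro gens_list) auto
    have S: "subspace ?S" "K \<subseteq> ?S" by (rule subspace_diff_op; auto simp: pf_periodic reflected_pf_periodic)+
    have "j \<in> ?S" if j: "j \<in> \<sigma>" "k j \<noteq> 0" for j
    proof -
      have jZ: "j \<in> set Z" using False j by blast
      have perm: "mset (remove1 j ?Z) = mset (replicate (Suc (Suc p)) u0 @ remove1 j Z)"
      proof -
        obtain M where "mset Z = add_mset j M"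
          using jZ by (metis multi_member_split set_mset_mset)
        then show ?thesis by simp
      qed
      have posR: "list_all pos (remove1 j ?Z)" by (rule list_all_remove1[OF pos])
      have len: "length (remove1 j Z) < length Z"
        using jZ by (metis One_nat_def Suc_pred length_pos_if_in_set length_remove1 lessI)
      have sub: "set (remove1 j Z) \<subseteq> \<sigma>" using less.prems set_remove1_subset by (metis subset_trans)
      have "partial_fraction (diff_op j (pf ?Z)) (diff_op j (reflected_pf ?Z))"
        using trans[OF diff_op_pf[OF pos] pf_perm[OF posR perm]]
          trans[OF diff_op_reflected_pf[OF pos] reflected_pf_perm[OF posR perm]] jZ less.hyps[OF len sub, of "Suc p"]
        by (simp del: replicate.simps)
      then show ?thesis using j \<sigma>(3) gens_G by auto
    qed
    then have "scale (k j) j \<in> ?S" if "j \<in> \<sigma>" for j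
      using that subspace_scale[OF S(1)] subspace_0[OF S(1)] by (cases "k j = 0") auto
    then have "(\<Sum>u\<in>\<sigma>. scale (k u) u) \<in> ?S" by (intro subspace_sum[OF S(1)])
    from subspace_add[OF S(1) subsetD[OF S(2) rel] this]
    have "u0 \<in> ?S" by (simp only: diff_add_cancel)
    then show ?thesis
      using diff_op_pf[OF pos, of u0] diff_op_reflected_pf[OF pos, of u0] by simp
  qed
qed

lemma partial_fraction_Cons_indep:
  assumes "set Y \<subseteq> gens" "indep (set Y)" "g \<in> gens"
  shows "partial_fraction (pf (g # Y)) (reflected_pf (g # Y))"
proof (cases "indep (insert g (set Y))")
  case True
  then show ?thesis using assms by (intro partial_fraction.base) auto
next
  case False
  obtain D k where D: "D > 0" and rel: "scale D g - (\<Sum>u\<in>set Y. scale (k u) u) \<in> K"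
    using dependent_insert_obtains[OF _ assms(2) False] by auto
  have "partial_fraction (pf (scale D g # Y)) (reflected_pf (scale D g # Y))"
    using partial_fraction_replicate[OF _ assms(2,1) _ rel, of Y 0] assms(3) D gens_multiple by simp
  then show ?thesis using partial_fraction_Cons_multiple[of g Y D] assms D by simp
qed

text \<open>
  Division by \<open>1 - t\<^sup>g\<close> does not lead out of the class of partial fractions. It suffices to divide the
  generators of the class.
\<close>

lemma partial_fraction_solve:
  assumes "partial_fraction f f'" "g \<in> gens"
  shows "\<exists>h h'. partial_fraction h h' \<and> bounded_supp h \<and> bounded_supp (\<lambda>x. h' (- x)) \<and>
    diff_op g h = f \<and> diff_op g h' = f'"
  using assms(1)
proof induction
  case (base Y)
  have "list_all pos (g # Y)" using base assms(2) by (intro gens_list) auto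
  then show ?case
    using partial_fraction_Cons_indep[OF base assms(2)] diff_op_pf[of "g # Y" g] diff_op_reflected_pf[of "g # Y" g]
    by (intro exI[of _ "pf (g # Y)"] exI[of _ "reflected_pf (g # Y)"]) (simp add: bounded_supp_pf bounded_supp_reflected_pf)
next
  case (add f1 f1' f2 f2')
  then obtain h1 h1' h2 h2' where
    h1: "partial_fraction h1 h1'" "bounded_supp h1" "bounded_supp (\<lambda>x. h1' (- x))" "diff_op g h1 = f1" "diff_op g h1' = f1'"
    and h2: "partial_fraction h2 h2'" "bounded_supp h2" "bounded_supp (\<lambda>x. h2' (- x))" "diff_op g h2 = f2" "diff_op g h2' = f2'"
    by blast
  have "diff_op g (\<lambda>x. h1 x + h2 x) = (\<lambda>x. diff_op g h1 x + diff_op g h2 x)"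
    "diff_op g (\<lambda>x. h1' x + h2' x) = (\<lambda>x. diff_op g h1' x + diff_op g h2' x)"
    by (simp_all add: diff_op_def fun_eq_iff)
  then show ?case
    using partial_fraction.add[OF h1(1) h2(1)] bounded_supp_add[OF h1(2) h2(2)] bounded_supp_add[OF h1(3) h2(3)]
      h1(4,5) h2(4,5)
    by (intro exI[of _ "\<lambda>x. h1 x + h2 x"] exI[of _ "\<lambda>x. h1' x + h2' x"]) simp
next
  case (neg f1 f1')
  then obtain h1 h1' where
    h1: "partial_fraction h1 h1'" "bounded_supp h1" "bounded_supp (\<lambda>x. h1' (- x))" "diff_op g h1 = f1" "diff_op g h1' = f1'"
    by blast
  have "diff_op g (\<lambda>x. - h1 x) = (\<lambda>x. - diff_op g h1 x)"
    "diff_op g (\<lambda>x. - h1' x) = (\<lambda>x. - diff_op g h1' x)"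
    by (simp_all add: diff_op_def fun_eq_iff)
  then show ?case
    using partial_fraction.neg[OF h1(1)] bounded_supp_uminus[OF h1(2)] bounded_supp_uminus[OF h1(3)] h1(4,5)
    by (intro exI[of _ "\<lambda>x. - h1 x"] exI[of _ "\<lambda>x. - h1' x"]) simp
next
  case (shift f1 f1' b)
  then obtain h1 h1' where
    h1: "partial_fraction h1 h1'" "bounded_supp h1" "bounded_supp (\<lambda>x. h1' (- x))" "diff_op g h1 = f1" "diff_op g h1' = f1'"
    by blast
  have "bounded_supp (\<lambda>x. h1' (- (x - (- b))))"
    using bounded_supp_shift[OF h1(3) G_neg[OF shift(2)]] by simp
  then have "bounded_supp (\<lambda>x. h1' (- x - b))" by (simp add: algebra_simps)
  then show ?case
    using partial_fraction.shift[OF h1(1) shift(2)] bounded_supp_shift[OF h1(2) shift(2)] h1(4,5)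
    by (intro exI[of _ "\<lambda>x. h1 (x - b)"] exI[of _ "\<lambda>x. h1' (x - b)"]) (simp add: diff_op_shift)
qed

text \<open>
  The quotient by \<open>1 - t\<^sup>g\<close> constructed in the previous lemma is the right one because a series
  bounded from below, or from above, is determined by its product with \<open>1 - t\<^sup>g\<close>.
\<close>

theorem partial_fractions: "set X \<subseteq> gens \<Longrightarrow> partial_fraction (pf X) (reflected_pf X)"
proof (induction X)
  case Nil
  then show ?case by (intro partial_fraction.base) (auto simp: indep_empty)
next
  case (Cons g X)
  then obtain h h' where h: "partial_fraction h h'" "bounded_supp h" "bounded_supp (\<lambda>x. h' (- x))"
    "diff_op g h = pf X" "diff_op g h' = reflected_pf X"
    using partial_fraction_solve[of "pf X" "reflected_pf X" g] by auto
  have pos: "list_all pos (g # X)" using Cons.prems gens_list by blast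
  have eq: "diff_op g h = diff_op g (pf (g # X))" "diff_op g h' = diff_op g (reflected_pf (g # X))"
    using h diff_op_pf[OF pos, of g] diff_op_reflected_pf[OF pos, of g] by simp_all
  have "pos g" using pos by simp
  then have "h = pf (g # X)" "h' = reflected_pf (g # X)"
    using diff_op_unique[OF h(2) bounded_supp_pf[OF pos] _ eq(1)]
      diff_op_unique_reflected[OF h(3) bounded_supp_reflected_pf[OF pos] _ eq(2)] by blast+
  then show ?case using h(1) by simp
qed

end

section \<open>Quasi-polynomials and independent generators\<close>

context graded_group
begin

text \<open>
  Quasi-polynomials: the functions generated by linear functions of \<open>w x\<close> and by functions that are
  periodic with respect to a multiple of \<open>G\<close>. Only their values on \<open>G\<close> matter.
\<close>

inductive qpoly :: "('a \<Rightarrow> real) \<Rightarrow> bool" where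
  linear: "linear \<phi> \<Longrightarrow> qpoly (\<lambda>x. \<phi> (w x))"
| periodic: "0 < D \<Longrightarrow> (\<And>x u. x \<in> G \<Longrightarrow> u \<in> G \<Longrightarrow> p (x + scale D u) = p x) \<Longrightarrow> qpoly p"
| add: "qpoly f \<Longrightarrow> qpoly h \<Longrightarrow> qpoly (\<lambda>x. f x + h x)"
| mult: "qpoly f \<Longrightarrow> qpoly h \<Longrightarrow> qpoly (\<lambda>x. f x * h x)"

lemma qpoly_const: "qpoly (\<lambda>x. r)"
  by (rule qpoly.periodic[of 1]) auto

lemma qpoly_scale: "qpoly f \<Longrightarrow> qpoly (\<lambda>x. r * f x)"
  using qpoly.mult[OF qpoly_const] .

lemma qpoly_diff: "qpoly f \<Longrightarrow> qpoly h \<Longrightarrow> qpoly (\<lambda>x. f x - h x)"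
  using qpoly.add[OF _ qpoly_scale[of h "-1"]] by simp

lemma qpoly_prod: "(\<And>i. i \<in> A \<Longrightarrow> qpoly (f i)) \<Longrightarrow> qpoly (\<lambda>x. \<Prod>i\<in>A. f i x)"
  by (induction A rule: infinite_finite_induct) (simp_all add: qpoly_const qpoly.mult)

lemma qpoly_sum: "(\<And>i. i \<in> A \<Longrightarrow> qpoly (f i)) \<Longrightarrow> qpoly (\<lambda>x. \<Sum>i\<in>A. f i x)"
  by (induction A rule: infinite_finite_induct) (simp_all add: qpoly_const qpoly.add)

lemma qpoly_gbinomial:
  assumes "qpoly f" shows "qpoly (\<lambda>x. f x gchoose n)"
proof -
  have "qpoly (\<lambda>x. (1 / fact n) * (\<Prod>i\<in>{0..<n}. f x - real i))"
    by (intro qpoly_scale qpoly_prod qpoly_diff assms qpoly_const)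
  then show ?thesis by (simp add: gbinomial_prod_rev)
qed

lemma qpoly_shift:
  assumes "qpoly f" "b \<in> G"
  shows "\<exists>f'. qpoly f' \<and> (\<forall>x\<in>G. f' x = f (x - b))"
  using assms(1)
proof induction
  case (linear \<phi>)
  have "qpoly (\<lambda>x. \<phi> (w x) - \<phi> (w b))"
    using linear by (intro qpoly_diff qpoly.linear qpoly_const)
  then show ?case using linear assms(2)
    by (intro exI[of _ "\<lambda>x. \<phi> (w x) - \<phi> (w b)"]) (simp add: w_diff linear_diff)
next
  case (periodic D p)
  have "p (x + scale D u - b) = p (x - b)" if "x \<in> G" "u \<in> G" for x u
    using periodic(2)[OF G_diff[OF that(1) assms(2)] that(2)] by (simp add: algebra_simps)
  then have "qpoly (\<lambda>x. p (x - b))" by (rule qpoly.periodic[OF periodic(1)])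
  then show ?case by blast
next
  case (add f h)
  then obtain f' h' where "qpoly f'" "\<forall>x\<in>G. f' x = f (x - b)" "qpoly h'" "\<forall>x\<in>G. h' x = h (x - b)"
    by blast
  then show ?case by (intro exI[of _ "\<lambda>x. f' x + h' x"]) (simp add: qpoly.add)
next
  case (mult f h)
  then obtain f' h' where "qpoly f'" "\<forall>x\<in>G. f' x = f (x - b)" "qpoly h'" "\<forall>x\<in>G. h' x = h (x - b)"
    by blast
  then show ?case by (intro exI[of _ "\<lambda>x. f' x * h' x"]) (simp add: qpoly.mult)
qed

lemma qpoly_reflect:
  assumes "qpoly f"
  shows "\<exists>f'. qpoly f' \<and> (\<forall>x\<in>G. f' x = f (- x))"
  using assms
proof induction
  case (linear \<phi>)
  have "qpoly (\<lambda>x. (-1) * \<phi> (w x))"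
    using linear by (intro qpoly_scale qpoly.linear)
  then show ?case using linear
    by (intro exI[of _ "\<lambda>x. (-1) * \<phi> (w x)"]) (simp add: w_neg linear_neg)
next
  case (periodic D p)
  have "p (- (x + scale D u)) = p (- x)" if "x \<in> G" "u \<in> G" for x u
    using periodic(2)[OF G_neg[OF that(1)] G_neg[OF that(2)]] by (simp add: algebra_simps)
  then have "qpoly (\<lambda>x. p (- x))" by (rule qpoly.periodic[OF periodic(1)])
  then show ?case by blast
next
  case (add f h)
  then obtain f' h' where "qpoly f'" "\<forall>x\<in>G. f' x = f (- x)" "qpoly h'" "\<forall>x\<in>G. h' x = h (- x)"
    by blast
  then show ?case by (intro exI[of _ "\<lambda>x. f' x + h' x"]) (simp add: qpoly.add)
next
  case (mult f h)
  then obtain f' h' where "qpoly f'" "\<forall>x\<in>G. f' x = f (- x)" "qpoly h'" "\<forall>x\<in>G. h' x = h (- x)"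
    by blast
  then show ?case by (intro exI[of _ "\<lambda>x. f' x * h' x"]) (simp add: qpoly.mult)
qed

text \<open>
  Along a ray the periodic parts become constant once the step is a common multiple of their
  periods.
\<close>

lemma qpoly_ray:
  assumes "qpoly f" "u \<in> G" "x \<in> G"
  shows "\<exists>D>0. \<exists>p. \<forall>k. f (x + scale (D * k) u) = poly p (of_int k)"
  using assms(1)
proof induction
  case (linear \<phi>)
  show ?case
    using linear assms(2,3)
    by (intro exI[of _ 1] conjI exI[of _ "[:\<phi> (w x), \<phi> (w u):]"])
      (simp_all add: w_add w_scale G_scale linear_add linear_scale)
next
  case (periodic D p)
  have "p (x + scale (D * k) u) = p x" for k
    using periodic(2)[OF assms(3) G_scale[OF assms(2)], of k] by simp
  then show ?case using periodic(1) by (intro exI[of _ D] conjI exI[of _ "[:p x:]"]) simp_all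
next
  case (add f h)
  then obtain D p E q where D: "D > 0" "\<And>k. f (x + scale (D * k) u) = poly p (of_int k)"
    and E: "E > 0" "\<And>k. h (x + scale (E * k) u) = poly q (of_int k)" by blast
  have "f (x + scale (D * E * k) u) + h (x + scale (D * E * k) u)
      = poly (pcompose p [:0, of_int E:] + pcompose q [:0, of_int D:]) (of_int k)" for k
    using D(2)[of "E * k"] E(2)[of "D * k"] by (simp add: poly_pcompose mult_ac)
  then show ?case using D(1) E(1) by (meson mult_pos_pos)
next
  case (mult f h)
  then obtain D p E q where D: "D > 0" "\<And>k. f (x + scale (D * k) u) = poly p (of_int k)"
    and E: "E > 0" "\<And>k. h (x + scale (E * k) u) = poly q (of_int k)" by blast
  have "f (x + scale (D * E * k) u) * h (x + scale (D * E * k) u)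
      = poly (pcompose p [:0, of_int E:] * pcompose q [:0, of_int D:]) (of_int k)" for k
    using D(2)[of "E * k"] E(2)[of "D * k"] by (simp add: poly_pcompose mult_ac)
  then show ?case using D(1) E(1) by (meson mult_pos_pos)
qed

lemma poly_eq_0_if_eventually:
  fixes p :: "real poly"
  assumes "\<And>k :: int. k \<ge> N \<Longrightarrow> poly p (of_int k) = 0"
  shows "p = 0"
proof (rule ccontr)
  assume "p \<noteq> 0"
  then have "finite {x. poly p x = 0}" by (rule poly_roots_finite)
  moreover have "of_int ` {N..} \<subseteq> {x. poly p x = 0}" using assms by auto
  ultimately have "finite ((of_int :: int \<Rightarrow> real) ` {N..})" by (rule finite_subset[rotated])
  then have "finite {N..}" by (rule finite_imageD) (auto simp: inj_on_def)
  then show False using infinite_Ici by blast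
qed

text \<open>
  A polynomial that vanishes at all large integers is \<open>0\<close>, so it also vanishes at the start of the ray.
\<close>

lemma qpoly_vanish:
  assumes "qpoly f" "u \<in> G" "x \<in> G" "\<And>k :: int. k \<ge> N \<Longrightarrow> f (x + scale k u) = 0"
  shows "f x = 0"
proof -
  obtain D p where D: "D > 0" "\<And>k. f (x + scale (D * k) u) = poly p (of_int k)"
    using qpoly_ray[OF assms(1-3)] by blast
  have "poly p (of_int k) = 0" if "k \<ge> max N 0" for k
  proof -
    have "N \<le> D * k" using that D(1) mult_right_mono[of 1 D k] by simp
    then show ?thesis using assms(4) D(2) by metis
  qed
  then have "p = 0" by (rule poly_eq_0_if_eventually)
  then show ?thesis using D(2)[of 0] by simp
qed

definition lattice_hull :: "'a set \<Rightarrow> 'a set" where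
  "lattice_hull \<sigma> = {x. \<exists>k. x - (\<Sum>u\<in>\<sigma>. scale (k u) u) \<in> K}"

text \<open>
  For independent \<open>\<sigma>\<close> and \<open>x \<in> lattice_hull \<sigma>\<close> these are the unique coordinates of \<open>x\<close> on \<open>\<sigma>\<close>.
\<close>

definition lcoord :: "'a set \<Rightarrow> 'a \<Rightarrow> 'a \<Rightarrow> int" where
  "lcoord \<sigma> x = (SOME k. x - (\<Sum>u\<in>\<sigma>. scale (k u) u) \<in> K)"

lemma lcoord: "x \<in> lattice_hull \<sigma> \<Longrightarrow> x - (\<Sum>u\<in>\<sigma>. scale (lcoord \<sigma> x u) u) \<in> K"
  unfolding lcoord_def lattice_hull_def mem_Collect_eq
  by (rule someI_ex[of "\<lambda>k. x - (\<Sum>u\<in>\<sigma>. scale (k u) u) \<in> K"])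

lemma lcoord_unique:
  assumes "indep \<sigma>" "x - (\<Sum>u\<in>\<sigma>. scale (k u) u) \<in> K" "u \<in> \<sigma>"
  shows "lcoord \<sigma> x u = k u"
proof -
  have "x \<in> lattice_hull \<sigma>" using assms(2) by (auto simp: lattice_hull_def)
  from K_diff[OF assms(2) lcoord[OF this]]
  have "(\<Sum>u\<in>\<sigma>. scale (lcoord \<sigma> x u - k u) u) \<in> K"
    by (simp add: scale_left_diff_distrib sum_subtractf)
  then show ?thesis
    using assms(1)[unfolded indep_def, THEN spec, of "\<lambda>u. lcoord \<sigma> x u - k u"] assms(3) by auto
qed

lemma subspace_lattice_hull: "subspace (lattice_hull \<sigma>)"
  unfolding subspace_def
proof (intro conjI ballI allI)
  show "0 \<in> lattice_hull \<sigma>"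
    unfolding lattice_hull_def using K_0 by (auto intro!: exI[of _ "\<lambda>u. 0"])
next
  fix x y assume "x \<in> lattice_hull \<sigma>" "y \<in> lattice_hull \<sigma>"
  then obtain k l where "x - (\<Sum>u\<in>\<sigma>. scale (k u) u) \<in> K" "y - (\<Sum>u\<in>\<sigma>. scale (l u) u) \<in> K"
    by (auto simp: lattice_hull_def)
  from K_add[OF this] have "(x + y) - (\<Sum>u\<in>\<sigma>. scale (k u + l u) u) \<in> K"
    by (simp add: scale_left_distrib sum.distrib algebra_simps)
  then show "x + y \<in> lattice_hull \<sigma>" unfolding lattice_hull_def by (intro CollectI exI)
next
  fix c x assume "x \<in> lattice_hull \<sigma>"
  then obtain k where "x - (\<Sum>u\<in>\<sigma>. scale (k u) u) \<in> K"
    by (auto simp: lattice_hull_def)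
  from K_scale[OF this, of c] have "scale c x - (\<Sum>u\<in>\<sigma>. scale (c * k u) u) \<in> K"
    by (simp add: scale_right_diff_distrib scale_sum_right)
  then show "scale c x \<in> lattice_hull \<sigma>" unfolding lattice_hull_def by (intro CollectI exI)
qed

lemma lattice_hull_G: "\<sigma> \<subseteq> G \<Longrightarrow> x \<in> lattice_hull \<sigma> \<Longrightarrow> x \<in> G"
proof -
  assume "\<sigma> \<subseteq> G" "x \<in> lattice_hull \<sigma>"
  then have "(x - (\<Sum>u\<in>\<sigma>. scale (lcoord \<sigma> x u) u)) + (\<Sum>u\<in>\<sigma>. scale (lcoord \<sigma> x u) u) \<in> G"
    using lcoord[of x \<sigma>] K_subset by (intro G_add G_sum G_scale) auto
  then show "x \<in> G" by simp
qed

lemma w_lattice_hull: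
  assumes "\<sigma> \<subseteq> G" "x \<in> lattice_hull \<sigma>"
  shows "w x = (\<Sum>u\<in>\<sigma>. of_int (lcoord \<sigma> x u) *\<^sub>R w u)"
proof -
  let ?s = "\<Sum>u\<in>\<sigma>. scale (lcoord \<sigma> x u) u"
  have sG: "?s \<in> G" using assms(1) by (intro G_sum G_scale) auto
  have "w x = w (x - ?s) + w ?s" using w_diff[OF lattice_hull_G[OF assms] sG] by simp
  also have "\<dots> = w ?s" using w_K[OF lcoord[OF assms(2)]] by simp
  also have "\<dots> = (\<Sum>u\<in>\<sigma>. w (scale (lcoord \<sigma> x u) u))"
    using assms(1) by (intro w_sum G_scale) auto
  also have "\<dots> = (\<Sum>u\<in>\<sigma>. of_int (lcoord \<sigma> x u) *\<^sub>R w u)"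
    using assms(1) by (intro sum.cong) (auto simp: w_scale)
  finally show ?thesis .
qed

lemma lattice_hull_base: "finite \<sigma> \<Longrightarrow> g \<in> \<sigma> \<Longrightarrow> g \<in> lattice_hull \<sigma>"
proof -
  assume "finite \<sigma>" "g \<in> \<sigma>"
  have "(\<Sum>u\<in>\<sigma>. scale (if u = g then 1 else 0) u) = (\<Sum>u\<in>\<sigma>. if u = g then g else 0)"
    by (intro sum.cong) auto
  also have "\<dots> = g" using \<open>finite \<sigma>\<close> \<open>g \<in> \<sigma>\<close> by simp
  finally show ?thesis unfolding lattice_hull_def using K_0
    by (auto intro!: exI[of _ "\<lambda>u. if u = g then 1 else 0"])
qed

lemma lcoord_simps:
  assumes "finite \<sigma>" "indep \<sigma>" "u \<in> \<sigma>"
  shows "k \<in> K \<Longrightarrow> lcoord \<sigma> k u = 0"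
    and "x \<in> lattice_hull \<sigma> \<Longrightarrow> y \<in> lattice_hull \<sigma> \<Longrightarrow> lcoord \<sigma> (x - y) u = lcoord \<sigma> x u - lcoord \<sigma> y u"
    and "g \<in> \<sigma> \<Longrightarrow> lcoord \<sigma> g u = (if u = g then 1 else 0)"
proof -
  show "lcoord \<sigma> k u = 0" if "k \<in> K"
    using lcoord_unique[OF assms(2) _ assms(3), of k "\<lambda>u. 0"] that by simp
  show "lcoord \<sigma> (x - y) u = lcoord \<sigma> x u - lcoord \<sigma> y u"
    if "x \<in> lattice_hull \<sigma>" "y \<in> lattice_hull \<sigma>"
  proof (rule lcoord_unique[OF assms(2) _ assms(3)])
    show "x - y - (\<Sum>u\<in>\<sigma>. scale (lcoord \<sigma> x u - lcoord \<sigma> y u) u) \<in> K"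
      using K_diff[OF lcoord[OF that(1)] lcoord[OF that(2)]]
      by (simp add: scale_left_diff_distrib sum_subtractf algebra_simps)
  qed
  show "lcoord \<sigma> g u = (if u = g then 1 else 0)" if "g \<in> \<sigma>"
  proof (rule lcoord_unique[OF assms(2) _ assms(3)])
    have "(\<Sum>u\<in>\<sigma>. scale (if u = g then 1 else 0) u) = (\<Sum>u\<in>\<sigma>. if u = g then g else 0)"
      by (intro sum.cong) auto
    then show "g - (\<Sum>u\<in>\<sigma>. scale (if u = g then 1 else 0) u) \<in> K"
      using assms(1) that K_0 by simp
  qed
qed

text \<open>
  The number of weak compositions of \<open>k\<close> into \<open>m\<close> parts, the coefficient of \<open>s\<^sup>k\<close> in \<open>1/(1 - s)\<^sup>m\<close>. For \<open>m > 0\<close> it is a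
  polynomial in \<open>k\<close> cut off at \<open>0\<close>.
\<close>

fun weak_comps :: "nat \<Rightarrow> int \<Rightarrow> real" where
  "weak_comps 0 k = (if k = 0 then 1 else 0)"
| "weak_comps (Suc m) k = (if k \<ge> 0 then (of_int k + of_nat m) gchoose m else 0)"

lemma weak_comps_diff: "weak_comps (Suc m) k - weak_comps (Suc m) (k - 1) = weak_comps m k"
proof -
  consider "k < 0" | "k = 0" | "k > 0" by linarith
  then show ?thesis
  proof cases
    case 1
    then show ?thesis by (cases m) auto
  next
    case 2
    then show ?thesis
      using binomial_gbinomial[of m m, where 'a = real]
        binomial_gbinomial[of "m - 1" "m - 1", where 'a = real] by (cases m) auto
  next
    case 3
    then show ?thesis
    proof (cases m)
      case (Suc n)
      have "(of_int k + of_nat m :: real) = (of_int k + of_nat n) + 1"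
        and "(of_int (k - 1) + of_nat m :: real) = of_int k + of_nat n" using Suc by simp_all
      then show ?thesis using 3 Suc gbinomial_Suc_Suc[of "of_int k + of_nat n :: real" n]
        by (simp add: algebra_simps)
    qed auto
  qed
qed

lemma weak_comps_neg: "k < 0 \<Longrightarrow> weak_comps m k = 0"
  by (cases m) auto

declare weak_comps.simps [simp del]

definition simplicial_pf :: "'a set \<Rightarrow> 'a list \<Rightarrow> 'a \<Rightarrow> real" where
  "simplicial_pf \<sigma> Y x =
     (if x \<in> lattice_hull \<sigma> then \<Prod>u\<in>\<sigma>. weak_comps (count_list Y u) (lcoord \<sigma> x u) else 0)"

text \<open>
  For generators from an independent set the series is a product of the one-variable series
  \<open>1/(1 - s)\<^sup>m\<close>. This is checked by verifying that the product satisfies the difference equations of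
  \<open>pf\<close>.
\<close>

lemma pf_eq_simplicial_pf:
  assumes \<sigma>: "finite \<sigma>" "indep \<sigma>" "\<And>u. u \<in> \<sigma> \<Longrightarrow> pos u" and Y: "set Y \<subseteq> \<sigma>"
  shows "pf Y = simplicial_pf \<sigma> Y"
  using Y
proof (induction Y)
  case Nil
  show ?case
  proof
    fix x
    show "pf [] x = simplicial_pf \<sigma> [] x"
    proof (cases "x \<in> K")
      case True
      then have "x \<in> lattice_hull \<sigma>"
        unfolding lattice_hull_def by (auto intro!: exI[of _ "\<lambda>u. 0"])
      then show ?thesis
        using True lcoord_simps(1)[OF \<sigma>(1,2) _ True] by (simp add: pf_Nil simplicial_pf_def weak_comps.simps)
    next
      case False
      have "\<exists>u\<in>\<sigma>. lcoord \<sigma> x u \<noteq> 0" if "x \<in> lattice_hull \<sigma>"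
      proof (rule ccontr)
        assume "\<not> (\<exists>u\<in>\<sigma>. lcoord \<sigma> x u \<noteq> 0)"
        then have "(\<Sum>u\<in>\<sigma>. scale (lcoord \<sigma> x u) u) = 0" by (intro sum.neutral) simp
        then show False using lcoord[OF that] False by simp
      qed
      then have "(\<Prod>u\<in>\<sigma>. weak_comps 0 (lcoord \<sigma> x u)) = 0" if "x \<in> lattice_hull \<sigma>"
        using that \<sigma>(1) by (intro prod_zero) (simp_all add: weak_comps.simps)
      then show ?thesis using False by (simp add: pf_Nil simplicial_pf_def)
    qed
  qed
next
  case (Cons g Y)
  have g: "g \<in> \<sigma>" "pos g" and Y: "set Y \<subseteq> \<sigma>" using Cons.prems \<sigma>(3) by auto
  have posY: "list_all pos (g # Y)" using Cons.prems \<sigma>(3) by (auto simp: list_all_iff)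
  have "diff_op g (simplicial_pf \<sigma> (g # Y)) = simplicial_pf \<sigma> Y"
  proof
    fix x
    have hull: "x - g \<in> lattice_hull \<sigma> \<longleftrightarrow> x \<in> lattice_hull \<sigma>"
      using subspace_diff[OF subspace_lattice_hull _ lattice_hull_base[OF \<sigma>(1) g(1)], of x]
        subspace_add[OF subspace_lattice_hull _ lattice_hull_base[OF \<sigma>(1) g(1)], of "x - g"] by auto
    show "diff_op g (simplicial_pf \<sigma> (g # Y)) x = simplicial_pf \<sigma> Y x"
    proof (cases "x \<in> lattice_hull \<sigma>")
      case False
      then show ?thesis using hull by (simp add: diff_op_def simplicial_pf_def)
    next
      case True
      let ?k = "lcoord \<sigma> x" and ?m = "count_list Y"
      let ?R = "\<Prod>u\<in>\<sigma> - {g}. weak_comps (?m u) (?k u)"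
      have k: "lcoord \<sigma> (x - g) u = ?k u - (if u = g then 1 else 0)" if "u \<in> \<sigma>" for u
        using lcoord_simps(2)[OF \<sigma>(1,2) that True lattice_hull_base[OF \<sigma>(1) g(1)]]
          lcoord_simps(3)[OF \<sigma>(1,2) that g(1)] by simp
      have 1: "simplicial_pf \<sigma> (g # Y) x = weak_comps (Suc (?m g)) (?k g) * ?R"
      proof -
        have "(\<Prod>u\<in>\<sigma> - {g}. weak_comps (count_list (g # Y) u) (?k u)) = ?R"
          by (intro prod.cong) auto
        then show ?thesis
          using True prod.remove[OF \<sigma>(1) g(1), of "\<lambda>u. weak_comps (count_list (g # Y) u) (?k u)"]
          by (simp add: simplicial_pf_def)
      qed
      have 2: "simplicial_pf \<sigma> (g # Y) (x - g) = weak_comps (Suc (?m g)) (?k g - 1) * ?R"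
      proof -
        have "simplicial_pf \<sigma> (g # Y) (x - g)
            = (\<Prod>u\<in>\<sigma>. weak_comps (count_list (g # Y) u) (?k u - (if u = g then 1 else 0)))"
          using True hull k by (simp add: simplicial_pf_def cong: prod.cong)
        also have "\<dots> = weak_comps (Suc (?m g)) (?k g - 1) *
            (\<Prod>u\<in>\<sigma> - {g}. weak_comps (count_list (g # Y) u) (?k u - (if u = g then 1 else 0)))"
          by (subst prod.remove[OF \<sigma>(1) g(1)]) simp
        also have "(\<Prod>u\<in>\<sigma> - {g}. weak_comps (count_list (g # Y) u) (?k u - (if u = g then 1 else 0))) = ?R"
          by (intro prod.cong) auto
        finally show ?thesis .
      qed
      have 3: "simplicial_pf \<sigma> Y x = weak_comps (?m g) (?k g) * ?R"
        using True prod.remove[OF \<sigma>(1) g(1), of "\<lambda>u. weak_comps (?m u) (?k u)"]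
        by (simp add: simplicial_pf_def)
      show ?thesis
        unfolding diff_op_def 1 2 3 by (simp only: left_diff_distrib[symmetric] weak_comps_diff)
    qed
  qed
  then have eq: "diff_op g (pf (g # Y)) = diff_op g (simplicial_pf \<sigma> (g # Y))"
    using Cons.IH[OF Y] diff_op_pf_Cons[OF posY] by simp
  have "x \<in> G \<and> 0 \<le> \<xi> (w x)" if nz: "simplicial_pf \<sigma> (g # Y) x \<noteq> 0" for x
  proof -
    have x: "x \<in> lattice_hull \<sigma>" using nz by (auto simp: simplicial_pf_def split: if_splits)
    have \<sigma>G: "\<sigma> \<subseteq> G" using \<sigma>(3) pos_G by blast
    have xG: "x \<in> G" using lattice_hull_G[OF \<sigma>G x] .
    have wx: "\<xi> (w x) = (\<Sum>u\<in>\<sigma>. of_int (lcoord \<sigma> x u) * \<xi> (w u))"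
      by (simp add: w_lattice_hull[OF \<sigma>G x] xi_simps)
    have "lcoord \<sigma> x u \<ge> 0" if u: "u \<in> \<sigma>" for u
    proof (rule ccontr)
      assume "\<not> lcoord \<sigma> x u \<ge> 0"
      then have "weak_comps m (lcoord \<sigma> x u) = 0" for m by (simp add: weak_comps_neg)
      then have "(\<Prod>u\<in>\<sigma>. weak_comps (count_list (g # Y) u) (lcoord \<sigma> x u)) = 0"
        using \<sigma>(1) u by (meson prod_zero)
      then show False using nz x by (simp add: simplicial_pf_def)
    qed
    then have "0 \<le> (\<Sum>u\<in>\<sigma>. of_int (lcoord \<sigma> x u) * \<xi> (w u))"
      using \<sigma>(3) by (intro sum_nonneg mult_nonneg_nonneg) (auto simp: pos_def less_imp_le)
    then show ?thesis using xG wx by simp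
  qed
  then have "bounded_supp (simplicial_pf \<sigma> (g # Y))" by (auto simp: bounded_supp_def)
  then show ?case using diff_op_unique[OF bounded_supp_pf[OF posY] _ g(2) eq] by blast
qed

end

section \<open>Asymptotics in a chamber and reciprocity\<close>

text \<open>
  The set \<open>c\<close> is an abstract chamber: a convex cone that absorbs the images of all lattice points
  and is compatible with the simplicial cones of the generators, that is, it is contained in those
  of full dimension \<open>d\<close> that it meets, and it meets no others.
\<close>

locale graded_chamber = generated_group +
  fixes c :: "'b set" and d :: nat
  assumes c_add: "\<And>x y. x \<in> c \<Longrightarrow> y \<in> c \<Longrightarrow> x + y \<in> c"
    and c_scale: "\<And>r x. 0 < r \<Longrightarrow> x \<in> c \<Longrightarrow> r *\<^sub>R x \<in> c"
    and c_point: "\<exists>u\<in>G. w u \<in> c"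
    and c_absorb: "\<And>y x. y \<in> c \<Longrightarrow> x \<in> G \<Longrightarrow> \<exists>r>0. r *\<^sub>R y + w x \<in> c"
    and c_compat: "\<And>\<sigma>. finite \<sigma> \<Longrightarrow> \<sigma> \<subseteq> gens \<Longrightarrow> indep \<sigma> \<Longrightarrow>
      (card \<sigma> = d \<and> c \<subseteq> convex_cone hull (w ` \<sigma>)) \<or> c \<inter> convex_cone hull (w ` \<sigma>) = {}"
    and rational: "\<And>\<sigma>. finite \<sigma> \<Longrightarrow> \<sigma> \<subseteq> G \<Longrightarrow> indep \<sigma> \<Longrightarrow>
      inj_on w \<sigma> \<and> \<not> real_vector.dependent (w ` \<sigma>)"
    and finitely_generated: "\<exists>B. finite B \<and> span B = G"
begin

lemma ray_enters_chamber:
  assumes "u \<in> G" "w u \<in> c" "x \<in> G"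
  shows "\<exists>N. \<forall>k\<ge>N::int. w (x + scale k u) \<in> c"
proof -
  obtain r where r: "r > 0" "r *\<^sub>R w u + w x \<in> c" using c_absorb[OF assms(2,3)] by blast
  have "w (x + scale k u) \<in> c" if k: "k \<ge> \<lceil>r\<rceil> + 1" for k
  proof -
    have "of_int k - r > 0" using k by linarith
    then have "(r *\<^sub>R w u + w x) + (of_int k - r) *\<^sub>R w u \<in> c"
      using r(2) assms(2) c_scale c_add by blast
    then show ?thesis using assms by (simp add: w_add w_scale G_scale algebra_simps)
  qed
  then show ?thesis by blast
qed

lemma qpoly_vanish_deep:
  assumes "qpoly f" "q \<in> G" "\<And>x. x \<in> G \<Longrightarrow> w (x - q) \<in> c \<Longrightarrow> f x = 0" "x \<in> G"
  shows "f x = 0"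
proof -
  obtain u where u: "u \<in> G" "w u \<in> c" using c_point by blast
  obtain N where N: "\<And>k. k \<ge> N \<Longrightarrow> w ((x - q) + scale k u) \<in> c"
    using ray_enters_chamber[OF u G_diff[OF assms(4,2)]] by blast
  have "f (x + scale k u) = 0" if "k \<ge> N" for k
    using assms(3)[of "x + scale k u"] N[OF that] assms(4) u(1)
    by (simp add: G_add G_scale algebra_simps)
  then show ?thesis using qpoly_vanish[OF assms(1) u(1) assms(4)] by blast
qed

text \<open>
  The set of points \<open>x\<close> with \<open>w (x - q) \<in> c\<close> is what it means to be far inside the chamber. The second
  condition concerns the expansion at infinity, which lives over the opposite cone; the sign
  \<open>(-1)\<^sup>d\<close> is the one of \<open>\<Prod> 1/(1 - s\<^sub>i)\<close> with \<open>d\<close> factors.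
\<close>

definition asymptotic :: "('a \<Rightarrow> real) \<Rightarrow> ('a \<Rightarrow> real) \<Rightarrow> ('a \<Rightarrow> real) \<Rightarrow> bool" where
  "asymptotic f f' T \<longleftrightarrow> (\<exists>q\<in>G. w q \<in> c \<and>
     (\<forall>x\<in>G. w (x - q) \<in> c \<longrightarrow> f x = T x) \<and>
     (\<forall>x\<in>G. w (- x - q) \<in> c \<longrightarrow> f' x = (-1) ^ d * T x))"

lemma asymptoticE:
  assumes "asymptotic f f' T"
  obtains q where "q \<in> G" "w q \<in> c" "\<forall>x\<in>G. w (x - q) \<in> c \<longrightarrow> f x = T x"
    "\<forall>x\<in>G. w (- x - q) \<in> c \<longrightarrow> f' x = (-1) ^ d * T x"
  using assms unfolding asymptotic_def by (elim bexE conjE)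

lemma asymptotic_zero:
  assumes "set Y \<subseteq> gens" "c \<inter> convex_cone hull (w ` set Y) = {}"
  shows "asymptotic (pf Y) (reflected_pf Y) (\<lambda>x. 0)"
proof -
  obtain u where u: "u \<in> G" "w u \<in> c" using c_point by blast
  have YG: "set Y \<subseteq> G" using assms(1) gens_G by blast
  have zero: "pf Y x = 0" if "w x \<in> c" for x
    using pf_supp[OF YG, of x] that assms(2) by blast
  have 1: "pf Y x = 0" if x: "x \<in> G" "w (x - u) \<in> c" for x
    using zero[of x] c_add[OF x(2) u(2)] x u by (simp add: w_diff)
  have 2: "reflected_pf Y x = 0" if x: "x \<in> G" "w (- x - u) \<in> c" for x
  proof -
    let ?s = "sum_list Y"
    have sG: "?s \<in> G" using YG by (rule G_sum_list)
    have "w ?s \<in> convex_cone hull (w ` set Y)"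
      using YG
    proof (induction Y)
      case Nil
      then show ?case by (simp add: w_0)
    next
      case (Cons g Y)
      have "w g \<in> convex_cone hull (w ` set (g # Y))" by (intro hull_inc) auto
      moreover have "w (sum_list Y) \<in> convex_cone hull (w ` set (g # Y))"
        using Cons hull_mono[of "w ` set Y" "w ` set (g # Y)"] by auto
      ultimately show ?case
        using Cons.prems G_sum_list[of Y] by (simp add: w_add convex_cone_hull_add)
    qed
    moreover have "w (- x) \<in> c"
      using c_add[OF x(2) u(2)] x u by (simp add: w_diff G_neg)
    moreover have "w (- x - ?s) + w ?s = w (- x)" using x(1) sG by (simp add: w_diff G_neg)
    ultimately have "w (- x - ?s) \<notin> convex_cone hull (w ` set Y)"
      using assms(2) convex_cone_hull_add by (metis disjoint_iff)
    then show ?thesis using pf_supp[OF YG, of "- x - ?s"] by (auto simp: reflected_pf_def)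
  qed
  show ?thesis unfolding asymptotic_def using u 1 2 by auto
qed

lemma c_spans:
  assumes "c \<subseteq> convex_cone hull S" "x \<in> G"
  shows "w x \<in> real_vector.span S"
proof -
  obtain u where u: "u \<in> G" "w u \<in> c" using c_point by blast
  have "convex_cone hull S \<subseteq> real_vector.span S"
    by (intro hull_minimal real_vector.span_superset convex_cone_span)
  then have sub: "c \<subseteq> real_vector.span S" using assms(1) by blast
  obtain r where r: "r > 0" "r *\<^sub>R w u + w x \<in> c" using c_absorb[OF u(2) assms(2)] by blast
  have "(r *\<^sub>R w u + w x) - r *\<^sub>R w u \<in> real_vector.span S"
    using sub r u by (intro real_vector.span_diff real_vector.span_scale) auto
  then show ?thesis by simp
qed

text \<open>
  A maximal independent set spans a subgroup of finite index: each of the finitely many generators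
  of \<open>G\<close> has a multiple in it.
\<close>

lemma full_rank_index:
  assumes "finite \<sigma>" "\<sigma> \<subseteq> G" "indep \<sigma>" "c \<subseteq> convex_cone hull (w ` \<sigma>)"
  obtains D where "D > 0" "\<And>x. x \<in> G \<Longrightarrow> scale D x \<in> lattice_hull \<sigma>"
proof -
  have ex: "\<exists>D>0. scale D x \<in> lattice_hull \<sigma>" if x: "x \<in> G" for x
  proof (cases "x \<in> \<sigma>")
    case True
    then show ?thesis using lattice_hull_base[OF assms(1)] by (intro exI[of _ 1]) auto
  next
    case False
    have "\<not> indep (insert x \<sigma>)"
    proof
      assume "indep (insert x \<sigma>)"
      then have "inj_on w (insert x \<sigma>)" "\<not> real_vector.dependent (w ` insert x \<sigma>)"
        using rational[of "insert x \<sigma>"] assms x by auto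
      moreover have "w x \<notin> w ` \<sigma>" using \<open>inj_on w (insert x \<sigma>)\<close> False by auto
      ultimately have "w x \<notin> real_vector.span (w ` \<sigma>)"
        by (simp add: real_vector.independent_insert)
      then show False using c_spans[OF assms(4) x] by blast
    qed
    then obtain D k where "D > 0" "scale D x - (\<Sum>u\<in>\<sigma>. scale (k u) u) \<in> K"
      using dependent_insert_obtains[OF assms(1,3)] by blast
    then show ?thesis unfolding lattice_hull_def by blast
  qed
  obtain B where B: "finite B" "span B = G" using finitely_generated by blast
  have "\<forall>x\<in>B. \<exists>D>0. scale D x \<in> lattice_hull \<sigma>" using ex B(2) span_superset by blast
  then obtain D where D: "\<And>x. x \<in> B \<Longrightarrow> D x > 0 \<and> scale (D x) x \<in> lattice_hull \<sigma>" by metis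
  let ?D = "\<Prod>x\<in>B. D x"
  have pos: "?D > 0" using D by (intro prod_pos) auto
  have "subspace {x. scale ?D x \<in> lattice_hull \<sigma>}"
    unfolding subspace_def
  proof (intro conjI ballI allI; clarify?)
    show "scale ?D 0 \<in> lattice_hull \<sigma>" using subspace_0[OF subspace_lattice_hull] by simp
  next
    fix x y assume "scale ?D x \<in> lattice_hull \<sigma>" "scale ?D y \<in> lattice_hull \<sigma>"
    then show "scale ?D (x + y) \<in> lattice_hull \<sigma>"
      using subspace_add[OF subspace_lattice_hull] by (simp add: scale_right_distrib)
  next
    fix k x assume "scale ?D x \<in> lattice_hull \<sigma>"
    then have "scale k (scale ?D x) \<in> lattice_hull \<sigma>" by (rule subspace_scale[OF subspace_lattice_hull])
    then show "scale ?D (scale k x) \<in> lattice_hull \<sigma>" by (simp add: mult.commute)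
  qed
  moreover have "B \<subseteq> {x. scale ?D x \<in> lattice_hull \<sigma>}"
  proof
    fix x assume x: "x \<in> B"
    have "?D = (\<Prod>y\<in>B - {x}. D y) * D x" using prod.remove[OF B(1) x, of D] by (simp add: mult.commute)
    then have eq: "scale ?D x = scale (\<Prod>y\<in>B - {x}. D y) (scale (D x) x)" by simp
    have "scale ?D x \<in> lattice_hull \<sigma>"
      unfolding eq by (rule subspace_scale[OF subspace_lattice_hull conjunct2[OF D[OF x]]])
    then show "x \<in> {x. scale ?D x \<in> lattice_hull \<sigma>}" by simp
  qed
  ultimately have "span B \<subseteq> {x. scale ?D x \<in> lattice_hull \<sigma>}" by (rule span_minimal[rotated])
  then show ?thesis using that[OF pos] B(2) by blast
qed

lemma dual_of_image:
  assumes "finite \<sigma>" "\<sigma> \<subseteq> G" "indep \<sigma>" "u \<in> \<sigma>"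
  shows "y \<in> convex_cone hull (w ` \<sigma>) \<Longrightarrow> 0 \<le> dual (w ` \<sigma>) (w u) y"
    and "x \<in> lattice_hull \<sigma> \<Longrightarrow> dual (w ` \<sigma>) (w u) (w x) = of_int (lcoord \<sigma> x u)"
proof -
  have r: "inj_on w \<sigma>" "\<not> real_vector.dependent (w ` \<sigma>)" using rational[OF assms(1-3)] by auto
  show "0 \<le> dual (w ` \<sigma>) (w u) y" if "y \<in> convex_cone hull (w ` \<sigma>)"
    using that simplicial_cone_iff[OF r(2)] assms(1,4) by blast
  show "dual (w ` \<sigma>) (w u) (w x) = of_int (lcoord \<sigma> x u)" if x: "x \<in> lattice_hull \<sigma>"
  proof -
    have "dual (w ` \<sigma>) (w u) (w x) = (\<Sum>v\<in>\<sigma>. of_int (lcoord \<sigma> x v) * dual (w ` \<sigma>) (w u) (w v))"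
      by (simp add: w_lattice_hull[OF assms(2) x] linear_sum[OF dual(1)[OF r(2)]] linear_scale[OF dual(1)[OF r(2)]])
    also have "\<dots> = (\<Sum>v\<in>\<sigma>. if v = u then of_int (lcoord \<sigma> x v) else 0)"
      using r assms(4) by (intro sum.cong) (auto simp: dual(2) inj_on_eq_iff)
    finally show ?thesis using assms(1,4) by simp
  qed
qed

lemma weak_comps_pos: "0 < m \<Longrightarrow> 0 \<le> k \<Longrightarrow> weak_comps m k = (of_int k + of_nat (m - 1)) gchoose (m - 1)"
  by (cases m) (auto simp: weak_comps.simps)

text \<open>
  Reciprocity in one variable, the identity \<open>(-1)\<^sup>m (-k-1 choose m-1) = - (k+m-1 choose m-1)\<close>.
\<close>

lemma weak_comps_reflect:
  assumes "0 < m" "0 \<le> - k - int m"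
  shows "(-1) ^ m * weak_comps m (- k - int m) = - ((of_int k + of_nat (m - 1)) gchoose (m - 1))"
proof -
  obtain n where m: "m = Suc n" using assms(1) gr0_implies_Suc by blast
  have "(of_int k + of_nat n :: real) gchoose n = (-1) ^ n * ((- of_int k - 1) gchoose n)"
    using gbinomial_negated_upper[of "of_int k + of_nat n :: real" n] by (simp add: algebra_simps)
  moreover have "weak_comps m (- k - int m) = (- of_int k - 1) gchoose n"
  proof -
    have "of_int (- k - int m) + of_nat n = (- of_int k - 1 :: real)" using m by simp
    then show ?thesis using assms(2) m by (simp only: weak_comps.simps if_True)
  qed
  ultimately show ?thesis using m by simp
qed

lemma sum_list_lattice_hull:
  assumes "finite \<sigma>" "set Y \<subseteq> \<sigma>"
  shows "sum_list Y \<in> lattice_hull \<sigma>"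
  using assms(2) by (induction Y) (auto intro: subspace_0[OF subspace_lattice_hull]
      subspace_add[OF subspace_lattice_hull] lattice_hull_base[OF assms(1)])

lemma lcoord_sum_list:
  assumes "finite \<sigma>" "indep \<sigma>" "set Y \<subseteq> \<sigma>" and u: "u \<in> \<sigma>"
  shows "lcoord \<sigma> (sum_list Y) u = int (count_list Y u)"
  using assms(3)
proof (induction Y)
  case Nil
  then show ?case using lcoord_simps(1)[OF assms(1,2) u K_0] by simp
next
  case (Cons g Y)
  have g: "g \<in> \<sigma>" using Cons.prems by simp
  have gh: "g \<in> lattice_hull \<sigma>" using lattice_hull_base[OF assms(1) g] .
  have Yh: "g + sum_list Y \<in> lattice_hull \<sigma>"
    using sum_list_lattice_hull[OF assms(1) Cons.prems] by simp
    have "lcoord \<sigma> (g + sum_list Y - g) u = lcoord \<sigma> (g + sum_list Y) u - lcoord \<sigma> g u"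
      using lcoord_simps(2)[OF assms(1,2) u Yh gh] .
  then show ?case using Cons lcoord_simps(3)[OF assms(1,2) u g] by auto
qed

text \<open>
  On the cone of its independent generators \<open>pf Y\<close> is a product of binomial coefficients in the
  coordinates, supported on the subgroup spanned by the generators. By reciprocity in one variable,
  applied to each of the \<open>d\<close> coordinates, the same quasi-polynomial up to the sign \<open>(-1)\<^sup>d\<close>
  describes the expansion at infinity on the opposite cone.
\<close>

lemma asymptotic_simplicial:
  assumes Y: "set Y \<subseteq> gens" "indep (set Y)" "card (set Y) = d" "c \<subseteq> convex_cone hull (w ` set Y)"
  shows "\<exists>T. qpoly T \<and> asymptotic (pf Y) (reflected_pf Y) T"
proof -
  define \<sigma> where "\<sigma> = set Y"
  have \<sigma>: "finite \<sigma>" "indep \<sigma>" "\<sigma> \<subseteq> G" "\<sigma> \<subseteq> gens" "c \<subseteq> convex_cone hull (w ` \<sigma>)" "card \<sigma> = d"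
    using Y gens_G by (auto simp: \<sigma>_def)
  have pf: "pf Y = simplicial_pf \<sigma> Y"
    using \<sigma> gens_pos by (intro pf_eq_simplicial_pf) (auto simp: \<sigma>_def)
  obtain D where D: "D > 0" "\<And>x. x \<in> G \<Longrightarrow> scale D x \<in> lattice_hull \<sigma>"
    using full_rank_index[OF \<sigma>(1,3,2,5)] by blast
  define \<theta> where "\<theta> u = dual (w ` \<sigma>) (w u)" for u
  have \<theta>: "linear (\<theta> u)"
    "u \<in> \<sigma> \<Longrightarrow> y \<in> convex_cone hull (w ` \<sigma>) \<Longrightarrow> 0 \<le> \<theta> u y"
    "u \<in> \<sigma> \<Longrightarrow> x \<in> lattice_hull \<sigma> \<Longrightarrow> \<theta> u (w x) = of_int (lcoord \<sigma> x u)" for u x y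
    using dual(1) rational[OF \<sigma>(1,3,2)] dual_of_image[OF \<sigma>(1,3,2)] unfolding \<theta>_def by blast+
  let ?m = "count_list Y"
  have m: "?m u > 0" if "u \<in> \<sigma>" for u
    using that count_list_0_iff[of Y u] by (simp add: \<sigma>_def)
  define T where "T x = indicator (lattice_hull \<sigma>) x *
     (\<Prod>u\<in>\<sigma>. (\<theta> u (w x) + of_nat (?m u - 1)) gchoose (?m u - 1))" for x
  have "qpoly (indicator (lattice_hull \<sigma>))"
  proof (rule qpoly.periodic[OF D(1)])
    fix x u assume u: "u \<in> G"
    have "x + scale D u \<in> lattice_hull \<sigma> \<longleftrightarrow> x \<in> lattice_hull \<sigma>"
      using subspace_add[OF subspace_lattice_hull _ D(2)[OF u], of x]
        subspace_diff[OF subspace_lattice_hull _ D(2)[OF u], of "x + scale D u"] by auto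
    then show "indicator (lattice_hull \<sigma>) (x + scale D u) = (indicator (lattice_hull \<sigma>) x :: real)"
      by (simp add: indicator_def)
  qed
  then have qT: "qpoly T"
    unfolding T_def[abs_def]
    by (intro qpoly.mult qpoly_prod qpoly_gbinomial qpoly.add qpoly.linear \<theta>(1) qpoly_const)
  obtain u where u: "u \<in> G" "w u \<in> c" using c_point by blast
  have sG: "sum_list Y \<in> G" using \<sigma>(3) by (intro G_sum_list) (simp add: \<sigma>_def)
  obtain N where N: "\<And>k. k \<ge> N \<Longrightarrow> w (- sum_list Y + scale k u) \<in> c"
    using ray_enters_chamber[OF u G_neg[OF sG]] by blast
  obtain N' where N': "\<And>k. k \<ge> N' \<Longrightarrow> w (0 + scale k u) \<in> c"
    using ray_enters_chamber[OF u G_0] by blast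
  define q where "q = scale (max N N') u"
  have q: "q \<in> G" "w q \<in> c" "w (- sum_list Y + q) \<in> c"
    using N[of "max N N'"] N'[of "max N N'"] u by (auto simp: q_def G_scale)
  have 1: "pf Y x = T x" if x: "x \<in> G" "w (x - q) \<in> c" for x
  proof (cases "x \<in> lattice_hull \<sigma>")
    case False
    then show ?thesis by (simp add: pf simplicial_pf_def T_def)
  next
    case True
    have "w x \<in> c" using c_add[OF x(2) q(2)] x q by (simp add: w_diff)
    then have "0 \<le> lcoord \<sigma> x u" if "u \<in> \<sigma>" for u
      using \<theta>(2)[OF that, of "w x"] \<theta>(3)[OF that True] \<sigma>(5) by auto
    then show ?thesis
      using True m \<theta>(3)[OF _ True]
      by (auto simp: pf simplicial_pf_def T_def weak_comps_pos intro!: prod.cong)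
  qed
  have 2: "reflected_pf Y x = (-1) ^ d * T x" if x: "x \<in> G" "w (- x - q) \<in> c" for x
  proof -
    let ?z = "- x - sum_list Y"
    have sh: "sum_list Y \<in> lattice_hull \<sigma>"
      "\<And>u. u \<in> \<sigma> \<Longrightarrow> lcoord \<sigma> (sum_list Y) u = int (?m u)"
      using sum_list_lattice_hull[OF \<sigma>(1), of Y] lcoord_sum_list[OF \<sigma>(1,2), of Y] by (simp_all add: \<sigma>_def)
    have hull: "?z \<in> lattice_hull \<sigma> \<longleftrightarrow> x \<in> lattice_hull \<sigma>"
    proof
      assume "?z \<in> lattice_hull \<sigma>"
      then have "- (?z + sum_list Y) \<in> lattice_hull \<sigma>"
        using sh(1) by (intro subspace_add[OF subspace_lattice_hull] subspace_neg[OF subspace_lattice_hull])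
      then show "x \<in> lattice_hull \<sigma>" by simp
    next
      assume "x \<in> lattice_hull \<sigma>"
      then show "?z \<in> lattice_hull \<sigma>"
        using sh(1) by (intro subspace_diff[OF subspace_lattice_hull] subspace_neg[OF subspace_lattice_hull])
    qed
    show ?thesis
    proof (cases "x \<in> lattice_hull \<sigma>")
      case False
      then show ?thesis using hull by (simp add: reflected_pf_def pf simplicial_pf_def T_def)
    next
      case True
      have lz: "lcoord \<sigma> ?z u = - lcoord \<sigma> x u - int (?m u)" if v: "u \<in> \<sigma>" for u
      proof -
        have "0 - x \<in> lattice_hull \<sigma>" using True subspace_neg[OF subspace_lattice_hull] by simp
        then have "lcoord \<sigma> (0 - x - sum_list Y) u = lcoord \<sigma> (0 - x) u - lcoord \<sigma> (sum_list Y) u"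
          using lcoord_simps(2)[OF \<sigma>(1,2) v _ sh(1)] by blast
        also have "lcoord \<sigma> (0 - x) u = lcoord \<sigma> 0 u - lcoord \<sigma> x u"
          using lcoord_simps(2)[OF \<sigma>(1,2) v subspace_0[OF subspace_lattice_hull] True] .
        finally show ?thesis
          using lcoord_simps(1)[OF \<sigma>(1,2) v K_0] sh(2)[OF v] by simp
      qed
      have "w ?z = w (- x - q) + w (- sum_list Y + q)"
        using x(1) q(1) sG by (simp add: w_diff w_add G_neg w_neg)
      then have "w ?z \<in> c" using c_add[OF x(2) q(3)] by simp
      then have nn: "0 \<le> - lcoord \<sigma> x u - int (?m u)" if "u \<in> \<sigma>" for u
        using \<theta>(2)[OF that, of "w ?z"] \<theta>(3)[OF that, of ?z] \<sigma>(5) hull True lz[OF that] by auto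
      have "reflected_pf Y x = (-1) ^ (\<Sum>u\<in>\<sigma>. ?m u) * (\<Prod>u\<in>\<sigma>. weak_comps (?m u) (lcoord \<sigma> ?z u))"
        using True hull \<sigma>(1) by (simp add: reflected_pf_def pf simplicial_pf_def sum_count_set \<sigma>_def)
      also have "\<dots> = (\<Prod>u\<in>\<sigma>. (-1) ^ ?m u * weak_comps (?m u) (- lcoord \<sigma> x u - int (?m u)))"
        using lz by (simp add: power_sum prod.distrib)
      also have "\<dots> = (\<Prod>u\<in>\<sigma>. (-1) * ((of_int (lcoord \<sigma> x u) + of_nat (?m u - 1)) gchoose (?m u - 1)))"
        using weak_comps_reflect[OF m nn] by (intro prod.cong) auto
      also have "\<dots> = (-1) ^ d * (\<Prod>u\<in>\<sigma>. (of_int (lcoord \<sigma> x u) + of_nat (?m u - 1)) gchoose (?m u - 1))"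
        by (simp only: prod.distrib prod_constant \<sigma>(6))
      also have "\<dots> = (-1) ^ d * T x" using True \<theta>(3)[OF _ True] by (simp add: T_def)
      finally show ?thesis .
    qed
  qed
  show ?thesis unfolding asymptotic_def using qT q 1 2 by blast
qed

text \<open>
  Sums and shifts only change how far inside the chamber one has to be; this uses that \<open>c\<close> is closed
  under addition.
\<close>

lemma asymptotic_partial_fraction:
  assumes "partial_fraction f f'"
  shows "\<exists>T. qpoly T \<and> asymptotic f f' T"
  using assms
proof induction
  case (base Y)
  consider "card (set Y) = d" "c \<subseteq> convex_cone hull (w ` set Y)" | "c \<inter> convex_cone hull (w ` set Y) = {}"
    using c_compat[OF _ base] by auto
  then show ?case
    using asymptotic_simplicial[OF base] asymptotic_zero[OF base(1)] qpoly_const by cases blast+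
next
  case (add f f' h h')
  then obtain T S where T0: "qpoly T" "asymptotic f f' T" and S0: "qpoly S" "asymptotic h h' S"
    by (elim exE conjE)
  obtain p where p: "p \<in> G" "w p \<in> c" "\<forall>x\<in>G. w (x - p) \<in> c \<longrightarrow> f x = T x"
      "\<forall>x\<in>G. w (- x - p) \<in> c \<longrightarrow> f' x = (-1) ^ d * T x"
    by (rule asymptoticE[OF T0(2)])
  obtain q where q: "q \<in> G" "w q \<in> c" "\<forall>x\<in>G. w (x - q) \<in> c \<longrightarrow> h x = S x"
      "\<forall>x\<in>G. w (- x - q) \<in> c \<longrightarrow> h' x = (-1) ^ d * S x"
    by (rule asymptoticE[OF S0(2)])
  note T = T0(1) p(1,2) p(3)[rule_format] p(4)[rule_format]
  note S = S0(1) q(1,2) q(3)[rule_format] q(4)[rule_format]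
  have le: "w (x - p) \<in> c" "w (x - q) \<in> c" if "x \<in> G" "w (x - (p + q)) \<in> c" for x
    using c_add[OF that(2) S(3)] c_add[OF that(2) T(3)] that(1) S(2) T(2) by (simp_all add: w_diff w_add G_add)
  have "asymptotic (\<lambda>x. f x + h x) (\<lambda>x. f' x + h' x) (\<lambda>x. T x + S x)"
    unfolding asymptotic_def
  proof (intro bexI[of _ "p + q"] conjI ballI impI)
    show "p + q \<in> G" "w (p + q) \<in> c" using S T c_add by (auto simp: w_add G_add)
    fix x assume x: "x \<in> G"
    show "f x + h x = T x + S x" if "w (x - (p + q)) \<in> c"
      using le[OF x that] T(4)[OF x] S(4)[OF x] by simp
    show "f' x + h' x = (-1) ^ d * (T x + S x)" if "w (- x - (p + q)) \<in> c"
      using le[OF G_neg[OF x] that] T(5)[OF x] S(5)[OF x] by (simp add: distrib_left)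
  qed
  then show ?case using qpoly.add[OF T(1) S(1)] by blast
next
  case (neg f f')
  then obtain T where T: "qpoly T" "asymptotic f f' T" by (elim exE conjE)
  have "asymptotic (\<lambda>x. - f x) (\<lambda>x. - f' x) (\<lambda>x. (-1) * T x)"
    using T(2) unfolding asymptotic_def by auto
  then show ?case using qpoly_scale[OF T(1), of "-1"] by blast
next
  case (shift f f' b)
  then obtain T where T0: "qpoly T" "asymptotic f f' T" by (elim exE conjE)
  obtain q where q: "q \<in> G" "w q \<in> c" "\<forall>x\<in>G. w (x - q) \<in> c \<longrightarrow> f x = T x"
      "\<forall>x\<in>G. w (- x - q) \<in> c \<longrightarrow> f' x = (-1) ^ d * T x"
    by (rule asymptoticE[OF T0(2)])
  note T = T0(1) q(1,2) q(3)[rule_format] q(4)[rule_format]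
  obtain T' where T': "qpoly T'" "\<And>x. x \<in> G \<Longrightarrow> T' x = T (x - b)"
    using qpoly_shift[OF T(1) shift(2)] by blast
  have bG: "b \<in> G" by fact
  obtain N1 where N1: "\<And>k. k \<ge> N1 \<Longrightarrow> w ((- b - q) + scale k q) \<in> c"
    using ray_enters_chamber[OF T(2,3), of "- b - q"] bG T(2) G_neg G_diff by blast
  obtain N2 where N2: "\<And>k. k \<ge> N2 \<Longrightarrow> w ((b - q) + scale k q) \<in> c"
    using ray_enters_chamber[OF T(2,3), of "b - q"] bG T(2) G_diff by blast
  obtain N3 where N3: "\<And>k. k \<ge> N3 \<Longrightarrow> w (0 + scale k q) \<in> c"
    using ray_enters_chamber[OF T(2,3) G_0] by blast
  define r where "r = scale (max N1 (max N2 N3)) q"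
  have r: "r \<in> G" "w r \<in> c" "w (- b - q + r) \<in> c" "w (b - q + r) \<in> c"
    using N1[of "max N1 (max N2 N3)"] N2[of "max N1 (max N2 N3)"] N3[of "max N1 (max N2 N3)"] T(2)
    by (auto simp: r_def G_scale)
  have "asymptotic (\<lambda>x. f (x - b)) (\<lambda>x. f' (x - b)) T'"
    unfolding asymptotic_def
  proof (intro bexI[of _ r] conjI ballI impI)
    show "r \<in> G" "w r \<in> c" by fact+
    fix x assume x: "x \<in> G"
    show "f (x - b) = T' x" if "w (x - r) \<in> c"
    proof -
      have "w (x - b - q) = w (x - r) + w (- b - q + r)"
        using x r T(2) bG by (simp add: w_diff w_add w_neg G_neg G_diff G_add)
      then show ?thesis using c_add[OF that r(3)] T(4)[of "x - b"] T'(2)[OF x] x bG G_diff by simp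
    qed
    show "f' (x - b) = (-1) ^ d * T' x" if "w (- x - r) \<in> c"
    proof -
      have "w (- (x - b) - q) = w (- x - r) + w (b - q + r)"
        using x r T(2) bG by (simp add: w_diff w_add w_neg G_neg G_diff G_add)
      then show ?thesis using c_add[OF that r(4)] T(5)[of "x - b"] T'(2)[OF x] x bG G_diff by simp
    qed
  qed
  then show ?case using T'(1) by blast
qed

lemma ex_asymptotic: "set X \<subseteq> gens \<Longrightarrow> \<exists>T. qpoly T \<and> asymptotic (pf X) (reflected_pf X) T"
  using asymptotic_partial_fraction[OF partial_fractions] .

text \<open>
  Far inside \<open>- c\<close> both sides express the expansion at infinity: the left one since there
  \<open>- x - \<Sum>X\<close> is far inside \<open>c\<close> and \<open>T\<close> may be replaced by \<open>pf X\<close>, the right one by the choice of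
  \<open>T\<close>. Quasi-polynomials that agree there agree everywhere.
\<close>

lemma reciprocity:
  assumes "set X \<subseteq> gens" "qpoly T" "asymptotic (pf X) (reflected_pf X) T" "x \<in> G"
  shows "(-1) ^ length X * T (- x - sum_list X) = (-1) ^ d * T x"
proof -
  let ?s = "sum_list X"
  have sG: "?s \<in> G" using assms(1) gens_G by (intro G_sum_list) blast
  obtain q where q0: "q \<in> G" "w q \<in> c" "\<forall>x\<in>G. w (x - q) \<in> c \<longrightarrow> pf X x = T x"
      "\<forall>x\<in>G. w (- x - q) \<in> c \<longrightarrow> reflected_pf X x = (-1) ^ d * T x"
    by (rule asymptoticE[OF assms(3)])
  note q = q0(1,2) q0(3)[rule_format] q0(4)[rule_format]
  obtain T1 where T1: "qpoly T1" "\<And>x. x \<in> G \<Longrightarrow> T1 x = T (- x)"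
    using qpoly_reflect[OF assms(2)] by blast
  obtain T2 where T2: "qpoly T2" "\<And>x. x \<in> G \<Longrightarrow> T2 x = T (x - ?s)"
    using qpoly_shift[OF assms(2) sG] by blast
  define F where "F x = (-1) ^ length X * T2 x - (-1) ^ d * T1 x" for x
  obtain N1 where N1: "\<And>k. k \<ge> N1 \<Longrightarrow> w (- q + scale k q) \<in> c"
    using ray_enters_chamber[OF q(1,2) G_neg[OF q(1)]] by blast
  obtain N2 where N2: "\<And>k. k \<ge> N2 \<Longrightarrow> w ((- ?s - q) + scale k q) \<in> c"
    using ray_enters_chamber[OF q(1,2), of "- ?s - q"] G_diff[OF G_neg[OF sG] q(1)] by blast
  define r where "r = scale (max N1 N2) q"
  have r: "r \<in> G" "w (- q + r) \<in> c" "w (- ?s - q + r) \<in> c"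
    using N1[of "max N1 N2"] N2[of "max N1 N2"] q(1) by (auto simp: r_def G_scale)
  have "F y = 0" if "y \<in> G" for y
  proof (rule qpoly_vanish_deep[of F r])
    show "qpoly F" unfolding F_def[abs_def] by (intro qpoly_diff qpoly_scale T1 T2)
    show "r \<in> G" "y \<in> G" by fact+
    fix x assume x: "x \<in> G" "w (x - r) \<in> c"
    have "w (x - ?s - q) = w (x - r) + w (- ?s - q + r)" "w (- (- x) - q) = w (x - r) + w (- q + r)"
      using x(1) q(1) sG r(1) by (simp_all add: w_diff w_add w_neg G_diff G_add G_neg)
    then have "w (x - ?s - q) \<in> c" "w (- (- x) - q) \<in> c" using c_add[OF x(2)] r by simp_all
    then have "pf X (x - ?s) = T (x - ?s)" "reflected_pf X (- x) = (-1) ^ d * T (- x)"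
      using q(3)[of "x - ?s"] q(4)[of "- x"] x(1) sG G_diff G_neg by auto
    then show "F x = 0" using T1(2)[OF x(1)] T2(2)[OF x(1)] by (simp add: F_def reflected_pf_def)
  qed
  from this[of "- x"] show ?thesis
    using T1(2)[of "- x"] T2(2)[of "- x"] assms(4) by (simp add: F_def G_neg)
qed

end

section \<open>Exactness in the chamber\<close>

lemma sum_list_map_mset_cong:
  fixes f :: "'i \<Rightarrow> 'j::comm_monoid_add"
  assumes "mset xs = mset ys"
  shows "sum_list (map f xs) = sum_list (map f ys)"
proof -
  have "sum_mset (image_mset f (mset xs)) = sum_mset (image_mset f (mset ys))" by (simp add: assms)
  then show ?thesis by (simp add: sum_mset_sum_list flip: mset_map)
qed

context graded_chamber
begin

definition combination :: "('a \<times> real) list \<Rightarrow> 'b" where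
  "combination P = (\<Sum>p\<leftarrow>P. snd p *\<^sub>R w (fst p))"

text \<open>
  \<open>P\<close> lists the generators \<open>X\<close> in some order, each with a coefficient in \<open>[0,1]\<close>. The
  corresponding values of \<open>combination\<close> form the zonotope of \<open>X\<close>. Lists of pairs allow the same
  generator to occur with different coefficients.
\<close>

definition unit_coeffs :: "'a list \<Rightarrow> ('a \<times> real) list \<Rightarrow> bool" where
  "unit_coeffs X P \<longleftrightarrow> mset (map fst P) = mset X \<and> (\<forall>p\<in>set P. 0 \<le> snd p \<and> snd p \<le> 1)"

lemma combination_remove1: "p \<in> set P \<Longrightarrow> combination P = snd p *\<^sub>R w (fst p) + combination (remove1 p P)"
  unfolding combination_def by (rule sum_list_map_remove1)

lemma unit_coeffs_remove1:
  assumes "unit_coeffs X P" "p \<in> set P"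
  shows "unit_coeffs (remove1 (fst p) X) (remove1 p P)" "fst p \<in> set X"
proof -
  have "set (map fst P) = set X" using assms(1) unfolding unit_coeffs_def by (metis set_mset_mset)
  then show "fst p \<in> set X" using assms(2) by force
  have "mset (map fst (remove1 p P)) = mset (remove1 (fst p) X)"
    using assms unfolding unit_coeffs_def by (simp add: image_mset_Diff)
  moreover have "set (remove1 p P) \<subseteq> set P" by (rule set_remove1_subset)
  ultimately show "unit_coeffs (remove1 (fst p) X) (remove1 p P)"
    using assms(1) unfolding unit_coeffs_def by blast
qed

text \<open>
  The zonotope is bounded, so a sufficiently large multiple of a point of \<open>c\<close> moves all of \<open>- z\<close>,
  with \<open>z\<close> in the zonotope, into \<open>c\<close>.
\<close>

lemma absorb_combination:
  assumes "v \<in> c" "set X \<subseteq> G"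
  shows "\<exists>r>0. \<forall>P. unit_coeffs X P \<longrightarrow> r *\<^sub>R v - combination P \<in> c"
  using assms(2)
proof (induction X)
  case Nil
  have "combination P = 0" if "unit_coeffs [] P" for P
    using that by (simp add: unit_coeffs_def combination_def)
  then show ?case using assms(1) by (intro exI[of _ 1]) auto
next
  case (Cons g X)
  then obtain r where r: "r > 0" "\<And>P. unit_coeffs X P \<Longrightarrow> r *\<^sub>R v - combination P \<in> c" by auto
  have g: "g \<in> G" using Cons.prems by simp
  obtain a where a: "a > 0" "a *\<^sub>R v - w g \<in> c"
    using c_absorb[OF assms(1) G_neg[OF g]] g by (auto simp: w_neg)
  have seg: "a *\<^sub>R v - t *\<^sub>R w g \<in> c" if t: "0 \<le> t" "t \<le> 1" for t
  proof -
    consider "t = 0" | "t = 1" | "0 < t" "t < 1" using t by linarith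
    then show ?thesis
    proof cases
      case 3
      have "t *\<^sub>R (a *\<^sub>R v - w g) + ((1 - t) * a) *\<^sub>R v \<in> c"
        using 3 a assms(1) by (intro c_add c_scale) auto
      then show ?thesis by (simp add: algebra_simps)
    qed (use a assms(1) c_scale in auto)
  qed
  have "(r + a) *\<^sub>R v - combination P \<in> c" if P: "unit_coeffs (g # X) P" for P
  proof -
    have "set (map fst P) = set (g # X)" using P unfolding unit_coeffs_def by (metis set_mset_mset)
    then obtain p where p: "p \<in> set P" "fst p = g" by fastforce
    have "unit_coeffs X (remove1 p P)" using unit_coeffs_remove1[OF P p(1)] p(2) by simp
    then have "r *\<^sub>R v - combination (remove1 p P) \<in> c" by (rule r(2))
    moreover have "a *\<^sub>R v - snd p *\<^sub>R w g \<in> c"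
      using seg P p(1) unfolding unit_coeffs_def by blast
    ultimately have "(r *\<^sub>R v - combination (remove1 p P)) + (a *\<^sub>R v - snd p *\<^sub>R w g) \<in> c"
      by (rule c_add)
    then show ?thesis by (simp add: combination_remove1[OF p(1)] p(2) algebra_simps)
  qed
  then show ?case using r(1) a(1) by (intro exI[of _ "r + a"]) auto
qed

lemma cone_coefficients:
  assumes "v \<in> convex_cone hull (w ` set X)"
  obtains s where "\<And>g. 0 \<le> s g" "v = (\<Sum>g\<leftarrow>X. s g *\<^sub>R w g)"
proof -
  let ?S = "{v. \<exists>s. (\<forall>g. 0 \<le> s g) \<and> v = (\<Sum>g\<leftarrow>X. s g *\<^sub>R w g)}"
  have "convex_cone ?S"
    unfolding convex_cone_iff
  proof (intro conjI ballI allI impI)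
    show "0 \<in> ?S" by (intro CollectI exI[of _ "\<lambda>g. 0"]) simp
  next
    fix x y assume "x \<in> ?S" "y \<in> ?S"
    then obtain s t where s: "\<And>g. 0 \<le> s g" "x = (\<Sum>g\<leftarrow>X. s g *\<^sub>R w g)"
      and t: "\<And>g. 0 \<le> t g" "y = (\<Sum>g\<leftarrow>X. t g *\<^sub>R w g)" by auto
    have "x + y = (\<Sum>g\<leftarrow>X. (s g + t g) *\<^sub>R w g)"
      by (simp add: s(2) t(2) sum_list_addf scaleR_add_left)
    then show "x + y \<in> ?S" using s(1) t(1) by (intro CollectI exI[of _ "\<lambda>g. s g + t g"]) simp
  next
    fix x and r :: real assume "x \<in> ?S" "0 \<le> r"
    then obtain s where s: "\<And>g. 0 \<le> s g" "x = (\<Sum>g\<leftarrow>X. s g *\<^sub>R w g)" by auto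
    have "r *\<^sub>R (\<Sum>g\<leftarrow>X. s g *\<^sub>R w g) = (\<Sum>g\<leftarrow>X. (r * s g) *\<^sub>R w g)"
      by (induction X) (simp_all add: scaleR_add_right)
    then show "r *\<^sub>R x \<in> ?S" using s \<open>0 \<le> r\<close> by (intro CollectI exI[of _ "\<lambda>g. r * s g"]) simp
  qed
  moreover have "w ` set X \<subseteq> ?S"
  proof
    fix y assume "y \<in> w ` set X"
    then obtain g where g: "g \<in> set X" "y = w g" by blast
    have *: "(\<Sum>h\<leftarrow>X. (if h = g then r else 0) *\<^sub>R w h) = (real (count_list X g) * r) *\<^sub>R w g" for r
      by (induction X) (simp_all add: scaleR_add_left distrib_right)
    have "count_list X g \<noteq> 0" using g(1) count_list_0_iff[of X g] by simp
    then have "y = (\<Sum>h\<leftarrow>X. (if h = g then 1 / real (count_list X g) else 0) *\<^sub>R w h)"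
      using *[of "1 / real (count_list X g)"] g(2) by simp
    then show "y \<in> ?S"
      by (intro CollectI exI[of _ "\<lambda>h. if h = g then 1 / real (count_list X g) else 0"]) simp
  qed
  ultimately have "convex_cone hull (w ` set X) \<subseteq> ?S" by (rule hull_minimal[rotated])
  then show ?thesis using assms that by blast
qed

text \<open>
  The position of the lattice point \<open>x\<close> is written as \<open>y + k v - z\<close>, with \<open>y + k v\<close> in the chamber and \<open>z\<close> in
  the zonotope of \<open>X\<close>. Increasing \<open>k\<close> continuously increases the coefficients of \<open>z\<close> at the rates \<open>s\<close>,
  until one of them reaches \<open>1\<close>. At this moment \<open>x\<close> may be replaced by \<open>x + g\<close> for the corresponding
  generator \<open>g\<close> and the coefficient reset to \<open>0\<close>; by the assumption \<open>step\<close> this does not change the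
  value of \<open>e\<close>. The walk ends when \<open>k\<close> reaches \<open>r\<close>: the sum that is bounded by \<open>m\<close> is not changed by
  the growth of \<open>k\<close> and drops by \<open>1\<close> at each reset.
\<close>

lemma walk_into_chamber:
  fixes e :: "'a \<Rightarrow> real"
  assumes y: "y \<in> c" and v: "v \<in> c" and s: "\<And>g. 0 \<le> s g" and v_eq: "v = (\<Sum>g\<leftarrow>X. s g *\<^sub>R w g)"
    and XG: "set X \<subseteq> G"
    and step: "\<And>P p y x. unit_coeffs X P \<Longrightarrow> p \<in> set P \<Longrightarrow> y \<in> c \<Longrightarrow> x \<in> G \<Longrightarrow>
      w x = y - combination (remove1 p P) \<Longrightarrow> e x = e (x - fst p)"
    and far: "\<And>P k x. unit_coeffs X P \<Longrightarrow> r \<le> k \<Longrightarrow> x \<in> G \<Longrightarrow>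
      w x = y + k *\<^sub>R v - combination P \<Longrightarrow> e x = 0"
    and "unit_coeffs X P" "0 \<le> k" "x \<in> G" "w x = y + k *\<^sub>R v - combination P"
    and "(\<Sum>p\<leftarrow>P. snd p + (r - k) * s (fst p)) < real m"
  shows "e x = 0"
  using assms(8-12)
proof (induction m arbitrary: P k x)
  case 0
  have "r \<le> k"
  proof (rule ccontr)
    assume "\<not> r \<le> k"
    then have "0 \<le> (\<Sum>p\<leftarrow>P. snd p + (r - k) * s (fst p))"
      using 0(1) s by (intro sum_list_nonneg) (auto simp: unit_coeffs_def intro!: add_nonneg_nonneg mult_nonneg_nonneg)
    then show False using 0(5) by simp
  qed
  then show ?case using far[OF 0(1) _ 0(3,4)] by blast
next
  case (Suc m)
  note P = Suc.prems(1)
  define shifted where "shifted \<delta> = map (\<lambda>p. (fst p, snd p + \<delta> * s (fst p))) P" for \<delta>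
  have v_P: "v = (\<Sum>p\<leftarrow>P. s (fst p) *\<^sub>R w (fst p))"
    using sum_list_map_mset_cong[of "map fst P" X "\<lambda>g. s g *\<^sub>R w g"] P
    by (simp add: v_eq unit_coeffs_def o_def)
  have comb: "combination (shifted \<delta>) = combination P + \<delta> *\<^sub>R v" for \<delta>
  proof -
    have "\<delta> *\<^sub>R (\<Sum>p\<leftarrow>P. s (fst p) *\<^sub>R w (fst p)) = (\<Sum>p\<leftarrow>P. (\<delta> * s (fst p)) *\<^sub>R w (fst p))"
      by (induction P) (simp_all add: scaleR_add_right)
    then show ?thesis
      by (simp add: combination_def shifted_def v_P o_def scaleR_add_left sum_list_addf)
  qed
  have fsts: "map fst (shifted \<delta>) = map fst P" for \<delta> by (simp add: shifted_def o_def)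
  have unit: "unit_coeffs X (shifted \<delta>)"
    if "0 \<le> \<delta>" "\<And>p. p \<in> set P \<Longrightarrow> snd p + \<delta> * s (fst p) \<le> 1" for \<delta>
    using P that s unfolding unit_coeffs_def fsts by (auto simp: shifted_def intro!: add_nonneg_nonneg mult_nonneg_nonneg)
  show ?case
  proof (cases "r \<le> k")
    case True
    then show ?thesis using far[OF P _ Suc.prems(3,4)] by blast
  next
    case False
    show ?thesis
    proof (cases "\<forall>p\<in>set P. snd p + (r - k) * s (fst p) \<le> 1")
      case True
      have "unit_coeffs X (shifted (r - k))" using unit[of "r - k"] False True by simp
      moreover have "w x = y + r *\<^sub>R v - combination (shifted (r - k))"
        using Suc.prems(4) by (simp add: comb algebra_simps)
      ultimately show ?thesis using far[OF _ order_refl Suc.prems(3)] by blast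
    next
      case blocked: False
      let ?Q = "{p \<in> set P. 0 < s (fst p)}" and ?t = "\<lambda>p. (1 - snd p) / s (fst p)"
      obtain b where b: "b \<in> set P" "1 < snd b + (r - k) * s (fst b)" using blocked by force
      have "0 < s (fst b)"
        using b P s[of "fst b"] False unfolding unit_coeffs_def by (cases "s (fst b) = 0") force+
      then have bQ: "b \<in> ?Q" using b by simp
      \<comment> \<open>the time until the first coefficient reaches \<open>1\<close>\<close>
      define \<delta> where "\<delta> = Min (?t ` ?Q)"
      have \<delta>_le: "\<delta> \<le> ?t p" if "p \<in> ?Q" for p unfolding \<delta>_def using that by (intro Min_le) auto
      have "?t ` ?Q \<noteq> {}" using bQ by blast
      then have "\<delta> \<in> ?t ` ?Q" unfolding \<delta>_def by (intro Min_in) auto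
      then obtain p where p: "p \<in> set P" "0 < s (fst p)" "\<delta> = ?t p" by auto
      have \<delta>0: "0 \<le> \<delta>" using p P unfolding unit_coeffs_def by auto
      have "\<delta> \<le> ?t b" using \<delta>_le[OF bQ] .
      also have "\<dots> < r - k" using b(2) bQ by (simp add: divide_simps)
      finally have \<delta>1: "\<delta> < r - k" .
      let ?P = "shifted \<delta>"
      have "snd q + \<delta> * s (fst q) \<le> 1" if q: "q \<in> set P" for q
      proof (cases "0 < s (fst q)")
        case True
        then show ?thesis using \<delta>_le[of q] q by (simp add: le_divide_eq)
      next
        case False
        then have "s (fst q) = 0" using s[of "fst q"] by simp
        then show ?thesis using P q unfolding unit_coeffs_def by simp
      qed
      then have P1: "unit_coeffs X ?P" using unit[OF \<delta>0] by blast
      define p1 where "p1 = (fst p, 1 :: real)"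
      have "snd p + \<delta> * s (fst p) = 1" using p(2,3) by simp
      then have p1: "p1 \<in> set ?P" using p(1) unfolding shifted_def p1_def by force
      \<comment> \<open>replacing \<open>x\<close> by \<open>x + fst p\<close> resets the coefficient of \<open>fst p\<close> from \<open>1\<close> to \<open>0\<close>\<close>
      define P2 where "P2 = (fst p, 0) # remove1 p1 ?P"
      have pG: "fst p \<in> G" using unit_coeffs_remove1(2)[OF P p(1)] XG by blast
      have xG: "x + fst p \<in> G" using Suc.prems(3) pG by (rule G_add)
      have comb2: "combination P2 = combination (remove1 p1 ?P)" by (simp add: P2_def combination_def)
      have w': "w (x + fst p) = y + (k + \<delta>) *\<^sub>R v - combination (remove1 p1 ?P)"
      proof -
        have "combination P + \<delta> *\<^sub>R v = w (fst p) + combination (remove1 p1 ?P)"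
          using combination_remove1[OF p1] comb[of \<delta>] by (simp add: p1_def)
        then have "w (fst p) = combination P + \<delta> *\<^sub>R v - combination (remove1 p1 ?P)" by simp
        then show ?thesis
          using w_add[OF Suc.prems(3) pG] Suc.prems(4) by (simp only:) (simp add: algebra_simps)
      qed
      have "y + (k + \<delta>) *\<^sub>R v \<in> c"
        using y v c_add[OF y c_scale[of "k + \<delta>" v]] Suc.prems(2) \<delta>0 by (cases "k + \<delta> = 0") auto
      from step[OF P1 p1 this xG w'] have "e (x + fst p) = e x" by (simp add: p1_def)
      moreover have "e (x + fst p) = 0"
      proof (rule Suc.IH)
        have "mset (map fst P2) = mset (map fst ?P)"
          using p1 by (simp add: P2_def p1_def image_mset_Diff)
            (metis fst_conv image_eqI image_mset_add_mset insert_DiffM set_image_mset set_mset_mset)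
        moreover have "set (remove1 p1 ?P) \<subseteq> set ?P" by (rule set_remove1_subset)
        ultimately show "unit_coeffs X P2" using P1 unfolding unit_coeffs_def P2_def by auto
        show "0 \<le> k + \<delta>" using Suc.prems(2) \<delta>0 by simp
        show "x + fst p \<in> G" by fact
        show "w (x + fst p) = y + (k + \<delta>) *\<^sub>R v - combination P2" using w' comb2 by simp
        let ?f = "\<lambda>p. snd p + (r - (k + \<delta>)) * s (fst p)"
        have "sum_list (map ?f ?P) = (\<Sum>p\<leftarrow>P. snd p + (r - k) * s (fst p))"
          by (simp add: shifted_def o_def algebra_simps)
        moreover have "sum_list (map ?f ?P) = ?f p1 + sum_list (map ?f (remove1 p1 ?P))"
          by (rule sum_list_map_remove1[OF p1])
        moreover have "sum_list (map ?f P2) = (r - (k + \<delta>)) * s (fst p) + sum_list (map ?f (remove1 p1 ?P))"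
          by (simp add: P2_def)
        ultimately show "sum_list (map ?f P2) < real m"
          using Suc.prems(5) by (simp add: p1_def)
      qed
      ultimately show ?thesis by simp
    qed
  qed
qed

text \<open>
  Induction on the number of generators. If the cone of \<open>X\<close> does not meet \<open>c\<close>, then both sides are
  \<open>0\<close>. Otherwise \<open>e = pf X - T\<close> vanishes far inside the chamber, and for each generator \<open>g\<close> the
  difference \<open>diff_op g e\<close> is the corresponding error for \<open>X\<close> without \<open>g\<close>, which vanishes by the
  induction hypothesis at the points met on the walk of the previous lemma.
\<close>

theorem pf_exact:
  assumes "set X \<subseteq> gens" "qpoly T" "asymptotic (pf X) (reflected_pf X) T"
    "unit_coeffs X P" "y \<in> c" "x \<in> G" "w x = y - combination P"
  shows "pf X x = T x"
  using assms
proof (induction "length X" arbitrary: X T P y x rule: less_induct)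
  case less
  have XG: "set X \<subseteq> G" using less.prems(1) gens_G by blast
  obtain q where q: "q \<in> G" "w q \<in> c" "\<forall>x\<in>G. w (x - q) \<in> c \<longrightarrow> pf X x = T x"
      "\<forall>x\<in>G. w (- x - q) \<in> c \<longrightarrow> reflected_pf X x = (-1) ^ d * T x"
    by (rule asymptoticE[OF less.prems(3)])
  show ?case
  proof (cases "c \<inter> convex_cone hull (w ` set X) = {}")
    case True
    have "T x = 0"
    proof (rule qpoly_vanish_deep[OF less.prems(2) q(1) _ less.prems(6)])
      fix x assume x: "x \<in> G" "w (x - q) \<in> c"
      then have "w x \<in> c" using c_add[OF x(2) q(2)] q(1) by (simp add: w_diff)
      then have "pf X x = 0" using pf_supp[OF XG, of x] True by blast
      then show "T x = 0" using q(3) x by auto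
    qed
    moreover have "pf X x = 0"
    proof (rule ccontr)
      assume "pf X x \<noteq> 0"
      then have 1: "w x \<in> convex_cone hull (w ` set X)" using pf_supp[OF XG] by blast
      have "combination P \<in> convex_cone hull (w ` set X)"
      proof -
        have "set (map fst P) = set X" using less.prems(4) unfolding unit_coeffs_def by (metis set_mset_mset)
        then have "\<forall>p\<in>set P. fst p \<in> set X \<and> 0 \<le> snd p"
          using less.prems(4) unfolding unit_coeffs_def by force
        then show ?thesis
          unfolding combination_def
          by (induction P) (auto intro!: convex_cone_hull_add convex_cone_hull_mul convex_cone_hull_contains_0 intro: hull_inc)
      qed
      from convex_cone_hull_add[OF 1 this] show False using less.prems(5,7) True by auto
    qed
    ultimately show ?thesis by simp
  next
    case False
    then obtain v where v: "v \<in> c" "v \<in> convex_cone hull (w ` set X)" by blast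
    obtain s where s: "\<And>g. 0 \<le> s g" "v = (\<Sum>g\<leftarrow>X. s g *\<^sub>R w g)" using cone_coefficients[OF v(2)] by blast
    obtain r1 where r1: "r1 > 0" "\<And>P. unit_coeffs X P \<Longrightarrow> r1 *\<^sub>R v - combination P \<in> c"
      using absorb_combination[OF v(1) XG] by blast
    obtain r2 where r2: "r2 > 0" "r2 *\<^sub>R v + w (- q) \<in> c"
      using c_absorb[OF v(1) G_neg[OF q(1)]] by blast
    define e where "e x = pf X x - T x" for x
    define r where "r = r1 + r2"
    have far: "e x = 0"
      if P: "unit_coeffs X P" and k: "r \<le> k" and x: "x \<in> G" "w x = y + k *\<^sub>R v - combination P" for P k x
    proof -
      have "y + (k - r) *\<^sub>R v \<in> c"
        using less.prems(5) c_add[OF less.prems(5) c_scale[OF _ v(1), of "k - r"]] k by (cases "k = r") auto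
      then have "(y + (k - r) *\<^sub>R v) + ((r1 *\<^sub>R v - combination P) + (r2 *\<^sub>R v + w (- q))) \<in> c"
        using r1(2)[OF P] r2(2) c_add by blast
      also have "(y + (k - r) *\<^sub>R v) + ((r1 *\<^sub>R v - combination P) + (r2 *\<^sub>R v + w (- q))) = w (x - q)"
        using x q(1) by (simp add: w_diff w_neg r_def algebra_simps)
      finally show ?thesis using q(3) x(1) by (simp add: e_def)
    qed
    have step: "e x = e (x - fst p)"
      if P: "unit_coeffs X P" and p: "p \<in> set P" and y: "y \<in> c" and x: "x \<in> G" "w x = y - combination (remove1 p P)"
      for P p y x
    proof -
      let ?g = "fst p" and ?X = "remove1 (fst p) X"
      have g: "?g \<in> set X" "?g \<in> G" using unit_coeffs_remove1(2)[OF P p] XG by auto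
      have sub: "set ?X \<subseteq> gens" using less.prems(1) set_remove1_subset by (metis subset_trans)
      have pos: "list_all pos X" using less.prems(1) by (rule gens_list)
      obtain T' where T': "qpoly T'" "asymptotic (pf ?X) (reflected_pf ?X) T'" using ex_asymptotic[OF sub] by blast
      have len: "length ?X < length X"
        using length_pos_if_in_set[OF g(1)] g(1) by (simp add: length_remove1)
      have 1: "pf ?X x = T' x"
        using less.hyps[OF len sub T' unit_coeffs_remove1(1)[OF P p] y x] .
      obtain q' where q': "q' \<in> G" "w q' \<in> c" "\<forall>x\<in>G. w (x - q') \<in> c \<longrightarrow> pf ?X x = T' x"
          "\<forall>x\<in>G. w (- x - q') \<in> c \<longrightarrow> reflected_pf ?X x = (-1) ^ d * T' x"
        by (rule asymptoticE[OF T'(2)])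
      obtain T1 where T1: "qpoly T1" "\<And>x. x \<in> G \<Longrightarrow> T1 x = T (x - ?g)"
        using qpoly_shift[OF less.prems(2) g(2)] by blast
      have diff: "pf X z - pf X (z - ?g) = pf ?X z" for z
        using fun_cong[OF diff_op_pf[OF pos g(1)], of z] by (simp add: diff_op_def)
      obtain N where N: "\<And>k. k \<ge> N \<Longrightarrow> w (- ?g + scale k q) \<in> c"
        using ray_enters_chamber[OF q(1,2) G_neg[OF g(2)]] by blast
      obtain N' where N': "\<And>k. k \<ge> N' \<Longrightarrow> w (0 + scale k q) \<in> c"
        using ray_enters_chamber[OF q(1,2) G_0] by blast
      define m where "m = scale (max N N') q"
      have m: "m \<in> G" "w m \<in> c" "w (- ?g + m) \<in> c"
        using N[of "max N N'"] N'[of "max N N'"] q(1) by (auto simp: m_def G_scale)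
      have "T x - T1 x - T' x = 0"
      proof (rule qpoly_vanish_deep[of "\<lambda>x. T x - T1 x - T' x" "q' + (q + m)"])
        show "qpoly (\<lambda>x. T x - T1 x - T' x)" by (intro qpoly_diff less.prems(2) T1 T')
        show "q' + (q + m) \<in> G" using q q' m by (intro G_add)
        fix z assume z: "z \<in> G" "w (z - (q' + (q + m))) \<in> c"
        have "w (z - q) = w (z - (q' + (q + m))) + (w q' + w m)"
          "w (z - q') = w (z - (q' + (q + m))) + (w q + w m)"
          "w (z - ?g - q) = w (z - (q' + (q + m))) + (w q' + w (- ?g + m))"
          using z(1) q(1) q'(1) m(1) g(2) by (simp_all add: w_diff w_add w_neg G_add G_diff G_neg)
        then have "w (z - q) \<in> c" "w (z - q') \<in> c" "w (z - ?g - q) \<in> c"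
          using c_add[OF z(2) c_add[OF q'(2) m(2)]] c_add[OF z(2) c_add[OF q(2) m(2)]]
            c_add[OF z(2) c_add[OF q'(2) m(3)]] by simp_all
        then have "pf X z = T z" "pf ?X z = T' z" "pf X (z - ?g) = T (z - ?g)"
          using q(3) q'(3) z(1) g(2) G_diff by auto
        then show "T z - T1 z - T' z = 0" using diff[of z] T1(2)[OF z(1)] by simp
      qed (rule x(1))
      then show ?thesis using 1 diff[of x] T1(2)[OF x(1)] by (simp add: e_def)
    qed
    obtain m :: nat where m: "(\<Sum>p\<leftarrow>P. snd p + (r - 0) * s (fst p)) < real m"
      using reals_Archimedean2 by blast
    have "w x = y + 0 *\<^sub>R v - combination P" using less.prems(7) by simp
    from walk_into_chamber[OF less.prems(5) v(1) s XG step far less.prems(4) order_refl less.prems(6) this m]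
    show ?thesis by (simp add: e_def)
  qed
qed

end

section \<open>Rational coordinates on the lattice\<close>

lemma common_denominator:
  fixes f :: "'i \<Rightarrow> rat"
  assumes "finite J"
  shows "\<exists>D::int. D > 0 \<and> (\<forall>j\<in>J. \<exists>k::int. of_int D * f j = of_int k)"
  using assms
proof induction
  case empty
  then show ?case by (intro exI[of _ 1]) auto
next
  case (insert j J)
  then obtain D where D: "D > 0" "\<forall>j\<in>J. \<exists>k::int. of_int D * f j = of_int k" by blast
  obtain a b where ab: "f j = Rat.Fract a b" "b > 0" by (cases "f j") auto
  have "of_int (D * b) * f j = of_int (D * a)" using ab by (simp add: Fract_of_int_quotient)
  moreover have "\<exists>k::int. of_int (D * b) * f i = of_int k" if i: "i \<in> J" for i
  proof -
    obtain k :: int where "of_int D * f i = of_int k" using D(2) i by blast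
    then have "of_int (D * b) * f i = of_int (k * b)" by (simp add: mult.commute mult.left_commute)
    then show ?thesis by blast
  qed
  ultimately show ?case using D(1) ab(2) by (intro exI[of _ "D * b"]) (metis insert_iff mult_pos_pos)
qed

text \<open>
  A coordinate of the reals as a vector space over the rationals.
\<close>

lemma rational_functional:
  fixes c :: real
  assumes "c \<noteq> 0"
  obtains f :: "real \<Rightarrow> rat" where "f c = 1" "\<And>x y. f (x + y) = f x + f y"
    "\<And>q x. f (of_rat q * x) = q * f x"
proof -
  interpret Q: vector_space "\<lambda>(q::rat) (x::real). of_rat q * x"
    by unfold_locales (auto simp: of_rat_add of_rat_mult algebra_simps)
  have ind: "Q.independent {c}" using assms by simp
  let ?B = "Q.extend_basis {c}"
  have B: "Q.independent ?B" "Q.span ?B = UNIV" "c \<in> ?B"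
    using Q.independent_extend_basis[OF ind] Q.span_extend_basis[OF ind] Q.extend_basis_superset[OF ind] by auto
  define f where "f x = Q.representation ?B x c" for x
  show ?thesis
  proof (rule that)
    show "f c = 1" using Q.representation_basis[OF B(1,3)] by (simp add: f_def)
    show "f (x + y) = f x + f y" for x y
      using Q.representation_add[OF B(1), of y x] B(2) by (simp add: f_def)
    show "f (of_rat q * x) = q * f x" for q x
      using Q.representation_scale[OF B(1), of x q] B(2) by (simp add: f_def)
  qed
qed

text \<open>
  A real relation between rational vectors is turned into a rational one by applying a
  \<open>\<rat>\<close>-linear functional to its coefficients, and into an integral one by clearing denominators.
\<close>

lemma integer_relation:
  fixes q :: "'i \<Rightarrow> 'v::finite \<Rightarrow> rat" and c :: "'i \<Rightarrow> real"
  assumes J: "finite J" and rel: "\<And>v. (\<Sum>j\<in>J. c j * of_rat (q j v)) = 0" and nz: "j0 \<in> J" "c j0 \<noteq> 0"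
  obtains k :: "'i \<Rightarrow> int" where "\<And>v. (\<Sum>j\<in>J. of_int (k j) * q j v) = 0" "k j0 \<noteq> 0"
proof -
  obtain f :: "real \<Rightarrow> rat" where f: "f (c j0) = 1" "\<And>x y. f (x + y) = f x + f y"
    "\<And>q x. f (of_rat q * x) = q * f x"
    using rational_functional[OF nz(2)] by blast
  have f0: "f 0 = 0" using f(3)[of 0 0] by simp
  have sum: "f (\<Sum>j\<in>A. g j) = (\<Sum>j\<in>A. f (g j))" if "finite A" for A and g :: "'i \<Rightarrow> real"
    using that by induction (simp_all add: f0 f(2))
  have rel': "(\<Sum>j\<in>J. f (c j) * q j v) = 0" for v
  proof -
    have f3: "f (x * of_rat a) = f x * a" for x a using f(3)[of a x] by (simp only: mult.commute)
    have "0 = f (\<Sum>j\<in>J. c j * of_rat (q j v))" by (simp add: rel f0)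
    then show ?thesis by (simp add: sum[OF J] f3)
  qed
  obtain D where D: "D > 0" "\<forall>j\<in>J. \<exists>k::int. of_int D * f (c j) = of_int k"
    using common_denominator[OF J, of "\<lambda>j. f (c j)"] by blast
  then obtain k :: "'i \<Rightarrow> int" where k: "\<And>j. j \<in> J \<Longrightarrow> of_int D * f (c j) = of_int (k j)" by metis
  have "(\<Sum>j\<in>J. of_int (k j) * q j v) = of_int D * (\<Sum>j\<in>J. f (c j) * q j v)" for v
    unfolding sum_distrib_left using k by (intro sum.cong) (auto simp: mult.assoc[symmetric])
  then have 1: "(\<Sum>j\<in>J. of_int (k j) * q j v) = 0" for v by (simp add: rel')
  have 2: "k j0 \<noteq> 0" using k[OF nz(1)] f(1) D(1) by auto
  show ?thesis by (rule that[OF 1 2])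
qed

lemma family_relation:
  fixes p :: "'i \<Rightarrow> 'e::real_vector"
  assumes "finite J" "\<not> (inj_on p J \<and> independent (p ` J))"
  obtains c j0 where "j0 \<in> J" "c j0 \<noteq> 0" "(\<Sum>j\<in>J. c j *\<^sub>R p j) = 0"
proof (cases "inj_on p J")
  case True
  then have "dependent (p ` J)" using assms(2) by blast
  then obtain u where u: "\<exists>y\<in>p ` J. u y \<noteq> 0" "(\<Sum>y\<in>p ` J. u y *\<^sub>R y) = 0"
    using dependent_finite[OF finite_imageI[OF assms(1)], of p] by auto
  have "(\<Sum>j\<in>J. u (p j) *\<^sub>R p j) = 0" using u(2) True by (simp add: sum.reindex)
  moreover obtain j0 where "j0 \<in> J" "u (p j0) \<noteq> 0" using u(1) by blast
  ultimately show ?thesis using that[of j0 "\<lambda>j. u (p j)"] by simp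
next
  case False
  then obtain i j where ij: "i \<in> J" "j \<in> J" "i \<noteq> j" "p i = p j" by (auto simp: inj_on_def)
  let ?c = "\<lambda>l. if l = i then 1 else if l = j then -1 else (0::real)"
  have "(\<Sum>l\<in>J. ?c l *\<^sub>R p l) = (\<Sum>l\<in>{i, j}. ?c l *\<^sub>R p l)"
    using ij assms(1) by (intro sum.mono_neutral_right) auto
  also have "\<dots> = 0" using ij by simp
  finally show ?thesis using that[of i ?c] ij(1) by simp
qed

context lattice_pair
begin

lemma family_independent:
  fixes e :: "'v \<Rightarrow> 'a"
  assumes "inj e" "\<not> dependent (range e)" "(\<Sum>v\<in>UNIV. scale (k v) (e v)) = 0"
  shows "k v = 0"
proof (rule ccontr)
  assume nz: "k v \<noteq> 0"
  have "(\<Sum>x\<in>range e. scale (k (inv e x)) x) = (\<Sum>v\<in>UNIV. scale (k v) (e v))"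
    using assms(1) by (simp add: sum.reindex inv_f_f o_def)
  then have "(\<Sum>x\<in>range e. scale (k (inv e x)) x) = 0" using assms(3) by simp
  moreover have "k (inv e (e v)) \<noteq> 0" using assms(1) nz by (simp add: inv_f_f)
  ultimately have "(\<exists>x\<in>range e. k (inv e x) \<noteq> 0) \<and> (\<Sum>x\<in>range e. scale (k (inv e x)) x) = 0"
    by (intro conjI bexI[of _ "e v"]) simp_all
  then have "dependent (range e)"
    unfolding dependent_finite[OF finite_imageI[OF finite]] by (rule exI[of _ "\<lambda>x. k (inv e x)"])
  then show False using assms(2) by blast
qed

lemma family_span:
  fixes e :: "'v \<Rightarrow> 'a"
  assumes "inj e" "x \<in> span (range e)"
  obtains k where "x = (\<Sum>v\<in>UNIV. scale (k v) (e v))"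
proof -
  obtain u where u: "x = (\<Sum>y\<in>range e. scale (u y) y)"
    using assms(2) span_finite[of "range e"] by auto
  have "x = (\<Sum>v\<in>UNIV. scale (u (e v)) (e v))"
    unfolding u using assms(1) by (simp add: sum.reindex o_def)
  then show ?thesis by (rule that)
qed

lemma L'_basis:
  obtains e :: "'v \<Rightarrow> 'a" where "inj e" "\<not> dependent (range e)" "span (range e) = L'"
proof -
  obtain B where B: "finite B" "card B = CARD('v)" "\<not> dependent B" "span B = L'" using free_L' by blast
  have "\<exists>e. bij_betw e (UNIV :: 'v set) B" using B by (intro finite_same_card_bij) auto
  then obtain e :: "'v \<Rightarrow> 'a" where "inj e" "range e = B" by (auto simp: bij_betw_def)
  then show ?thesis using that B by auto
qed

lemma subspace_L': "subspace L'" and subspace_L: "subspace L"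
  using free_L' basis_L(3) subspace_span by auto

lemma E_L: "E v \<in> L" and E_L': "E v \<in> L'"
  using basis_L(3) span_superset[of "range E"] L_subset by auto

lemma L'_torsion_free:
  assumes "x \<in> L'" "scale m x = 0" "m \<noteq> 0"
  shows "x = 0"
proof -
  obtain e :: "'v \<Rightarrow> 'a" where e: "inj e" "\<not> dependent (range e)" "span (range e) = L'"
    using L'_basis .
  obtain k where k: "x = (\<Sum>v\<in>UNIV. scale (k v) (e v))" using family_span[OF e(1)] assms(1) e(3) by metis
  have "(\<Sum>v\<in>UNIV. scale (m * k v) (e v)) = 0" using assms(2) by (simp add: k scale_sum_right)
  then have "m * k v = 0" for v using family_independent[OF e(1,2), of "\<lambda>v. m * k v" v] by blast
  then show ?thesis using assms(3) by (simp add: k)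
qed

text \<open>
  The vectors \<open>E\<^sub>v\<close> and \<open>x\<close> are one more than the rank of \<open>L'\<close>, hence dependent.
\<close>

lemma multiple_in_L:
  assumes "x \<in> L'"
  obtains m k where "m > 0" "scale m x = (\<Sum>v\<in>UNIV. scale (k v) (E v))"
proof -
  obtain e :: "'v \<Rightarrow> 'a" where e: "inj e" "\<not> dependent (range e)" "span (range e) = L'"
    using L'_basis .
  define z where "z j = (case j of None \<Rightarrow> x | Some v \<Rightarrow> E v)" for j
  have zL': "z j \<in> span (range e)" for j using assms e(3) E_L' by (cases j) (auto simp: z_def)
  have "\<forall>j. \<exists>k. z j = (\<Sum>v\<in>UNIV. scale (k v) (e v))" using family_span[OF e(1) zL'] by blast
  then obtain t where t: "\<And>j. z j = (\<Sum>v\<in>UNIV. scale (t j v) (e v))" by metis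
  define p :: "'v option \<Rightarrow> real ^ 'v" where "p j = (\<chi> v. of_int (t j v))" for j
  have "\<not> (inj p \<and> \<not> real_vector.dependent (range p))"
  proof
    assume *: "inj p \<and> \<not> real_vector.dependent (range p)"
    then have "card (range p) = Suc CARD('v)" by (simp add: card_image)
    then have "real_vector.dependent (range p)" by (intro dependent_biggerset) auto
    then show False using * by blast
  qed
  then obtain c j0 where c: "c j0 \<noteq> 0" "(\<Sum>j\<in>UNIV. c j *\<^sub>R p j) = 0"
    using family_relation[OF finite, of p] by blast
  have "(\<Sum>j\<in>UNIV. c j * of_rat (of_int (t j v))) = 0" for v
    using arg_cong[OF c(2), of "\<lambda>y. y $ v"] by (simp add: p_def)
  then obtain k where k: "\<And>v. (\<Sum>j\<in>UNIV. of_int (k j) * (of_int (t j v) :: rat)) = 0" "k j0 \<noteq> 0"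
    using integer_relation[of UNIV c "\<lambda>j v. of_int (t j v)" j0] c(1) by auto
  have kt: "(\<Sum>j\<in>UNIV. k j * t j v) = 0" for v
  proof -
    have "of_int (\<Sum>j\<in>UNIV. k j * t j v) = (0 :: rat)" using k(1)[of v] by simp
    then show ?thesis by (simp only: of_int_eq_0_iff)
  qed
  have "(\<Sum>j\<in>UNIV. scale (k j) (z j)) = (\<Sum>v\<in>UNIV. scale (\<Sum>j\<in>UNIV. k j * t j v) (e v))"
    unfolding t scale_sum_right scale_sum_left scale_scale by (rule sum.swap)
  then have "(\<Sum>j\<in>UNIV. scale (k j) (z j)) = 0" by (simp only: kt) simp
  then have rel: "scale (k None) x + (\<Sum>v\<in>UNIV. scale (k (Some v)) (E v)) = 0"
    by (simp add: UNIV_option_conv sum.insert z_def sum.reindex o_def)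
  have "k None \<noteq> 0"
  proof
    assume "k None = 0"
    then have "k (Some v) = 0" for v using rel family_independent[OF basis_L(1,2), of "\<lambda>v. k (Some v)"] by simp
    then show False using k(2) \<open>k None = 0\<close> by (cases j0) auto
  qed
  then consider "k None > 0" | "k None < 0" by linarith
  then show ?thesis
  proof cases
    case 1
    then show ?thesis using rel
      by (intro that[of "k None" "\<lambda>v. - k (Some v)"]) (simp_all add: sum_negf eq_neg_iff_add_eq_0)
  next
    case 2
    then show ?thesis using rel
      by (intro that[of "- k None" "\<lambda>v. k (Some v)"]) (simp_all add: add_eq_0_iff)
  qed
qed

lemma coordI:
  assumes "m > 0" "scale m x = (\<Sum>v\<in>UNIV. scale (k v) (E v))"
  shows "coord x v = of_int (k v) / of_int m"
proof -
  have "coord x = (\<lambda>v. of_int (k v) / of_int m)"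
    unfolding coord_def
  proof (rule the_equality)
    show "\<exists>m'>0. \<exists>k' :: 'v \<Rightarrow> int. scale m' x = (\<Sum>v\<in>UNIV. scale (k' v) (E v)) \<and>
        (\<forall>v. of_int (k v) / of_int m = (of_int (k' v) / of_int m' :: rat))"
      using assms by blast
  next
    fix c :: "'v \<Rightarrow> rat"
    assume "\<exists>m'>0. \<exists>k' :: 'v \<Rightarrow> int. scale m' x = (\<Sum>v\<in>UNIV. scale (k' v) (E v)) \<and>
        (\<forall>v. c v = of_int (k' v) / of_int m')"
    then obtain m' k' where k': "m' > 0" "scale m' x = (\<Sum>v\<in>UNIV. scale (k' v) (E v))"
      "\<And>v. c v = of_int (k' v) / of_int m'" by blast
    have "scale m' (scale m x) - scale m (scale m' x) = 0" by (simp add: mult.commute)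
    then have "(\<Sum>v\<in>UNIV. scale (m' * k v - m * k' v) (E v)) = 0"
      unfolding assms(2) k'(2) by (simp add: scale_sum_right scale_left_diff_distrib sum_subtractf)
    then have "m' * k v = m * k' v" for v
      using family_independent[OF basis_L(1,2), of "\<lambda>v. m' * k v - m * k' v" v] by simp
    then have "of_int m' * of_int (k v) = (of_int m * of_int (k' v) :: rat)" for v
      by (metis of_int_mult)
    then show "c = (\<lambda>v. of_int (k v) / of_int m)"
      using assms(1) k'(1) by (simp add: fun_eq_iff k'(3) frac_eq_eq mult.commute)
  qed
  then show ?thesis by simp
qed

lemma coord_L: "x = (\<Sum>v\<in>UNIV. scale (k v) (E v)) \<Longrightarrow> coord x v = of_int (k v)"
  using coordI[of 1 x k v] by simp

lemma L_coords:
  assumes "x \<in> L"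
  obtains k where "x = (\<Sum>v\<in>UNIV. scale (k v) (E v))" "\<And>v. coord x v = of_int (k v)"
proof -
  obtain k where "x = (\<Sum>v\<in>UNIV. scale (k v) (E v))"
    using family_span[OF basis_L(1)] basis_L(3) assms by blast
  then show ?thesis using that coord_L by blast
qed

lemma coord_E: "coord (E u) v = (if v = u then 1 else 0)"
proof -
  have "(\<Sum>v\<in>UNIV. scale (if v = u then 1 else 0) (E v)) = (\<Sum>v\<in>UNIV. if v = u then E u else 0)"
    by (intro sum.cong) auto
  then show ?thesis using coord_L[of "E u" "\<lambda>v. if v = u then 1 else 0" v] by simp
qed

lemma coord_add:
  assumes "x \<in> L'" "y \<in> L'" shows "coord (x + y) v = coord x v + coord y v"
proof -
  obtain m k where m: "m > 0" "scale m x = (\<Sum>v\<in>UNIV. scale (k v) (E v))" using multiple_in_L[OF assms(1)] .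
  obtain n l where n: "n > 0" "scale n y = (\<Sum>v\<in>UNIV. scale (l v) (E v))" using multiple_in_L[OF assms(2)] .
  have "scale (m * n) (x + y) = scale n (scale m x) + scale m (scale n y)"
    by (simp add: scale_right_distrib mult.commute)
  also have "\<dots> = (\<Sum>v\<in>UNIV. scale (n * k v + m * l v) (E v))"
    unfolding m n by (simp add: scale_sum_right scale_left_distrib sum.distrib)
  finally have "coord (x + y) v = of_int (n * k v + m * l v) / of_int (m * n)"
    using m(1) n(1) by (intro coordI) auto
  also have "\<dots> = of_int (k v) / of_int m + of_int (l v) / of_int n"
    using m(1) n(1) by (simp add: field_simps)
  finally show ?thesis using coordI[OF m] coordI[OF n] by simp
qed

lemma coord_scale:
  assumes "x \<in> L'" shows "coord (scale c x) v = of_int c * coord x v"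
proof -
  obtain m k where m: "m > 0" "scale m x = (\<Sum>v\<in>UNIV. scale (k v) (E v))" using multiple_in_L[OF assms] .
  have "scale m (scale c x) = scale c (scale m x)" by (simp add: mult.commute)
  then have "scale m (scale c x) = (\<Sum>v\<in>UNIV. scale (c * k v) (E v))"
    unfolding m by (simp add: scale_sum_right)
  then show ?thesis using coordI[OF m] coordI[OF m(1)] by simp
qed

lemma coord_neg: "x \<in> L' \<Longrightarrow> coord (- x) v = - coord x v"
  using coord_scale[of x "-1" v] by simp

lemma coord_diff: "x \<in> L' \<Longrightarrow> y \<in> L' \<Longrightarrow> coord (x - y) v = coord x v - coord y v"
  using coord_add[of x "- y" v] subspace_neg[OF subspace_L', of y] by (simp add: coord_neg)

lemma coord_zero: "coord 0 v = 0"
  using coord_scale[OF E_L', of 0 undefined v] by simp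

lemma coord_eq_0:
  assumes "x \<in> L'" "\<And>v. coord x v = 0" shows "x = 0"
proof -
  obtain m k where m: "m > 0" "scale m x = (\<Sum>v\<in>UNIV. scale (k v) (E v))" using multiple_in_L[OF assms(1)] .
  have "k v = 0" for v using coordI[OF m, of v] assms(2)[of v] m(1) by simp
  then show ?thesis using m L'_torsion_free[OF assms(1), of m] by simp
qed

lemma cls_eq_iff: "cls x = cls y \<longleftrightarrow> x - y \<in> L"
proof
  assume "cls x = cls y"
  moreover have "x + 0 \<in> cls x" unfolding cls_def using subspace_0[OF subspace_L] by blast
  ultimately obtain l where "l \<in> L" "x = y + l" unfolding cls_def by auto
  then show "x - y \<in> L" by simp
next
  assume *: "x - y \<in> L"
  have "{x + l |l. l \<in> L} \<subseteq> {y + l |l. l \<in> L}" if "x - y \<in> L" for x y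
  proof clarify
    fix l assume "l \<in> L"
    then have "x + l = y + ((x - y) + l)" "(x - y) + l \<in> L" using that subspace_add[OF subspace_L] by auto
    then show "\<exists>l'. x + l = y + l' \<and> l' \<in> L" by blast
  qed
  from this[OF *] this[of y x] show "cls x = cls y"
    using subspace_neg[OF subspace_L *] unfolding cls_def by (intro equalityI) auto
qed

lemma rep:
  assumes "h \<in> class_group"
  shows "rep h \<in> L'" "cls (rep h) = h" "0 \<le> coord (rep h) v" "coord (rep h) v < 1"
proof -
  obtain x where x: "x \<in> L'" "h = cls x" using assms unfolding class_group_def by blast
  let ?f = "\<Sum>v\<in>UNIV. scale \<lfloor>coord x v\<rfloor> (E v)"
  have fL: "?f \<in> L" by (intro subspace_sum[OF subspace_L] subspace_scale[OF subspace_L] E_L)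
  then have fL': "?f \<in> L'" using L_subset by blast
  let ?r = "x - ?f"
  have c: "coord ?r v = frac (coord x v)" for v
    using coord_diff[OF x(1) fL'] coord_L[of ?f "\<lambda>v. \<lfloor>coord x v\<rfloor>" v] by (simp add: frac_def)
  have ex: "?r \<in> L' \<and> cls ?r = h \<and> (\<forall>v. 0 \<le> coord ?r v \<and> coord ?r v < 1)"
    using subspace_diff[OF subspace_L' x(1) fL'] subspace_neg[OF subspace_L fL]
    by (auto simp: c frac_lt_1 x(2) cls_eq_iff)
  moreover have "y = ?r" if y: "y \<in> L' \<and> cls y = h \<and> (\<forall>v. 0 \<le> coord y v \<and> coord y v < 1)" for y
  proof -
    have "y - ?r \<in> L" using y ex cls_eq_iff by metis
    then obtain k where k: "\<And>v. coord (y - ?r) v = of_int (k v)" using L_coords by blast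
    have "coord (y - ?r) v = 0" for v
    proof -
      have "coord (y - ?r) v = coord y v - coord ?r v" using y ex by (intro coord_diff) simp_all
      moreover have "0 \<le> coord y v" "coord y v < 1" "0 \<le> coord ?r v" "coord ?r v < 1" using y ex by blast+
      ultimately have "\<bar>coord (y - ?r) v\<bar> < 1" by linarith
      then show ?thesis using k[of v] by simp
    qed
    then have "y - ?r = 0"
      using y ex subspace_diff[OF subspace_L'] by (intro coord_eq_0) blast+
    then show ?thesis by simp
  qed
  ultimately have "rep h = ?r" unfolding rep_def by (intro the_equality)
  then show "rep h \<in> L'" "cls (rep h) = h" "0 \<le> coord (rep h) v" "coord (rep h) v < 1" using ex by simp_all
qed

lemma restr_nth: "restr I x $ v = (if v \<in> I then of_rat (coord x v) else 0)"
  by (simp add: restr_def)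

lemma restr_coord_space: "restr I x \<in> coord_space I"
  by (simp add: coord_space_def restr_nth)

lemma restr_add: "x \<in> L' \<Longrightarrow> y \<in> L' \<Longrightarrow> restr I (x + y) = restr I x + restr I y"
  by (simp add: vec_eq_iff restr_nth coord_add of_rat_add)

end

section \<open>Geometry of chambers\<close>

text \<open>
  \<open>\<Gamma>\<close> stands for the restrictions of the generators. The positivity of the coordinate sums makes all
  cones pointed, and the axes make the positive orthant one of the cones.
\<close>

locale chamber_arrangement =
  fixes I :: "'v::finite set" and \<Gamma> C :: "(real ^ 'v) set"
  assumes finite_\<Gamma>: "finite \<Gamma>" and \<Gamma>_subset: "\<Gamma> \<subseteq> coord_space I"
    and axes: "\<And>v. v \<in> I \<Longrightarrow> axis v 1 \<in> \<Gamma>"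
    and \<Gamma>_nonneg: "\<And>g v. g \<in> \<Gamma> \<Longrightarrow> v \<in> I \<Longrightarrow> 0 \<le> g $ v"
    and \<Gamma>_pos: "\<And>g. g \<in> \<Gamma> \<Longrightarrow> 0 < (\<Sum>v\<in>I. g $ v)"
    and C: "C \<in> chambers I \<Gamma>"
begin

abbreviation "walls \<equiv> \<Union>\<sigma>\<in>bases_in I \<Gamma>. top_of_set (coord_space I) frontier_of (convex_cone hull \<sigma>)"

lemma subspace_V: "subspace (coord_space I)"
  by (auto simp: subspace_def coord_space_def)

lemma axes_expand: "x \<in> coord_space I \<Longrightarrow> x = (\<Sum>v\<in>I. x $ v *\<^sub>R axis v 1)"
  by (auto simp: vec_eq_iff coord_space_def axis_def if_distrib[of "\<lambda>y. _ * y"] cong: if_cong)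

lemma span_\<Gamma>: "span \<Gamma> = coord_space I"
proof
  show "span \<Gamma> \<subseteq> coord_space I" using \<Gamma>_subset subspace_V by (rule span_minimal)
  show "coord_space I \<subseteq> span \<Gamma>"
  proof
    fix x assume x: "x \<in> coord_space I"
    have "(\<Sum>v\<in>I. x $ v *\<^sub>R axis v 1) \<in> span \<Gamma>"
      using axes by (intro span_sum span_scale span_base)
    then show "x \<in> span \<Gamma>"
      by (rule back_subst[of "\<lambda>y. y \<in> span \<Gamma>", OF _ axes_expand[OF x, symmetric]])
  qed
qed

lemma basesD:
  assumes "\<sigma> \<in> bases_in I \<Gamma>"
  shows "independent \<sigma>" "finite \<sigma>" "\<sigma> \<subseteq> \<Gamma>" "span \<sigma> = coord_space I"
  using assms by (auto simp: bases_in_def intro: independent_imp_finite)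

lemma finite_bases: "finite (bases_in I \<Gamma>)"
  using finite_\<Gamma> by (rule finite_subset[rotated, OF finite_Pow_iff[THEN iffD2]]) (auto simp: bases_in_def)

lemma walls_iff: "x \<in> walls \<longleftrightarrow> x \<in> coord_space I \<and>
    (\<exists>\<sigma>\<in>bases_in I \<Gamma>. (\<forall>u\<in>\<sigma>. 0 \<le> dual \<sigma> u x) \<and> (\<exists>u\<in>\<sigma>. dual \<sigma> u x = 0))"
proof -
  have "top_of_set (coord_space I) frontier_of (convex_cone hull \<sigma>)
      = {x \<in> coord_space I. (\<forall>u\<in>\<sigma>. 0 \<le> dual \<sigma> u x) \<and> (\<exists>u\<in>\<sigma>. dual \<sigma> u x = 0)}"
    if "\<sigma> \<in> bases_in I \<Gamma>" for \<sigma>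
    using frontier_simplicial_cone[OF basesD(1,4)[OF that]] .
  then have "walls = (\<Union>\<sigma>\<in>bases_in I \<Gamma>.
      {x \<in> coord_space I. (\<forall>u\<in>\<sigma>. 0 \<le> dual \<sigma> u x) \<and> (\<exists>u\<in>\<sigma>. dual \<sigma> u x = 0)})"
    by (rule SUP_cong[OF refl])
  then show ?thesis by blast
qed

lemma closed_walls: "closed walls"
proof -
  have "closedin (top_of_set (coord_space I)) walls"
    using finite_bases by (intro closedin_Union) (auto intro: closedin_frontier_of)
  moreover have "closed (coord_space I)" using subspace_V by (rule closed_subspace)
  ultimately show ?thesis by (rule closedin_closed_trans)
qed

lemma C_component: "C \<in> components (coord_space I - walls)"
  using C by (simp add: chambers_def)

lemma C_subset: "C \<subseteq> coord_space I - walls" and C_nonempty: "C \<noteq> {}" and connected_C: "connected C"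
  using C_component by (auto dest: in_components_subset in_components_nonempty in_components_connected)

lemma C_V: "x \<in> C \<Longrightarrow> x \<in> coord_space I"
  using C_subset by blast

lemma segment_in_C:
  assumes "x \<in> C" "\<And>t. 0 \<le> t \<Longrightarrow> t \<le> 1 \<Longrightarrow> (1 - t) *\<^sub>R x + t *\<^sub>R y \<in> coord_space I - walls"
  shows "y \<in> C"
proof -
  have "closed_segment x y \<subseteq> C"
  proof (rule components_maximal[OF C_component])
    show "closed_segment x y \<subseteq> coord_space I - walls" using assms(2) by (auto simp: closed_segment_def)
    show "C \<inter> closed_segment x y \<noteq> {}" using assms(1) by auto
  qed simp
  then show ?thesis by auto
qed

lemma C_open:
  assumes "x \<in> C"
  obtains e where "e > 0" "\<And>y. y \<in> coord_space I \<Longrightarrow> dist y x < e \<Longrightarrow> y \<in> C"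
proof -
  let ?V = "coord_space I"
  have op: "openin (top_of_set ?V) (?V - walls)"
    using closed_walls by (simp add: Diff_eq openin_open_Int open_closed)
  have "locally connected ?V" using subspace_V by (intro convex_imp_locally_connected subspace_imp_convex)
  then have "locally connected (?V - walls)" using op by (rule locally_open_subset)
  then have "openin (top_of_set (?V - walls)) C" using C_component by (rule openin_components_locally_connected)
  then have "openin (top_of_set ?V) C" using op by (rule openin_trans)
  then show ?thesis using assms that unfolding openin_euclidean_subtopology_iff by (meson)
qed

lemma C_scale:
  assumes "x \<in> C" "0 < r" shows "r *\<^sub>R x \<in> C"
proof (rule segment_in_C[OF assms(1)])
  fix t :: real assume t: "0 \<le> t" "t \<le> 1"
  define s where "s = (1 - t) + t * r"
  have s: "0 < s" using t assms(2) unfolding s_def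
    by (cases "t = 1") (auto intro!: add_pos_nonneg)
  have eq: "(1 - t) *\<^sub>R x + t *\<^sub>R r *\<^sub>R x = s *\<^sub>R x" by (simp add: s_def scaleR_add_left)
  have "s *\<^sub>R x \<notin> walls"
  proof
    assume "s *\<^sub>R x \<in> walls"
    then obtain \<sigma> where \<sigma>: "\<sigma> \<in> bases_in I \<Gamma>" "\<forall>u\<in>\<sigma>. 0 \<le> dual \<sigma> u (s *\<^sub>R x)" "\<exists>u\<in>\<sigma>. dual \<sigma> u (s *\<^sub>R x) = 0"
      unfolding walls_iff by blast
    then have "x \<in> walls"
      unfolding walls_iff using s C_V[OF assms(1)]
      by (intro conjI bexI[of _ \<sigma>]) (auto simp: dual_simps[OF basesD(1)[OF \<sigma>(1)]] zero_le_mult_iff)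
    then show False using assms(1) C_subset by blast
  qed
  then show "(1 - t) *\<^sub>R x + t *\<^sub>R r *\<^sub>R x \<in> coord_space I - walls"
    unfolding eq using C_V[OF assms(1)] subspace_scale[OF subspace_V] by blast
qed

text \<open>
  \<open>C\<close> is open in the coordinate space and invariant under positive scaling.
\<close>

lemma C_absorb:
  assumes "y \<in> C" "x \<in> coord_space I"
  shows "\<exists>r>0. \<forall>t\<ge>r. t *\<^sub>R y + x \<in> C"
proof -
  obtain e where e: "e > 0" "\<And>z. z \<in> coord_space I \<Longrightarrow> dist z y < e \<Longrightarrow> z \<in> C"
    using C_open[OF assms(1)] by blast
  define r where "r = (norm x + 1) / e"
  have r: "r > 0" using e(1) by (simp add: r_def add_nonneg_pos)
  have "t *\<^sub>R y + x \<in> C" if t: "t \<ge> r" for t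
  proof -
    have t0: "t > 0" using t r by linarith
    have "y + (1 / t) *\<^sub>R x \<in> C"
    proof (rule e(2))
      show "y + (1 / t) *\<^sub>R x \<in> coord_space I"
        using C_V[OF assms(1)] assms(2) subspace_V by (intro subspace_add subspace_scale)
      have "norm x < r * e" using e(1) by (simp add: r_def)
      also have "r * e \<le> t * e" using t e(1) by simp
      finally show "dist (y + (1 / t) *\<^sub>R x) y < e" using t0 by (simp add: dist_norm divide_simps mult.commute)
    qed
    from C_scale[OF this t0] show ?thesis using t0 by (simp add: scaleR_add_right)
  qed
  then show ?thesis using r by blast
qed

text \<open>
  Off the walls, lying in a simplicial cone is the same as lying in its interior, and a connected
  set cannot be split by an open and closed condition.
\<close>

lemma C_basis_cases:
  assumes \<sigma>: "\<sigma> \<in> bases_in I \<Gamma>"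
  shows "(\<forall>x\<in>C. \<forall>u\<in>\<sigma>. 0 < dual \<sigma> u x) \<or> C \<inter> convex_cone hull \<sigma> = {}"
proof -
  note b = basesD[OF \<sigma>]
  let ?A = "\<Inter>u\<in>\<sigma>. {x. 0 < dual \<sigma> u x}" and ?B = "\<Union>u\<in>\<sigma>. {x. dual \<sigma> u x < 0}"
  have "open ?A" "open ?B"
    using b by (auto intro!: open_INT open_UN open_Collect_less continuous_on_const continuous_dual)
  moreover have "C \<subseteq> ?A \<union> ?B"
  proof
    fix x assume x: "x \<in> C"
    then have "x \<notin> walls" using C_subset by blast
    then have "\<not> ((\<forall>u\<in>\<sigma>. 0 \<le> dual \<sigma> u x) \<and> (\<exists>u\<in>\<sigma>. dual \<sigma> u x = 0))"
      using C_V[OF x] \<sigma> unfolding walls_iff by blast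
    then show "x \<in> ?A \<union> ?B" by force
  qed
  moreover have "?A \<inter> ?B \<inter> C = {}" by force
  ultimately have "?A \<inter> C = {} \<or> ?B \<inter> C = {}" by (intro connectedD[OF connected_C])
  then show ?thesis
  proof
    assume "?A \<inter> C = {}"
    then have "C \<subseteq> ?B" using \<open>C \<subseteq> ?A \<union> ?B\<close> by blast
    then have "C \<inter> convex_cone hull \<sigma> = {}"
      unfolding disjoint_iff simplicial_cone_iff[OF b(1,2)] by force
    then show ?thesis ..
  next
    assume "?B \<inter> C = {}"
    then have "C \<subseteq> ?A" using \<open>C \<subseteq> ?A \<union> ?B\<close> by blast
    then show ?thesis by blast
  qed
qed

lemma C_cone_cases:
  assumes "\<sigma> \<in> bases_in I \<Gamma>"
  shows "C \<subseteq> convex_cone hull \<sigma> \<or> C \<inter> convex_cone hull \<sigma> = {}"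
proof -
  note b = basesD[OF assms]
  have "C \<subseteq> convex_cone hull \<sigma>" if *: "\<forall>x\<in>C. \<forall>u\<in>\<sigma>. 0 < dual \<sigma> u x"
  proof
    fix x assume x: "x \<in> C"
    then have "\<forall>u\<in>\<sigma>. 0 \<le> dual \<sigma> u x" using * less_imp_le by blast
    then show "x \<in> convex_cone hull \<sigma>" using simplicial_cone_iff[OF b(1,2)] b(4) C_V[OF x] by blast
  qed
  then show ?thesis using C_basis_cases[OF assms] by blast
qed

text \<open>
  A set of generators that is not a basis extends to one, and its cone lies in the boundary of the
  cone of this basis.
\<close>

lemma C_avoids_small_cones:
  assumes "\<tau> \<subseteq> \<Gamma>" "independent \<tau>" "\<tau> \<notin> bases_in I \<Gamma>"
  shows "C \<inter> convex_cone hull \<tau> = {}"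
proof (rule ccontr)
  assume "\<not> ?thesis"
  then obtain x where x: "x \<in> C" "x \<in> convex_cone hull \<tau>" by blast
  obtain \<sigma> where \<sigma>: "\<tau> \<subseteq> \<sigma>" "\<sigma> \<subseteq> \<Gamma>" "independent \<sigma>" "\<Gamma> \<subseteq> span \<sigma>"
    using maximal_independent_subset_extend[OF assms(1,2)] by blast
  have "span \<sigma> = coord_space I"
    using \<sigma>(2,4) span_\<Gamma> by (metis span_mono span_span subset_antisym)
  then have \<sigma>b: "\<sigma> \<in> bases_in I \<Gamma>" using \<sigma> by (simp add: bases_in_def)
  then have "\<tau> \<noteq> \<sigma>" using assms(3) by auto
  then obtain u where u: "u \<in> \<sigma>" "u \<notin> \<tau>" using \<sigma>(1) by blast
  note b = basesD[OF \<sigma>b]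
  have fin: "finite \<tau>" using b(2) \<sigma>(1) finite_subset by blast
  have xs: "x \<in> span \<tau>" "\<forall>u\<in>\<tau>. 0 \<le> dual \<tau> u x" using x(2) simplicial_cone_iff[OF assms(2) fin] by blast+
  have "dual \<sigma> u x = 0"
    by (subst dual_expand[OF assms(2) fin xs(1)]) (simp add: dual_combination[OF b(1,2) \<sigma>(1) u(1)] u(2))
  moreover have "x \<in> convex_cone hull \<sigma>" using x(2) hull_mono[OF \<sigma>(1)] by blast
  then have "\<forall>u\<in>\<sigma>. 0 \<le> dual \<sigma> u x" using simplicial_cone_iff[OF b(1,2)] by blast
  ultimately have "x \<in> walls" unfolding walls_iff using C_V[OF x(1)] \<sigma>b u(1) by blast
  then show False using x(1) C_subset by blast
qed

text \<open>
  The intersection of the interiors of the simplicial cones that contain \<open>C\<close>. It is convex by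
  construction and will turn out to be \<open>C\<close>.
\<close>

definition inside :: "(real ^ 'v) set" where
  "inside = {y \<in> coord_space I. \<forall>\<sigma>\<in>bases_in I \<Gamma>. C \<subseteq> convex_cone hull \<sigma> \<longrightarrow> (\<forall>u\<in>\<sigma>. 0 < dual \<sigma> u y)}"

lemma C_subset_inside: "C \<subseteq> inside"
proof
  fix x assume x: "x \<in> C"
  have "0 < dual \<sigma> u x" if "\<sigma> \<in> bases_in I \<Gamma>" "C \<subseteq> convex_cone hull \<sigma>" "u \<in> \<sigma>" for \<sigma> u
    using C_basis_cases[OF that(1)] x that by blast
  then show "x \<in> inside" unfolding inside_def using C_V[OF x] by blast
qed

lemma inside_combination:
  assumes "x \<in> inside" "y \<in> inside" "0 \<le> s" "0 \<le> t" "0 < s + t"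
  shows "s *\<^sub>R x + t *\<^sub>R y \<in> inside"
proof -
  have "0 < dual \<sigma> u (s *\<^sub>R x + t *\<^sub>R y)"
    if \<sigma>: "\<sigma> \<in> bases_in I \<Gamma>" "C \<subseteq> convex_cone hull \<sigma>" "u \<in> \<sigma>" for \<sigma> u
  proof -
    have "0 < dual \<sigma> u x" "0 < dual \<sigma> u y" using assms(1,2) \<sigma> unfolding inside_def by blast+
    then show ?thesis
      using assms(3-5) by (cases "s = 0") (auto simp: dual_simps[OF basesD(1)[OF \<sigma>(1)]] add_pos_nonneg)
  qed
  moreover have "s *\<^sub>R x + t *\<^sub>R y \<in> coord_space I"
    using assms(1,2) subspace_V unfolding inside_def by (auto intro: subspace_add subspace_scale)
  ultimately show ?thesis unfolding inside_def by blast
qed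

text \<open>
  This is the reason for the convexity of chambers. A wall point \<open>p\<close> is a combination of a set \<open>\<tau>\<close>
  of generators smaller than a basis. The points \<open>z = (1 - s) p + s x\<close> with small \<open>s\<close> lie in \<open>C\<close> and
  are combinations of \<open>\<tau>\<close> and the axes in which the axes have total weight proportional to \<open>s\<close>.
  Caratheodory's theorem, with this weight as cost, produces a basis whose cone contains \<open>z\<close>, and
  hence all of \<open>C\<close>, such that the coordinates of \<open>z\<close> outside \<open>\<tau>\<close> are of order \<open>s\<close>. But such a
  coordinate exists, and it is bounded from below if \<open>p\<close> is in the interior of the cone.
\<close>

lemma wall_point_not_inside:
  assumes nonneg: "\<And>x v. x \<in> C \<Longrightarrow> v \<in> I \<Longrightarrow> 0 \<le> x $ v" and x: "x \<in> C" and p: "p \<in> inside"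
    and ray: "\<And>s. 0 < s \<Longrightarrow> s \<le> 1 \<Longrightarrow> (1 - s) *\<^sub>R p + s *\<^sub>R x \<in> C"
  shows "p \<notin> walls"
proof
  assume "p \<in> walls"
  then obtain \<rho> u0 where \<rho>: "\<rho> \<in> bases_in I \<Gamma>" "\<forall>u\<in>\<rho>. 0 \<le> dual \<rho> u p" "u0 \<in> \<rho>" "dual \<rho> u0 p = 0"
    unfolding walls_iff by blast
  note b = basesD[OF \<rho>(1)]
  define \<tau> where "\<tau> = \<rho> - {u0}"
  have "p \<in> span \<rho>" using p b(4) by (simp add: inside_def)
  from dual_expand[OF b(1,2) this] have p_eq: "p = (\<Sum>u\<in>\<tau>. dual \<rho> u p *\<^sub>R u)"
    using sum.remove[OF b(2) \<rho>(3), of "\<lambda>u. dual \<rho> u p *\<^sub>R u"] \<rho>(4) by (simp add: \<tau>_def)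
  define A where "A = (\<lambda>v. axis v (1 :: real)) ` I"
  have inj: "inj_on (\<lambda>v. axis v (1 :: real)) I" by (auto simp: inj_on_def axis_eq_axis)
  define \<alpha> where "\<alpha> y = (\<Sum>v\<in>I. x $ v * y $ v)" for y
  have \<alpha>: "\<alpha> (axis v 1) = x $ v" if "v \<in> I" for v
    using that by (simp add: \<alpha>_def axis_def if_distrib[of "\<lambda>y. _ * y"] cong: if_cong)
  have x_eq: "x = (\<Sum>u\<in>A. \<alpha> u *\<^sub>R u)"
    using axes_expand[OF C_V[OF x]] by (simp add: A_def sum.reindex[OF inj] \<alpha>)
  have \<alpha>0: "0 \<le> \<alpha> u" if "u \<in> A" for u using that nonneg[OF x] by (auto simp: A_def \<alpha>)
  define S where "S = \<tau> \<union> A"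
  have S: "finite S" "S \<subseteq> \<Gamma>" using b axes by (auto simp: S_def \<tau>_def A_def)
  define M where "M = (\<Sum>u\<in>A. \<alpha> u)"
  have M: "0 \<le> M" unfolding M_def using \<alpha>0 by (rule sum_nonneg)
  define \<Delta> where "\<Delta> = (\<Union>\<sigma>\<in>{\<sigma> \<in> bases_in I \<Gamma>. C \<subseteq> convex_cone hull \<sigma>}. (\<lambda>u. dual \<sigma> u p) ` \<sigma>)"
  \<comment> \<open>a lower bound for all coordinates of \<open>p\<close> in the cones that contain \<open>C\<close>\<close>
  define \<delta> where "\<delta> = Min (insert 1 \<Delta>)"
  have fin\<Delta>: "finite (insert 1 \<Delta>)" unfolding \<Delta>_def using finite_bases basesD(2) by auto
  have \<delta>: "0 < \<delta>" "\<And>y. y \<in> \<Delta> \<Longrightarrow> \<delta> \<le> y"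
  proof -
    have "\<forall>y\<in>insert 1 \<Delta>. 0 < y" using p by (auto simp: \<Delta>_def inside_def)
    then show "0 < \<delta>" unfolding \<delta>_def using fin\<Delta> by (subst Min_gr_iff) auto
    show "\<delta> \<le> y" if "y \<in> \<Delta>" for y unfolding \<delta>_def using fin\<Delta> that by (intro Min_le) auto
  qed
  \<comment> \<open>small enough that the cost \<open>s * M\<close> stays below the coordinates of \<open>(1 - s) *\<^sub>R p\<close>\<close>
  define s where "s = \<delta> / (\<delta> + M + 1)"
  have s: "0 < s" "s < 1" "s * M < (1 - s) * \<delta>"
  proof -
    have pos: "0 < \<delta> + M + 1" using \<delta>(1) M by simp
    then show "0 < s" "s < 1" using \<delta>(1) M by (simp_all add: s_def)
    have "s * (\<delta> + M + 1) = \<delta>" using pos by (simp add: s_def)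
    then have "(1 - s) * \<delta> = s * M + s" by (simp add: algebra_simps)
    then show "s * M < (1 - s) * \<delta>" using \<open>0 < s\<close> by simp
  qed
  define z where "z = (1 - s) *\<^sub>R p + s *\<^sub>R x"
  have zC: "z \<in> C" unfolding z_def using ray s by simp
  define l where "l u = (if u \<in> \<tau> then (1 - s) * dual \<rho> u p else 0) + (if u \<in> A then s * \<alpha> u else 0)" for u
  define cost where "cost u = (if u \<in> \<tau> then 0 else 1 :: real)" for u
  have l0: "0 \<le> l u" for u using s \<rho>(2) \<alpha>0 by (auto simp: l_def \<tau>_def)
  have fins: "finite \<tau>" "finite A" using S(1) by (auto simp: S_def)
  have 1: "(\<Sum>u\<in>S. l u *\<^sub>R u) = z"
  proof -
    have "(\<Sum>u\<in>S. (if u \<in> \<tau> then (1 - s) * dual \<rho> u p else 0) *\<^sub>R u) = (\<Sum>u\<in>\<tau>. ((1 - s) * dual \<rho> u p) *\<^sub>R u)"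
      using S(1) by (intro sum.mono_neutral_cong_right) (auto simp: S_def)
    moreover have "(\<Sum>u\<in>S. (if u \<in> A then s * \<alpha> u else 0) *\<^sub>R u) = (\<Sum>u\<in>A. (s * \<alpha> u) *\<^sub>R u)"
      using S(1) by (intro sum.mono_neutral_cong_right) (auto simp: S_def)
    moreover have "(\<Sum>u\<in>\<tau>. ((1 - s) * dual \<rho> u p) *\<^sub>R u) = (1 - s) *\<^sub>R p"
      using arg_cong[OF p_eq, of "\<lambda>y. (1 - s) *\<^sub>R y"] by (simp add: scaleR_sum_right)
    moreover have "(\<Sum>u\<in>A. (s * \<alpha> u) *\<^sub>R u) = s *\<^sub>R x"
      using arg_cong[OF x_eq, of "\<lambda>y. s *\<^sub>R y"] by (simp add: scaleR_sum_right)
    ultimately show ?thesis by (simp add: l_def scaleR_add_left sum.distrib z_def)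
  qed
  have 2: "(\<Sum>u\<in>S. cost u * l u) \<le> s * M"
  proof -
    have "(\<Sum>u\<in>S. cost u * l u) \<le> (\<Sum>u\<in>S. if u \<in> A then s * \<alpha> u else 0)"
      using s(1) \<alpha>0 by (intro sum_mono) (auto simp: cost_def l_def)
    also have "\<dots> = (\<Sum>u\<in>A. s * \<alpha> u)"
      using S(1) by (intro sum.mono_neutral_cong_right) (auto simp: S_def)
    finally show ?thesis by (simp add: M_def sum_distrib_left)
  qed
  have lin: "linear (\<lambda>y :: real ^ 'v. \<Sum>v\<in>I. y $ v)"
    by (rule linearI) (simp_all add: sum.distrib sum_distrib_left)
  have \<xi>: "0 < (\<Sum>v\<in>I. u $ v)" if "u \<in> S" for u using that S(2) \<Gamma>_pos by blast
  have "\<exists>T \<mu>. T \<subseteq> S \<and> independent T \<and> (\<forall>u\<in>T. 0 \<le> \<mu> u) \<and>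
      (\<Sum>u\<in>T. \<mu> u *\<^sub>R u) = (\<Sum>u\<in>S. l u *\<^sub>R u) \<and> (\<Sum>u\<in>T. cost u * \<mu> u) \<le> (\<Sum>u\<in>S. cost u * l u)"
    by (rule conic_caratheodory_cost[OF S(1) lin]) (use \<xi> l0 in auto)
  then obtain T \<mu> where T: "T \<subseteq> S" "independent T" "\<forall>u\<in>T. 0 \<le> \<mu> u"
    "(\<Sum>u\<in>T. \<mu> u *\<^sub>R u) = z" and "(\<Sum>u\<in>T. cost u * \<mu> u) \<le> (\<Sum>u\<in>S. cost u * l u)"
    unfolding 1 by (elim exE conjE)
  note T = T order_trans[OF this(5) 2]
  have finT: "finite T" using T(1) S(1) finite_subset by blast
  have zT: "z \<in> convex_cone hull T" using combination_in_cone[OF finT, of \<mu>] T(3,4) by simp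
  have Tb: "T \<in> bases_in I \<Gamma>" using C_avoids_small_cones[of T] T(1,2) S(2) zC zT by blast
  have CT: "C \<subseteq> convex_cone hull T"
    using C_cone_cases[OF Tb] zC zT by blast
  have "\<not> T \<subseteq> \<tau>"
  proof
    assume "T \<subseteq> \<tau>"
    then have "T \<subset> \<rho>" using \<rho>(3) by (auto simp: \<tau>_def)
    then have "card T < card \<rho>" using b(2) by (rule psubset_card_mono[rotated])
    moreover have "card T = card \<rho>"
      using dim_span_eq_card_independent[OF T(2)] dim_span_eq_card_independent[OF b(1)] b(4) basesD(4)[OF Tb]
      by simp
    ultimately show False by simp
  qed
  then obtain u where u: "u \<in> T" "u \<notin> \<tau>" by blast
  have "dual T u z = \<mu> u"
    using dual_combination[OF T(2) finT order_refl u(1), of \<mu>] T(4) u(1) by simp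
  moreover have "\<mu> u \<le> s * M"
  proof -
    have "cost u * \<mu> u \<le> (\<Sum>u\<in>T. cost u * \<mu> u)"
      using T(3) u(1) finT by (intro member_le_sum) (auto simp: cost_def)
    then show ?thesis using T(5) u(2) by (simp add: cost_def)
  qed
  moreover have "(1 - s) * \<delta> \<le> dual T u z"
  proof -
    have "dual T u p \<in> \<Delta>" unfolding \<Delta>_def using Tb CT u(1) by blast
    then have "(1 - s) * \<delta> \<le> (1 - s) * dual T u p" using \<delta>(2) s(2) by simp
    moreover have "0 \<le> s * dual T u x"
      using CT x u(1) s(1) simplicial_cone_iff[OF T(2) finT] by auto
    ultimately show ?thesis by (simp add: z_def dual_simps[OF T(2)])
  qed
  ultimately show False using s(3) by simp
qed

text \<open>
  If the segment from a point of \<open>C\<close> to a point of \<open>inside\<close> met a wall, then the first wall point on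
  it would contradict the previous lemma.
\<close>

lemma inside_eq_C:
  assumes nonneg: "\<And>x v. x \<in> C \<Longrightarrow> v \<in> I \<Longrightarrow> 0 \<le> x $ v"
  shows "inside = C"
proof
  show "C \<subseteq> inside" by (rule C_subset_inside)
  show "inside \<subseteq> C"
  proof
    fix y assume y: "y \<in> inside"
    obtain x where x: "x \<in> C" using C_nonempty by blast
    let ?f = "\<lambda>t. (1 - t) *\<^sub>R x + t *\<^sub>R y"
    have inside: "?f t \<in> inside" if "0 \<le> t" "t \<le> 1" for t
      using inside_combination[OF subsetD[OF C_subset_inside x] y, of "1 - t" t] that by simp
    let ?S = "{0..1} \<inter> ?f -` walls"
    have "?S = {}"
    proof (rule ccontr)
      assume ne: "?S \<noteq> {}"
      have "closed (?f -` walls)" using closed_walls by (intro closed_vimage) (auto intro!: continuous_intros)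
      then have "compact ?S" by (intro compact_Int_closed) auto
      then obtain t0 where t0: "t0 \<in> ?S" "\<And>t. t \<in> ?S \<Longrightarrow> t0 \<le> t" using compact_attains_inf[OF _ ne] by blast
      have before: "?f t \<in> C" if t: "0 \<le> t" "t < t0" for t
      proof (rule segment_in_C[OF x])
        fix r :: real assume r: "0 \<le> r" "r \<le> 1"
        have rt: "0 \<le> r * t" "r * t \<le> t" using r t by (auto simp: mult_left_le_one_le)
        have eq: "(1 - r) *\<^sub>R x + r *\<^sub>R ?f t = ?f (r * t)" by (simp add: algebra_simps)
        have "r * t \<notin> ?S" using t0(2)[of "r * t"] rt t by auto
        then have "?f (r * t) \<notin> walls" using rt t t0(1) by auto
        moreover have "?f (r * t) \<in> coord_space I"
          using inside[of "r * t"] rt t t0(1) by (auto simp: inside_def)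
        ultimately show "(1 - r) *\<^sub>R x + r *\<^sub>R ?f t \<in> coord_space I - walls" unfolding eq by blast
      qed
      have "t0 \<noteq> 0" using t0(1) x C_subset by auto
      then have t0_pos: "0 < t0" "t0 \<le> 1" using t0(1) by auto
      have "?f t0 \<notin> walls"
      proof (rule wall_point_not_inside[OF nonneg x])
        show "?f t0 \<in> inside" using inside t0_pos by simp
        fix s :: real assume s: "0 < s" "s \<le> 1"
        have "(1 - s) *\<^sub>R ?f t0 + s *\<^sub>R x = ?f ((1 - s) * t0)" by (simp add: algebra_simps)
        moreover have "?f ((1 - s) * t0) \<in> C" using s t0_pos by (intro before) (auto simp: field_simps)
        ultimately show "(1 - s) *\<^sub>R ?f t0 + s *\<^sub>R x \<in> C" by simp
      qed
      then show False using t0(1) by blast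
    qed
    then show "y \<in> C"
      using inside by (intro segment_in_C[OF x]) (force simp: inside_def)
  qed
qed

lemma C_add:
  assumes "\<And>x v. x \<in> C \<Longrightarrow> v \<in> I \<Longrightarrow> 0 \<le> x $ v" "x \<in> C" "y \<in> C"
  shows "x + y \<in> C"
  using inside_combination[of x y 1 1] inside_eq_C[OF assms(1)] assms(2,3) by simp

lemma orthant_cone: "x \<in> convex_cone hull ((\<lambda>v. axis v 1) ` I) \<longleftrightarrow> x \<in> coord_space I \<and> (\<forall>v\<in>I. 0 \<le> x $ v)"
proof
  assume x: "x \<in> convex_cone hull ((\<lambda>v. axis v 1) ` I)"
  have "convex_cone {x \<in> coord_space I. \<forall>v\<in>I. 0 \<le> x $ v}"
    unfolding convex_cone_iff by (auto simp: coord_space_def)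
  moreover have "(\<lambda>v. axis v 1) ` I \<subseteq> {x \<in> coord_space I. \<forall>v\<in>I. 0 \<le> x $ v}"
    by (auto simp: coord_space_def axis_def)
  ultimately show "x \<in> coord_space I \<and> (\<forall>v\<in>I. 0 \<le> x $ v)"
    using hull_minimal[of "(\<lambda>v. axis v 1) ` I" _ convex_cone] x by blast
next
  assume x: "x \<in> coord_space I \<and> (\<forall>v\<in>I. 0 \<le> x $ v)"
  have "(\<Sum>v\<in>J. x $ v *\<^sub>R axis v 1) \<in> convex_cone hull ((\<lambda>v. axis v 1) ` I)" if "finite J" "J \<subseteq> I" for J
    using that x
    by induction (auto intro!: convex_cone_hull_add convex_cone_hull_mul convex_cone_hull_contains_0 intro: hull_inc)
  from this[OF finite order_refl] show "x \<in> convex_cone hull ((\<lambda>v. axis v 1) ` I)"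
    by (rule back_subst[of "\<lambda>y. y \<in> convex_cone hull ((\<lambda>v. axis v 1) ` I)",
          OF _ axes_expand[OF conjunct1[OF x], symmetric]])
qed

lemma axes_basis: "(\<lambda>v. axis v 1) ` I \<in> bases_in I \<Gamma>"
proof -
  have "independent ((\<lambda>v. axis v 1 :: real ^ 'v) ` I)"
    by (rule independent_mono[OF independent_Basis]) (auto simp: Basis_vec_def)
  moreover have "span ((\<lambda>v. axis v 1) ` I) = coord_space I"
  proof
    show "span ((\<lambda>v. axis v 1) ` I) \<subseteq> coord_space I"
      using subspace_V by (intro span_minimal) (auto simp: coord_space_def axis_def)
    show "coord_space I \<subseteq> span ((\<lambda>v. axis v 1) ` I)"
    proof
      fix x assume x: "x \<in> coord_space I"
      have "(\<Sum>v\<in>I. x $ v *\<^sub>R axis v 1) \<in> span ((\<lambda>v. axis v 1) ` I)"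
        by (intro span_sum span_scale span_base) auto
      then show "x \<in> span ((\<lambda>v. axis v 1) ` I)"
        by (rule back_subst[of "\<lambda>y. y \<in> span ((\<lambda>v. axis v 1) ` I)", OF _ axes_expand[OF x, symmetric]])
    qed
  qed
  ultimately show ?thesis using axes by (auto simp: bases_in_def)
qed

text \<open>
  The positive orthant is itself one of the simplicial cones.
\<close>

lemma orthant_cases:
  "(\<forall>x\<in>C. \<forall>v\<in>I. 0 \<le> x $ v) \<or> (\<forall>x\<in>C. \<exists>v\<in>I. x $ v < 0)"
proof -
  let ?A = "(\<lambda>v. axis v (1::real)) ` I"
  consider "C \<subseteq> convex_cone hull ?A" | "C \<inter> convex_cone hull ?A = {}"
    using C_cone_cases[OF axes_basis] by blast
  then show ?thesis
  proof cases
    case 1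
    then show ?thesis using orthant_cone by blast
  next
    case 2
    have "\<exists>v\<in>I. x $ v < 0" if x: "x \<in> C" for x
    proof -
      have "x \<notin> convex_cone hull ?A" using 2 x by blast
      then show ?thesis unfolding orthant_cone using C_V[OF x] by (simp add: not_le)
    qed
    then show ?thesis by blast
  qed
qed

text \<open>
  All walls lie in the orthant, and a segment to the negative point stays off the orthant because
  the coordinate that is negative at its start remains negative.
\<close>

lemma outer_chamber_point:
  assumes outer: "\<forall>x\<in>C. \<exists>v\<in>I. x $ v < 0" and "0 < r"
  shows "(\<chi> v. if v \<in> I then - r else 0) \<in> C"
proof -
  obtain x where x: "x \<in> C" using C_nonempty by blast
  then obtain v where v: "v \<in> I" "x $ v < 0" using outer by blast
  let ?y = "(\<chi> v. if v \<in> I then - r else 0) :: real ^ 'v"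
  show ?thesis
  proof (rule segment_in_C[OF x])
    fix t :: real assume t: "0 \<le> t" "t \<le> 1"
    let ?z = "(1 - t) *\<^sub>R x + t *\<^sub>R ?y"
    have zV: "?z \<in> coord_space I"
      using C_V[OF x] by (auto simp: coord_space_def)
    have "(1 - t) * x $ v \<le> 0" "t * r \<ge> 0" using t v(2) assms(2) by (auto simp: mult_nonneg_nonpos)
    moreover have "(1 - t) * x $ v < 0 \<or> 0 < t * r"
      using t v(2) assms(2) by (cases "t = 1") (auto simp: mult_pos_neg)
    ultimately have neg: "?z $ v < 0" using v(1) by auto
    have "?z \<notin> walls"
    proof
      assume "?z \<in> walls"
      then obtain \<sigma> where \<sigma>: "\<sigma> \<in> bases_in I \<Gamma>" "\<forall>u\<in>\<sigma>. 0 \<le> dual \<sigma> u ?z" unfolding walls_iff by blast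
      note b = basesD[OF \<sigma>(1)]
      have "?z \<in> convex_cone hull \<sigma>" using \<sigma>(2) zV simplicial_cone_iff[OF b(1,2)] b(4) by simp
      also have "\<dots> \<subseteq> {x. 0 \<le> x $ v}"
      proof (rule hull_minimal)
        show "\<sigma> \<subseteq> {x. 0 \<le> x $ v}" using b(3) \<Gamma>_nonneg v(1) by blast
        show "convex_cone {x :: real ^ 'v. 0 \<le> x $ v}" unfolding convex_cone_iff by auto
      qed
      finally show False using neg by simp
    qed
    then show "?z \<in> coord_space I - walls" using zV by blast
  qed
qed

end

section \<open>Expansions and the counting function\<close>

lemma foldr_diff_op_commute: "foldr diff_op gs (diff_op g f) = diff_op g (foldr diff_op gs f)"
  by (induction gs) (simp_all add: diff_op_comm)

lemma foldr_diff_op_shift: "foldr diff_op gs (\<lambda>x. f (x - b)) = (\<lambda>x. foldr diff_op gs f (x - b))"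
  by (induction gs) (simp_all add: diff_op_shift)

lemma foldr_diff_op_linear:
  fixes f h :: "'a::ab_group_add \<Rightarrow> 'b::comm_ring"
  shows "foldr diff_op gs (\<lambda>x. f x + h x) = (\<lambda>x. foldr diff_op gs f x + foldr diff_op gs h x)"
    and "foldr diff_op gs (\<lambda>x. c * f x) = (\<lambda>x. c * foldr diff_op gs f x)"
    and "foldr diff_op gs (\<lambda>x. 0) = (\<lambda>x. 0 :: 'b)"
proof -
  show "foldr diff_op gs (\<lambda>x. f x + h x) = (\<lambda>x. foldr diff_op gs f x + foldr diff_op gs h x)"
    by (induction gs) (simp_all add: diff_op_def[abs_def] algebra_simps)
  show "foldr diff_op gs (\<lambda>x. c * f x) = (\<lambda>x. c * foldr diff_op gs f x)"
    by (induction gs) (simp_all add: diff_op_def[abs_def] algebra_simps)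
  show "foldr diff_op gs (\<lambda>x. 0) = (\<lambda>x. 0 :: 'b)"
    by (induction gs) (simp_all add: diff_op_def[abs_def])
qed

lemma foldr_diff_op_sum:
  fixes f :: "'i \<Rightarrow> 'a::ab_group_add \<Rightarrow> 'b::comm_ring"
  shows "foldr diff_op gs (\<lambda>x. \<Sum>i\<in>A. f i x) = (\<lambda>x. \<Sum>i\<in>A. foldr diff_op gs (f i) x)"
  by (induction A rule: infinite_finite_induct) (simp_all add: foldr_diff_op_linear)

lemma foldr_diff_op_of_int:
  "foldr diff_op gs (\<lambda>x. of_int (f x) :: real) = (\<lambda>x. of_int (foldr diff_op gs f x))"
  by (induction gs) (simp_all add: diff_op_def[abs_def])

text \<open>
  Here \<open>1 - t\<^sup>-\<^sup>g = - t\<^sup>-\<^sup>g (1 - t\<^sup>g)\<close> is used for each \<open>g\<close>.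
\<close>

lemma foldr_diff_op_reflect:
  fixes f :: "'a::ab_group_add \<Rightarrow> int"
  shows "foldr diff_op gs (\<lambda>x. f (- x)) =
    (\<lambda>x. (-1) ^ length gs * foldr diff_op gs f (- x + sum_list gs))"
proof (induction gs)
  case (Cons g gs)
  define F where "F = foldr diff_op gs f"
  have "diff_op g (\<lambda>x. (-1) ^ length gs * F (- x + sum_list gs)) =
      (\<lambda>x. (-1) ^ Suc (length gs) * diff_op g F (- x + (g + sum_list gs)))"
    by (simp add: diff_op_def fun_eq_iff algebra_simps)
  then show ?case by (simp add: Cons.IH F_def)
qed simp

lemma series_mult_superset:
  assumes "finite S" "Poly_Mapping.keys Q \<subseteq> S"
  shows "series_mult Q f l = (\<Sum>u\<in>S. Poly_Mapping.lookup Q u * f (l - u))"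
  unfolding series_mult_def using assms
  by (intro sum.mono_neutral_left) (auto simp: in_keys_iff)

lemma series_mult_add: "series_mult (P + Q) f l = series_mult P f l + series_mult Q f l"
proof -
  let ?S = "Poly_Mapping.keys P \<union> Poly_Mapping.keys Q"
  have "Poly_Mapping.keys (P + Q) \<subseteq> ?S" by (rule Poly_Mapping.keys_add)
  then show ?thesis
    by (simp add: series_mult_superset[of ?S] lookup_add distrib_right sum.distrib)
qed

lemma series_mult_sum: "series_mult (\<Sum>i\<in>A. Q i) f l = (\<Sum>i\<in>A. series_mult (Q i) f l)"
  by (induction A rule: infinite_finite_induct) (simp_all add: series_mult_add, simp_all add: series_mult_def)

lemma series_mult_single: "series_mult (Poly_Mapping.single u c) f l = c * f (l - u)"
  using series_mult_superset[of "{u}" "Poly_Mapping.single u c" f l] by simp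

lemma poly_mapping_as_sum:
  "Q = (\<Sum>u\<in>Poly_Mapping.keys Q. Poly_Mapping.single u (Poly_Mapping.lookup Q u :: int))"
proof (rule poly_mapping_eqI)
  fix i
  have "(\<Sum>u\<in>Poly_Mapping.keys Q. Poly_Mapping.lookup Q u when u = i)
      = (\<Sum>u\<in>Poly_Mapping.keys Q. if u = i then Poly_Mapping.lookup Q i else 0)"
    by (intro sum.cong) (auto simp: when_def)
  then show "Poly_Mapping.lookup Q i = Poly_Mapping.lookup (\<Sum>u\<in>Poly_Mapping.keys Q. Poly_Mapping.single u (Poly_Mapping.lookup Q u)) i"
    by (simp add: lookup_sum lookup_single in_keys_iff)
qed

lemma series_mult_monomial:
  "series_mult (Poly_Mapping.single g c * Q) f l = c * series_mult Q f (l - g)"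
proof -
  have "Poly_Mapping.single g c * Q
      = (\<Sum>u\<in>Poly_Mapping.keys Q. Poly_Mapping.single (g + u) (c * Poly_Mapping.lookup Q u))"
    by (subst poly_mapping_as_sum[of Q]) (simp only: sum_distrib_left mult_single)
  then have "series_mult (Poly_Mapping.single g c * Q) f l
      = (\<Sum>u\<in>Poly_Mapping.keys Q. c * Poly_Mapping.lookup Q u * f (l - (g + u)))"
    by (simp only: series_mult_sum series_mult_single)
  then show ?thesis
    by (simp add: series_mult_def sum_distrib_left diff_diff_eq mult.assoc)
qed

lemma series_mult_binomial:
  "series_mult (Q * (1 - Poly_Mapping.single g 1)) f = diff_op g (series_mult Q f)"
proof
  fix l
  have "Q * (1 - Poly_Mapping.single g 1) = Q + Poly_Mapping.single g (-1) * Q"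
    by (simp add: algebra_simps single_uminus)
  then show "series_mult (Q * (1 - Poly_Mapping.single g 1)) f l = diff_op g (series_mult Q f) l"
    by (simp add: series_mult_add series_mult_monomial diff_op_def)
qed

lemma series_mult_denominator:
  "series_mult (denominator n a) f = foldr diff_op (map a [1..<Suc n]) f"
proof (induction n)
  case 0
  have "series_mult 1 f l = f l" for l
    using series_mult_single[of 0 1 f l] by simp
  then show ?case by (simp add: denominator_def fun_eq_iff)
next
  case (Suc n)
  have "denominator (Suc n) a = denominator n a * (1 - Poly_Mapping.single (a (Suc n)) 1)"
    by (simp add: denominator_def)
  then show ?case
    by (simp only: series_mult_binomial Suc) (simp add: foldr_diff_op_commute)
qed

lemma series_mult_map_key_uminus:
  "series_mult (Poly_Mapping.map_key uminus Q) f l = series_mult Q (\<lambda>x. f (- x)) (- l)"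
proof -
  have inj: "inj (uminus :: 'a \<Rightarrow> 'a)" by (simp add: inj_def)
  have keys: "Poly_Mapping.keys (Poly_Mapping.map_key uminus Q) = uminus ` Poly_Mapping.keys Q"
    unfolding keys_map_key[OF inj] by (auto simp: image_iff) (metis minus_minus)
  have look: "Poly_Mapping.lookup (Poly_Mapping.map_key uminus Q) u = Poly_Mapping.lookup Q (- u)" for u
    by (simp add: map_key.rep_eq[OF inj])
  have "inj_on uminus (Poly_Mapping.keys Q)" by (simp add: inj_on_def)
  then show ?thesis
    unfolding series_mult_def keys by (simp add: sum.reindex look add.commute)
qed

lemma lookup_map_key_uminus:
  "Poly_Mapping.lookup (Poly_Mapping.map_key uminus Q) (u :: 'a::ab_group_add) = Poly_Mapping.lookup Q (- u)"
  using map_key.rep_eq[of uminus Q] by (simp add: inj_def)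

lemma lookup_numerator:
  "Poly_Mapping.lookup (numerator r \<iota> b) x = (\<Sum>k = 1..r. \<iota> k * (if x = b k then 1 else 0))"
  by (auto simp: numerator_def lookup_sum lookup_single when_def intro!: sum.cong)

text \<open>
  Fixing \<open>I\<close> makes \<open>L'\<close> a graded group: series are reduced to the variables in \<open>I\<close> by taking
  exponents modulo the lattice spanned by the \<open>E\<^sub>v\<close> with \<open>v \<notin> I\<close>, the \<open>kernel\<close> below. The classes
  modulo \<open>L\<close> remain visible in the quotient.
\<close>

locale reduced_lattice = lattice_pair +
  fixes I :: "'b set"
  assumes I_nonempty: "I \<noteq> {}"
begin

definition kernel :: "'a set" where
  "kernel = {x \<in> L. \<forall>v\<in>I. coord x v = 0}"

lemma kernel_L': "x \<in> kernel \<Longrightarrow> x \<in> L'" using L_subset by (auto simp: kernel_def)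

sublocale graded_group scale L' kernel "restr I" "\<lambda>y. \<Sum>v\<in>I. y $ v"
proof (intro graded_group.intro graded_group_axioms.intro)
  show "module scale" by unfold_locales
  show "subspace L'" by (rule subspace_L')
  show "subspace kernel"
    using L_subset unfolding kernel_def subspace_def
    by (auto simp: coord_zero coord_add coord_scale subset_iff intro: subspace_0[OF subspace_L]
        subspace_add[OF subspace_L] subspace_scale[OF subspace_L])
  show "kernel \<subseteq> L'" using kernel_L' by blast
  show "restr I (x + y) = restr I x + restr I y" if "x \<in> L'" "y \<in> L'" for x y
    using that by (rule restr_add)
  show "restr I x = 0" if "x \<in> kernel" for x
    using that by (auto simp: kernel_def vec_eq_iff restr_nth)
  show "linear (\<lambda>y :: real ^ 'b. \<Sum>v\<in>I. y $ v)"
    by (rule linearI) (simp_all add: sum.distrib sum_distrib_left)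
qed

definition positive :: "'a \<Rightarrow> bool" where
  "positive g \<longleftrightarrow> g \<in> L' \<and> (\<forall>v. 0 < coord g v)"

lemma positive_pos: "positive g \<Longrightarrow> pos g"
  unfolding positive_def pos_def using I_nonempty by (auto simp: restr_nth intro!: sum_pos)

text \<open>
  A support condition that the expansions satisfy and that makes all sums in the modified counting
  function finite, for which boundedness from below is not enough.
\<close>

definition narrow :: "('a \<Rightarrow> int) \<Rightarrow> bool" where
  "narrow f \<longleftrightarrow> (\<forall>l. f l \<noteq> 0 \<longrightarrow> l \<in> L') \<and> (\<forall>v m. finite {l. f l \<noteq> 0 \<and> coord l v \<le> m})"

lemma narrow_finite_support:
  assumes "finite {l. f l \<noteq> 0}" "\<And>l. f l \<noteq> 0 \<Longrightarrow> l \<in> L'"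
  shows "narrow f"
  unfolding narrow_def using assms by (auto intro: finite_subset[OF _ assms(1)])

lemma narrow_bound:
  assumes "narrow f" shows "\<exists>m. \<forall>l v. f l \<noteq> 0 \<longrightarrow> m \<le> coord l v"
proof -
  have "\<exists>m. \<forall>l. f l \<noteq> 0 \<longrightarrow> m \<le> coord l v" for v
  proof -
    let ?S = "{l. f l \<noteq> 0 \<and> coord l v \<le> 0}"
    have fin: "finite ?S" using assms by (simp add: narrow_def)
    let ?m = "Min (insert 0 ((\<lambda>l. coord l v) ` ?S))"
    have "?m \<le> coord l v" if "f l \<noteq> 0" for l
    proof (cases "coord l v \<le> 0")
      case True
      then show ?thesis using that fin by (intro Min_le) auto
    next
      case False
      have "?m \<le> 0" using fin by (intro Min_le) auto
      then show ?thesis using False by linarith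
    qed
    then show ?thesis by blast
  qed
  then obtain m where m: "\<And>v l. f l \<noteq> 0 \<Longrightarrow> m v \<le> coord l v" by metis
  have "Min (range m) \<le> coord l v" if "f l \<noteq> 0" for l v
    by (rule order_trans[OF Min_le m[OF that, of v]]) simp_all
  then show ?thesis by blast
qed

lemma bounded_supp_of_coords:
  assumes "\<And>l. f l \<noteq> 0 \<Longrightarrow> l \<in> L'" "\<And>l v. f l \<noteq> 0 \<Longrightarrow> m \<le> coord l v"
  shows "bounded_supp f"
  unfolding bounded_supp_def
proof (intro exI[of _ "\<Sum>v\<in>I. of_rat m"] allI impI conjI)
  fix x assume x: "f x \<noteq> 0"
  show "x \<in> L'" using assms(1)[OF x] .
  show "(\<Sum>v\<in>I. of_rat m) \<le> (\<Sum>v\<in>I. restr I x $ v)"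
    using assms(2)[OF x] by (intro sum_mono) (simp add: restr_nth of_rat_less_eq)
qed

lemma narrow_bounded_supp: "narrow f \<Longrightarrow> bounded_supp f"
  using narrow_bound[of f] bounded_supp_of_coords[of f] unfolding narrow_def by blast

lemma narrow_cumul:
  assumes f: "narrow f" and g: "positive g"
  shows "narrow (cumul g f)"
proof -
  have gL: "g \<in> L'" using g by (simp add: positive_def)
  have sup: "\<exists>j l'. f l' \<noteq> 0 \<and> l = l' + scale (int j) g" if nz: "cumul g f l \<noteq> 0" for l
  proof -
    obtain j where "f (l - scale (int j) g) \<noteq> 0" using cumul_nonzero[OF nz] .
    then show ?thesis by (intro exI[of _ j] exI[of _ "l - scale (int j) g"]) simp
  qed
  have 1: "l \<in> L'" if "cumul g f l \<noteq> 0" for l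
    using sup[OF that] f gL by (auto simp: narrow_def intro: G_add G_scale)
  have 2: "finite {l. cumul g f l \<noteq> 0 \<and> coord l v \<le> m}" for v m
  proof -
    have gv: "0 < coord g v" using g by (simp add: positive_def)
    let ?S = "{l. f l \<noteq> 0 \<and> coord l v \<le> m}"
    have fin: "finite ?S" using f by (simp add: narrow_def)
    define M where "M l = nat \<lfloor>(m - coord l v) / coord g v\<rfloor>" for l
    have "{l. cumul g f l \<noteq> 0 \<and> coord l v \<le> m} \<subseteq> (\<Union>l'\<in>?S. (\<lambda>j. l' + scale (int j) g) ` {..M l'})"
    proof
      fix l assume l: "l \<in> {l. cumul g f l \<noteq> 0 \<and> coord l v \<le> m}"
      then obtain j l' where j: "f l' \<noteq> 0" "l = l' + scale (int j) g" using sup by blast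
      have "l' \<in> L'" using f j(1) by (simp add: narrow_def)
      then have c: "coord l' v + of_nat j * coord g v \<le> m"
        using l gL by (simp add: j(2) coord_add coord_scale G_scale)
      have "0 \<le> of_nat j * coord g v" using gv by simp
      then have "coord l' v \<le> m" using c by linarith
      moreover have "of_nat j \<le> (m - coord l' v) / coord g v" using c gv by (simp add: le_divide_eq)
      then have "j \<le> M l'" unfolding M_def by (simp add: le_nat_floor le_floor_iff nat_le_iff le_nat_iff)
      ultimately show "l \<in> (\<Union>l'\<in>?S. (\<lambda>j. l' + scale (int j) g) ` {..M l'})" using j by auto
    qed
    then show ?thesis by (rule finite_subset) (use fin in auto)
  qed
  show ?thesis unfolding narrow_def using 1 2 by blast
qed

lemma narrow_solution:
  assumes "narrow p" "list_all positive gs"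
  shows "narrow (foldr cumul gs p)" "foldr diff_op gs (foldr cumul gs p) = p"
  using assms(2)
proof (induction gs)
  case (Cons g gs)
  { case 1 then show ?case using Cons narrow_cumul by simp }
  { case 2
    then have "diff_op g (cumul g (foldr cumul gs p)) = foldr cumul gs p"
      using Cons narrow_bounded_supp positive_pos by (intro diff_op_cumul) auto
    then have "foldr diff_op gs (diff_op g (cumul g (foldr cumul gs p))) = p" using Cons 2 by simp
    then show ?case by (simp add: foldr_diff_op_commute) }
qed (use assms(1) in simp_all)

lemma foldr_diff_op_unique:
  assumes "bounded_supp f" "bounded_supp f'" "list_all pos gs" "foldr diff_op gs f = foldr diff_op gs f'"
  shows "f = f'"
  using assms
proof (induction gs arbitrary: f f')
  case (Cons g gs)
  have g: "pos g" "g \<in> L'" using Cons.prems(3) by (auto simp: pos_def)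
  have "diff_op g f = diff_op g f'"
  proof (rule Cons.IH)
    show "foldr diff_op gs (diff_op g f) = foldr diff_op gs (diff_op g f')"
      using Cons.prems(4) by (simp add: foldr_diff_op_commute)
  qed (use Cons.prems g in \<open>simp_all add: bounded_supp_diff_op\<close>)
  then show ?case using diff_op_unique[OF Cons.prems(1,2) g(1)] by blast
qed simp

text \<open>
  Both expansions are determined by a system of difference equations for positive exponents. Its
  bounded solution is unique, and the solution obtained by repeated division is narrow.
\<close>

lemma expansion_eqI:
  assumes gs: "list_all positive gs" and p: "narrow p"
    and iff: "\<And>f. series_mult Q f = Poly_Mapping.lookup P \<longleftrightarrow> foldr diff_op gs f = p"
  shows "narrow (expansion P Q)" "foldr diff_op gs (expansion P Q) = p"
proof -
  have gs': "list_all pos gs" using gs positive_pos by (auto simp: list_all_iff)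
  let ?f = "foldr cumul gs p"
  note f = narrow_solution[OF p gs]
  have "expansion P Q = ?f"
    unfolding expansion_def iff
  proof (rule the_equality)
    show "(\<forall>l. ?f l \<noteq> 0 \<longrightarrow> l \<in> L') \<and> (\<exists>m. \<forall>l v. ?f l \<noteq> 0 \<longrightarrow> m \<le> coord l v) \<and> foldr diff_op gs ?f = p"
      using f narrow_bound[OF f(1)] by (simp only: narrow_def) simp
  next
    fix f' assume f': "(\<forall>l. f' l \<noteq> 0 \<longrightarrow> l \<in> L') \<and> (\<exists>m. \<forall>l v. f' l \<noteq> 0 \<longrightarrow> m \<le> coord l v) \<and>
        foldr diff_op gs f' = p"
    then have "bounded_supp f'" using bounded_supp_of_coords by blast
    moreover have "foldr diff_op gs f' = foldr diff_op gs ?f" using f' f(2) by (simp only:)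
    ultimately show "f' = ?f" using foldr_diff_op_unique narrow_bounded_supp[OF f(1)] gs' by blast
  qed
  then show "narrow (expansion P Q)" "foldr diff_op gs (expansion P Q) = p" using f by simp_all
qed

lemma expansion_denominator:
  assumes a: "\<And>i. i \<in> {1..n} \<Longrightarrow> positive (a i)" and P: "\<And>u. Poly_Mapping.lookup P u \<noteq> 0 \<Longrightarrow> u \<in> L'"
  shows "narrow (expansion P (denominator n a))"
    and "foldr diff_op (map a [1..<Suc n]) (expansion P (denominator n a)) = Poly_Mapping.lookup P"
proof -
  have gs: "list_all positive (map a [1..<Suc n])" using a by (auto simp: list_all_iff)
  have "narrow (Poly_Mapping.lookup P)" using P by (intro narrow_finite_support) auto
  note expansion_eqI[OF gs this, of "denominator n a" P]
  then show "narrow (expansion P (denominator n a))"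
    "foldr diff_op (map a [1..<Suc n]) (expansion P (denominator n a)) = Poly_Mapping.lookup P"
    by (simp_all only: series_mult_denominator)
qed

lemma narrow_shift:
  assumes "narrow f" "b \<in> L'" shows "narrow (\<lambda>x. f (x - b))"
proof -
  have 1: "x \<in> L'" if "f (x - b) \<noteq> 0" for x
    using G_add[of "x - b" b] assms that by (simp add: narrow_def)
  have 2: "finite {x. f (x - b) \<noteq> 0 \<and> coord x v \<le> m}" for v m
  proof -
    have "{x. f (x - b) \<noteq> 0 \<and> coord x v \<le> m} \<subseteq> (\<lambda>l. l + b) ` {l. f l \<noteq> 0 \<and> coord l v \<le> m - coord b v}"
    proof
      fix x assume x: "x \<in> {x. f (x - b) \<noteq> 0 \<and> coord x v \<le> m}"
      then have "x - b \<in> {l. f l \<noteq> 0 \<and> coord l v \<le> m - coord b v}"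
        using 1[of x] assms(2) by (simp add: coord_diff)
      then show "x \<in> (\<lambda>l. l + b) ` {l. f l \<noteq> 0 \<and> coord l v \<le> m - coord b v}" by force
    qed
    then show ?thesis by (rule finite_subset) (use assms(1) in \<open>simp add: narrow_def\<close>)
  qed
  show ?thesis unfolding narrow_def using 1 2 by blast
qed

text \<open>
  Passing to the inverse variables replaces the denominator by \<open>\<Prod> (1 - t\<^sup>-\<^sup>a)\<close>, which is
  \<open>(-1)\<^sup>n t\<^sup>-\<^sup>s \<Prod> (1 - t\<^sup>a)\<close> with \<open>s\<close> the sum of the \<open>a\<^sub>i\<close>. So this is again an expansion for positive
  exponents, with a modified numerator.
\<close>

lemma expansion_infinity_denominator:
  assumes a: "\<And>i. i \<in> {1..n} \<Longrightarrow> positive (a i)" and P: "\<And>u. Poly_Mapping.lookup P u \<noteq> 0 \<Longrightarrow> u \<in> L'"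
  obtains f where "narrow f" "\<And>l. expansion_infinity P (denominator n a) l = f (- l)"
    "foldr diff_op (map a [1..<Suc n]) f =
      (\<lambda>x. (-1) ^ n * Poly_Mapping.lookup P (sum_list (map a [1..<Suc n]) - x))"
proof -
  define gs where "gs = map a [1..<Suc n]"
  have len: "length gs = n" by (simp add: gs_def)
  note SM = series_mult_denominator[of n a, folded gs_def]
  let ?p = "Poly_Mapping.lookup P"
  let ?P = "Poly_Mapping.map_key uminus P" and ?Q = "Poly_Mapping.map_key uminus (denominator n a)"
  let ?s = "sum_list gs"
  have gs: "list_all positive gs" using a by (auto simp: gs_def list_all_iff)
  have sL: "?s \<in> L'" using gs by (intro G_sum_list) (auto simp: list_all_iff positive_def)
  have eqn: "series_mult ?Q f = Poly_Mapping.lookup ?P \<longleftrightarrow>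
      foldr diff_op gs f = (\<lambda>x. (-1) ^ n * ?p (?s - x))" (is "?A \<longleftrightarrow> ?B") for f
  proof -
    have sm: "series_mult ?Q f l = (-1) ^ n * foldr diff_op gs f (l + ?s)" for l
      by (simp add: series_mult_map_key_uminus SM foldr_diff_op_reflect len add.commute)
    have sq: "(-1) ^ n * ((-1) ^ n * z) = (z :: int)" for z
      by (simp add: mult.assoc[symmetric] power_mult_distrib[symmetric])
    show ?thesis
    proof
      assume A: ?A
      have "foldr diff_op gs f x = (-1) ^ n * ?p (?s - x)" for x
        using fun_cong[OF A, of "x - ?s"] sq[of "foldr diff_op gs f x"]
        by (simp add: sm lookup_map_key_uminus)
      then show ?B by blast
    next
      assume B: ?B
      show ?A by (rule ext) (simp add: sm B sq lookup_map_key_uminus)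
    qed
  qed
  let ?p' = "\<lambda>x. (-1) ^ n * ?p (?s - x)"
  have "narrow ?p'"
  proof (rule narrow_finite_support)
    have "{l. ?p' l \<noteq> 0} \<subseteq> (\<lambda>u. ?s - u) ` {u. ?p u \<noteq> 0}"
    proof
      fix l assume "l \<in> {l. ?p' l \<noteq> 0}"
      then have "l = ?s - (?s - l)" "?s - l \<in> {u. ?p u \<noteq> 0}" by auto
      then show "l \<in> (\<lambda>u. ?s - u) ` {u. ?p u \<noteq> 0}" by blast
    qed
    then show "finite {l. ?p' l \<noteq> 0}" by (rule finite_subset) simp
    show "l \<in> L'" if "?p' l \<noteq> 0" for l
    proof -
      have "?s - l \<in> L'" using P that by simp
      from G_diff[OF sL this] show ?thesis by simp
    qed
  qed
  note f = expansion_eqI[OF gs this eqn]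
  show ?thesis
    by (rule that[OF f(1) _ f(2)[unfolded gs_def]]) (simp add: expansion_infinity_def)
qed

text \<open>
  The modified counting function, for the class of its argument instead of a fixed class. In this form
  it commutes with shifts.
\<close>

definition counting :: "('a \<Rightarrow> int) \<Rightarrow> 'a \<Rightarrow> int" where
  "counting f x = (if x \<in> L' then mod_counting f (cls x) I x else 0)"

abbreviation counted :: "('a \<Rightarrow> int) \<Rightarrow> 'a \<Rightarrow> 'a set" where
  "counted f x \<equiv> {l \<in> L'. cls l = cls x \<and> (\<forall>v\<in>I. coord l v < coord x v) \<and> f l \<noteq> 0}"

lemma finite_counted: "narrow f \<Longrightarrow> finite (counted f x)"
proof -
  assume f: "narrow f"
  obtain v where v: "v \<in> I" using I_nonempty by blast
  have "counted f x \<subseteq> {l. f l \<noteq> 0 \<and> coord l v \<le> coord x v}" using v by (auto intro: less_imp_le)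
  then show ?thesis by (rule finite_subset) (use f in \<open>simp add: narrow_def\<close>)
qed

lemma counting_diff:
  assumes "narrow f" "narrow h"
  shows "counting (\<lambda>x. f x - h x) x = counting f x - counting h x"
proof -
  let ?k = "\<lambda>x. f x - h x"
  let ?S = "counted f x \<union> counted h x"
  have fin: "finite ?S" using finite_counted[OF assms(1)] finite_counted[OF assms(2)] by (rule finite_UnI)
  have "sum ?k (counted ?k x) = sum ?k ?S" using fin by (intro sum.mono_neutral_left) auto
  moreover have "sum f (counted f x) = sum f ?S" using fin by (intro sum.mono_neutral_left) auto
  moreover have "sum h (counted h x) = sum h ?S" using fin by (intro sum.mono_neutral_left) auto
  ultimately show ?thesis by (simp add: counting_def mod_counting_def sum_subtractf)
qed

lemma counting_shift:
  assumes "b \<in> L'"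
  shows "counting (\<lambda>x. f (x - b)) x = counting f (x - b)"
proof (cases "x \<in> L'")
  case False
  then have "x - b \<notin> L'" using G_add[of "x - b" b] assms by auto
  then show ?thesis using False by (simp add: counting_def)
next
  case True
  have xb: "x - b \<in> L'" using True assms by (rule G_diff)
  have "(\<Sum>l\<in>counted (\<lambda>x. f (x - b)) x. f (l - b)) = sum f (counted f (x - b))"
  proof (rule sum.reindex_bij_witness[of _ "\<lambda>l. l + b" "\<lambda>l. l - b"])
    fix l assume l: "l \<in> counted (\<lambda>x. f (x - b)) x"
    then show "l - b \<in> counted f (x - b)"
      using True assms by (auto simp: cls_eq_iff coord_diff G_diff)
  next
    fix l assume l: "l \<in> counted f (x - b)"
    then have "l - (x - b) \<in> L" "\<forall>v\<in>I. coord l v < coord x v - coord b v"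
      using True assms by (auto simp: cls_eq_iff coord_diff)
    then show "l + b \<in> counted (\<lambda>x. f (x - b)) x"
      using l assms by (auto simp: cls_eq_iff coord_add G_add algebra_simps)
  qed simp_all
  then show ?thesis using True xb by (simp add: counting_def mod_counting_def)
qed

lemma counting_diff_op:
  assumes "narrow f" "g \<in> L'"
  shows "counting (diff_op g f) = diff_op g (counting f)"
proof
  fix x
  show "counting (diff_op g f) x = diff_op g (counting f) x"
    using counting_diff[OF assms(1) narrow_shift[OF assms], of x] counting_shift[OF assms(2), of f x]
    by (simp add: diff_op_def[abs_def])
qed

lemma narrow_diff_op:
  assumes "narrow f" "g \<in> L'" shows "narrow (diff_op g f)"
proof -
  note h = narrow_shift[OF assms]
  have "finite {l. diff_op g f l \<noteq> 0 \<and> coord l v \<le> m}" for v m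
  proof -
    have "{l. diff_op g f l \<noteq> 0 \<and> coord l v \<le> m} \<subseteq>
        {l. f l \<noteq> 0 \<and> coord l v \<le> m} \<union> {l. f (l - g) \<noteq> 0 \<and> coord l v \<le> m}"
      by (auto simp: diff_op_def)
    then show ?thesis
      using assms(1) h unfolding narrow_def by (meson finite_UnI finite_subset)
  qed
  moreover have "l \<in> L'" if "diff_op g f l \<noteq> 0" for l
  proof -
    have "f l \<noteq> 0 \<or> f (l - g) \<noteq> 0" using that by (auto simp: diff_op_def)
    then show ?thesis using assms(1) h unfolding narrow_def by blast
  qed
  ultimately show ?thesis by (simp add: narrow_def)
qed

lemma counting_foldr_diff_op:
  assumes "narrow f" "set gs \<subseteq> L'"
  shows "narrow (foldr diff_op gs f) \<and> counting (foldr diff_op gs f) = foldr diff_op gs (counting f)"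
  using assms(2)
proof (induction gs)
  case (Cons g gs)
  then show ?case using narrow_diff_op counting_diff_op by simp
qed (simp add: assms(1))

lemma bounded_supp_counting:
  assumes "narrow f" shows "bounded_supp (counting f)"
proof -
  obtain m where m: "\<And>l v. f l \<noteq> 0 \<Longrightarrow> m \<le> coord l v" using narrow_bound[OF assms] by blast
  show ?thesis
    unfolding bounded_supp_def
  proof (intro exI[of _ "\<Sum>v\<in>I. of_rat m"] allI impI conjI)
    fix x assume x: "counting f x \<noteq> 0"
    then show "x \<in> L'" by (auto simp: counting_def split: if_splits)
    have "sum f (counted f x) \<noteq> 0" using x by (auto simp: counting_def mod_counting_def split: if_splits)
    then obtain l where "l \<in> counted f x" "f l \<noteq> 0" by (rule sum.not_neutral_contains_not_neutral)
    then have "m \<le> coord x v" if "v \<in> I" for v using m[of l v] that by fastforce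
    then show "(\<Sum>v\<in>I. of_rat m) \<le> (\<Sum>v\<in>I. restr I x $ v)"
      by (intro sum_mono) (simp add: restr_nth of_rat_less_eq)
  qed
qed

end

lemma sum_times_delta:
  fixes f :: "'i \<Rightarrow> 'j::semiring_1"
  shows "finite A \<Longrightarrow> (\<Sum>x\<in>A. f x * (if v = x then 1 else 0)) = (if v \<in> A then f v else 0)"
  by (simp add: if_distrib[of "\<lambda>y. _ * y"] cong: if_cong)

lemma count_list_distinct: "distinct xs \<Longrightarrow> count_list xs x = (if x \<in> set xs then 1 else 0)"
  by (induction xs) auto

context reduced_lattice
begin

text \<open>
  The \<open>E\<^sub>v\<close> with \<open>v \<in> I\<close>, in an arbitrary order.
\<close>

definition basis_list :: "'a list" where
  "basis_list = map E (SOME vs. set vs = I \<and> distinct vs)"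

lemma basis_list: "set basis_list = E ` I" "distinct basis_list" "length basis_list = card I"
proof -
  have "\<exists>vs. set vs = I \<and> distinct vs" using finite_distinct_list[of I] by auto
  then have *: "set (SOME vs. set vs = I \<and> distinct vs) = I \<and> distinct (SOME vs. set vs = I \<and> distinct vs)"
    by (rule someI_ex)
  then show "set basis_list = E ` I" "distinct basis_list"
    using basis_L(1) by (auto simp: basis_list_def distinct_map intro: inj_on_subset)
  show "length basis_list = card I"
    unfolding basis_list_def using * by (metis distinct_card length_map)
qed

definition all_ones :: 'a where
  "all_ones = sum_list basis_list"

lemma all_ones_eq: "all_ones = (\<Sum>v\<in>I. E v)"
  unfolding all_ones_def using basis_list inj_on_subset[OF basis_L(1) subset_UNIV, of I]
  by (simp add: distinct_sum_list_conv_Sum sum.reindex)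

lemma all_ones_L: "all_ones \<in> L"
  unfolding all_ones_eq by (intro subspace_sum[OF subspace_L] E_L)

lemma all_ones_L': "all_ones \<in> L'"
  using all_ones_L L_subset by blast

lemma coord_all_ones: "coord all_ones v = (if v \<in> I then 1 else 0)"
proof -
  have "(\<Sum>v\<in>I. E v) = (\<Sum>v\<in>UNIV. scale (if v \<in> I then 1 else 0) (E v))"
    by (intro sum.mono_neutral_cong_left) auto
  then show ?thesis using coord_L[of all_ones "\<lambda>v. if v \<in> I then 1 else 0" v] by (simp add: all_ones_eq)
qed

lemma coord_sum: "(\<And>i. i \<in> A \<Longrightarrow> f i \<in> L') \<Longrightarrow> coord (sum f A) v = (\<Sum>i\<in>A. coord (f i) v)"
  by (induction A rule: infinite_finite_induct) (simp_all add: coord_zero coord_add G_sum)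

lemma restr_E: "v \<in> I \<Longrightarrow> restr I (E v) = axis v 1"
  by (auto simp: vec_eq_iff restr_nth coord_E axis_def)

lemma pos_E: "v \<in> I \<Longrightarrow> pos (E v)"
  unfolding pos_def using E_L' by (auto simp: restr_E axis_def)

lemma basis_indep: "indep (E ` I)"
  unfolding indep_def
proof (intro allI impI ballI)
  fix k u assume k: "(\<Sum>u\<in>E ` I. scale (k u) u) \<in> kernel" and u: "u \<in> E ` I"
  obtain v where v: "v \<in> I" "u = E v" using u by blast
  have inj: "inj_on E I" using basis_L(1) by (rule inj_on_subset) simp
  have "0 = coord (\<Sum>x\<in>I. scale (k (E x)) (E x)) v"
    using k v(1) by (simp add: kernel_def sum.reindex[OF inj])
  also have "\<dots> = (\<Sum>x\<in>I. of_int (k (E x)) * (if v = x then 1 else 0))"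
    using E_L' by (simp add: coord_sum G_scale coord_scale coord_E)
  also have "\<dots> = of_int (k u)" using v by (simp add: sum_times_delta)
  finally show "k u = 0" by simp
qed

lemma lattice_hull_basis:
  "lattice_hull (E ` I) = L"
  "x \<in> L \<Longrightarrow> v \<in> I \<Longrightarrow> coord x v = of_int (lcoord (E ` I) x (E v))"
proof -
  have inj: "inj_on E I" using basis_L(1) by (rule inj_on_subset) simp
  have 1: "\<exists>k. x - (\<Sum>u\<in>E ` I. scale (k u) u) \<in> kernel \<and> (\<forall>v\<in>I. coord x v = of_int (k (E v)))" if x: "x \<in> L" for x
  proof -
    obtain k where k: "x = (\<Sum>v\<in>UNIV. scale (k v) (E v))" "\<And>v. coord x v = of_int (k v)"
      using L_coords[OF x] by blast
    let ?y = "\<Sum>v\<in>I. scale (k v) (E v)"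
    have yL: "?y \<in> L" by (intro subspace_sum[OF subspace_L] subspace_scale[OF subspace_L] E_L)
    have "coord ?y v = (\<Sum>x\<in>I. of_int (k x) * (if v = x then 1 else 0))" for v
      using E_L' by (simp add: coord_sum G_scale coord_scale coord_E)
    then have "coord (x - ?y) v = 0" if "v \<in> I" for v
      using that x yL L_subset k(2) by (subst coord_diff) (auto simp: sum_times_delta)
    then have "x - ?y \<in> kernel" using subspace_diff[OF subspace_L x yL] by (simp add: kernel_def)
    moreover have "?y = (\<Sum>u\<in>E ` I. scale (k (inv E u)) u)"
      using basis_L(1) by (simp add: sum.reindex[OF inj] inv_f_f)
    ultimately show ?thesis
      using k(2) basis_L(1) by (intro exI[of _ "\<lambda>u. k (inv E u)"]) (simp add: inv_f_f)
  qed
  have 2: "x \<in> L" if "x \<in> lattice_hull (E ` I)" for x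
  proof -
    let ?s = "\<Sum>u\<in>E ` I. scale (lcoord (E ` I) x u) u"
    have "?s \<in> L" using E_L by (intro subspace_sum[OF subspace_L] subspace_scale[OF subspace_L]) auto
    moreover have "x - ?s \<in> L" using lcoord[OF that] by (simp add: kernel_def)
    ultimately have "(x - ?s) + ?s \<in> L" using subspace_add[OF subspace_L] by blast
    then show ?thesis by simp
  qed
  show "lattice_hull (E ` I) = L"
    using 1 2 unfolding lattice_hull_def by blast
  show "coord x v = of_int (lcoord (E ` I) x (E v))" if x: "x \<in> L" and v: "v \<in> I"
  proof -
    obtain k where k: "x - (\<Sum>u\<in>E ` I. scale (k u) u) \<in> kernel" "\<forall>v\<in>I. coord x v = of_int (k (E v))"
      using 1[OF x] by blast
    then show ?thesis using lcoord_unique[OF basis_indep k(1), of "E v"] v by simp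
  qed
qed

lemma pf_basis_list: "pf basis_list x = (if x \<in> L \<and> (\<forall>v\<in>I. 0 \<le> coord x v) then 1 else 0)"
proof -
  have inj: "inj_on E I" using basis_L(1) by (rule inj_on_subset) simp
  have "pf basis_list = simplicial_pf (E ` I) basis_list"
    using basis_indep basis_list pos_E by (intro pf_eq_simplicial_pf) auto
  moreover have "count_list basis_list (E v) = Suc 0" if "v \<in> I" for v
    using basis_list that by (simp add: count_list_distinct)
  ultimately have *: "pf basis_list x =
      (if x \<in> L then \<Prod>v\<in>I. weak_comps (Suc 0) (lcoord (E ` I) x (E v)) else 0)"
    by (simp add: simplicial_pf_def lattice_hull_basis(1) prod.reindex[OF inj])
  show ?thesis
  proof (cases "x \<in> L")
    case True
    have w: "weak_comps (Suc 0) (lcoord (E ` I) x (E v)) = (if 0 \<le> coord x v then 1 else 0)" if "v \<in> I" for v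
      using lattice_hull_basis(2)[OF True that] by (simp add: weak_comps.simps)
    show ?thesis
    proof (cases "\<forall>v\<in>I. 0 \<le> coord x v")
      case True
      then show ?thesis using * w by simp
    next
      case False
      then have "(\<Prod>v\<in>I. weak_comps (Suc 0) (lcoord (E ` I) x (E v))) = 0"
        using w by (intro prod_zero) auto
      then have "pf basis_list x = 0" using * by simp
      then show ?thesis using False by auto
    qed
  qed (simp add: *)
qed

lemma foldr_diff_op_pf: "list_all pos (gs @ Y) \<Longrightarrow> foldr diff_op gs (pf (gs @ Y)) = pf Y"
proof (induction gs)
  case (Cons g gs)
  have "foldr diff_op (g # gs) (pf (g # gs @ Y)) = foldr diff_op gs (diff_op g (pf (g # gs @ Y)))"
    by (simp add: foldr_diff_op_commute)
  then show ?case using Cons diff_op_pf_Cons[of g "gs @ Y"] by simp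
qed simp

lemma pf_basis_shift:
  assumes "x \<in> L'" "b \<in> L'"
  shows "pf basis_list (x - b - all_ones) =
    (if cls b = cls x \<and> (\<forall>v\<in>I. coord b v < coord x v) then 1 else 0)"
proof -
  have mem: "x - b - all_ones \<in> L \<longleftrightarrow> cls b = cls x"
  proof -
    have "x - b - all_ones \<in> L \<longleftrightarrow> x - b \<in> L"
      using subspace_add[OF subspace_L _ all_ones_L, of "x - b - all_ones"] subspace_diff[OF subspace_L _ all_ones_L, of "x - b"]
      by auto
    then show ?thesis by (metis cls_eq_iff)
  qed
  have "0 \<le> coord (x - b - all_ones) v \<longleftrightarrow> coord b v < coord x v" if v: "v \<in> I" and c: "cls b = cls x" for v
  proof -
    have "x - b \<in> L" using c by (metis cls_eq_iff)
    then obtain k where k: "coord (x - b) v = of_int (k v)" using L_coords by metis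
    have 1: "coord (x - b - all_ones) v = of_int (k v - 1)"
      using k v assms all_ones_L' G_diff by (simp add: coord_diff[of "x - b" all_ones] coord_all_ones)
    have "coord x v - coord b v = of_int (k v)" using k assms by (simp add: coord_diff)
    then have "coord b v < coord x v \<longleftrightarrow> 0 < k v"
      using diff_gt_0_iff_gt[of "coord x v" "coord b v"] by (simp only: of_int_0_less_iff)
    then show ?thesis unfolding 1 by (simp only: of_int_0_le_iff) linarith
  qed
  then show ?thesis unfolding pf_basis_list mem by auto
qed

lemma counting_point_masses:
  assumes "\<And>k. k \<in> K \<Longrightarrow> b k \<in> L'" "finite K"
  shows "real_of_int (counting (\<lambda>x. \<Sum>k\<in>K. c k * (if x = b k then 1 else 0)) x)
    = (\<Sum>k\<in>K. of_int (c k) * pf basis_list (x - b k - all_ones))"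
proof (cases "x \<in> L'")
  case False
  have "pf basis_list (x - b k - all_ones) = 0" if "k \<in> K" for k
  proof -
    have "x - b k - all_ones \<notin> L'"
      using False G_add[OF G_add[OF _ all_ones_L', of "x - b k - all_ones"] assms(1)[OF that]] by auto
    then show ?thesis using L_subset by (auto simp: pf_basis_list)
  qed
  then show ?thesis using False by (simp add: counting_def)
next
  case True
  let ?p = "\<lambda>x. \<Sum>k\<in>K. c k * (if x = b k then 1 else 0)"
  let ?P = "\<lambda>l. cls l = cls x \<and> (\<forall>v\<in>I. coord l v < coord x v)"
  let ?S = "{l \<in> b ` K. ?P l}"
  have "counted ?p x \<subseteq> ?S"
  proof
    fix l assume l: "l \<in> counted ?p x"
    then have "?p l \<noteq> 0" by simp
    then obtain k where "k \<in> K" "c k * (if l = b k then 1 else 0) \<noteq> 0"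
      by (rule sum.not_neutral_contains_not_neutral)
    then show "l \<in> ?S" using l by (auto split: if_splits)
  qed
  then have "sum ?p (counted ?p x) = sum ?p ?S"
    using assms by (intro sum.mono_neutral_left) auto
  also have "\<dots> = (\<Sum>k\<in>K. c k * (\<Sum>l\<in>?S. if l = b k then 1 else 0))"
    by (subst sum.swap) (simp add: sum_distrib_left)
  also have "\<dots> = (\<Sum>k\<in>K. c k * (if ?P (b k) then 1 else 0))"
    using assms(2) by (intro sum.cong) (auto simp: sum.delta)
  finally have "counting ?p x = (\<Sum>k\<in>K. c k * (if ?P (b k) then 1 else 0))"
    using True by (simp add: counting_def mod_counting_def)
  then have "real_of_int (counting ?p x) = (\<Sum>k\<in>K. of_int (c k) * (if ?P (b k) then 1 else 0))"
    by (simp add: if_distrib[of real_of_int] cong: if_cong)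
  also have "\<dots> = (\<Sum>k\<in>K. of_int (c k) * pf basis_list (x - b k - all_ones))"
    by (intro sum.cong) (simp_all add: pf_basis_shift[OF True assms(1)])
  finally show ?thesis .
qed

text \<open>
  The counting function of a single point mass is the vector partition function of the \<open>E\<^sub>v\<close>; the
  shift by \<open>all_ones\<close> comes from the strict inequality. Since \<open>counting\<close> is linear and commutes with
  the difference operators, dividing by \<open>\<Prod> (1 - t\<^sup>g)\<close> before counting has the same effect as adding
  the exponents \<open>g\<close> to the generators.
\<close>

lemma counting_formula:
  assumes f: "narrow f" and gs: "list_all positive gs" and K: "finite K" "\<And>k. k \<in> K \<Longrightarrow> b k \<in> L'"
    and eq: "foldr diff_op gs f = (\<lambda>x. \<Sum>k\<in>K. c k * (if x = b k then 1 else 0))"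
  shows "real_of_int (counting f x) = (\<Sum>k\<in>K. of_int (c k) * pf (gs @ basis_list) (x - b k - all_ones))"
proof -
  have gs': "list_all pos gs" using gs positive_pos by (auto simp: list_all_iff)
  have pos: "list_all pos (gs @ basis_list)"
    using gs' basis_list(1) pos_E by (auto simp: list_all_iff)
  have gsL: "set gs \<subseteq> L'" using gs by (auto simp: list_all_iff positive_def)
  let ?F = "\<lambda>x. \<Sum>k\<in>K. of_int (c k) * pf (gs @ basis_list) (x - (b k + all_ones))"
  have "(\<lambda>x. of_int (counting f x)) = ?F"
  proof (rule foldr_diff_op_unique[OF _ _ gs'])
    show "bounded_supp (\<lambda>x. real_of_int (counting f x))"
      using bounded_supp_counting[OF f] by (simp add: bounded_supp_def)
    show "bounded_supp ?F"
      using K(2) all_ones_L' by (intro bounded_supp_sum bounded_supp_mult bounded_supp_shift bounded_supp_pf[OF pos] G_add)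
    have "foldr diff_op gs (\<lambda>x. of_int (counting f x)) = (\<lambda>x. real_of_int (counting (foldr diff_op gs f) x))"
      using counting_foldr_diff_op[OF f gsL] by (simp add: foldr_diff_op_of_int)
    also have "\<dots> = (\<lambda>x. \<Sum>k\<in>K. of_int (c k) * pf basis_list (x - (b k + all_ones)))"
      unfolding eq using counting_point_masses[OF K(2,1)] by (simp add: diff_diff_eq)
    also have "\<dots> = foldr diff_op gs ?F"
      by (simp only: foldr_diff_op_sum foldr_diff_op_linear foldr_diff_op_shift foldr_diff_op_pf[OF pos])
    finally show "foldr diff_op gs (\<lambda>x. real_of_int (counting f x)) = foldr diff_op gs ?F" .
  qed
  then show ?thesis by (simp add: fun_eq_iff diff_diff_eq)
qed

text \<open>
  The coordinates of an exponent of class \<open>h\<close> differ from those of \<open>rep h\<close> by integers, and those of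
  \<open>rep h\<close> lie in \<open>[0,1)\<close>. Hence nonnegativity of \<open>l\<close> on \<open>I\<close> means that \<open>- l\<close> lies strictly below
  \<open>all_ones - rep h\<close>, and the sum is a value of the counting function.
\<close>

lemma sum_reduced_coeff:
  assumes f: "narrow f" and h: "h \<in> class_group"
  shows "(\<Sum>y | y \<in> coord_space I \<and> (\<forall>v\<in>I. 0 \<le> y $ v) \<and> reduced_coeff (\<lambda>l. f (- l)) h I y \<noteq> 0.
      reduced_coeff (\<lambda>l. f (- l)) h I y) = counting f (all_ones - rep h)" (is "sum ?r ?Y = _")
proof -
  note r = rep[OF h]
  define A where "A = {l \<in> L'. cls l = h \<and> (\<forall>v\<in>I. 0 \<le> coord l v) \<and> f (- l) \<noteq> 0}"
  have ur: "all_ones - rep h \<in> L'" using all_ones_L' r(1) by (rule G_diff)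
  have int: "0 \<le> coord l v \<longleftrightarrow> coord (- l) v < coord (all_ones - rep h) v"
    if l: "l \<in> L'" "cls l = h" and v: "v \<in> I" for l v
  proof -
    have "l - rep h \<in> L" using l(2) r(2) by (metis cls_eq_iff)
    then obtain k where k: "coord (l - rep h) v = of_int (k v)" using L_coords by metis
    have kv: "coord l v = of_int (k v) + coord (rep h) v" using k l(1) r(1) by (simp add: coord_diff)
    have "coord (- l) v = - coord l v" "coord (all_ones - rep h) v = 1 - coord (rep h) v"
      using l(1) v r(1) all_ones_L' by (simp_all add: coord_neg coord_diff coord_all_ones)
    then have "coord (- l) v < coord (all_ones - rep h) v \<longleftrightarrow> -1 < (of_int (k v) :: rat)" using kv by auto
    also have "\<dots> \<longleftrightarrow> 0 \<le> k v" by linarith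
    also have "\<dots> \<longleftrightarrow> 0 \<le> coord l v"
    proof
      assume "0 \<le> k v" then show "0 \<le> coord l v" using kv r(3)[of v] by simp
    next
      assume "0 \<le> coord l v"
      then have "-1 < (of_int (k v) :: rat)" using kv r(4)[of v] by linarith
      then show "0 \<le> k v" by linarith
    qed
    finally show ?thesis by simp
  qed
  have cls: "cls (- l) = cls (all_ones - rep h) \<longleftrightarrow> cls l = h" for l
  proof -
    have "cls (- l) = cls (all_ones - rep h) \<longleftrightarrow> - l - (all_ones - rep h) \<in> L" by (rule cls_eq_iff)
    also have "- l - (all_ones - rep h) = - ((l - rep h) + all_ones)" by simp
    also have "\<dots> \<in> L \<longleftrightarrow> (l - rep h) + all_ones \<in> L"
      using subspace_neg[OF subspace_L] by (metis minus_minus)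
    also have "\<dots> \<longleftrightarrow> l - rep h \<in> L"
      using subspace_add[OF subspace_L _ all_ones_L] subspace_diff[OF subspace_L _ all_ones_L]
      by (metis add_diff_cancel_right')
    also have "\<dots> \<longleftrightarrow> cls l = h" using r(2) by (metis cls_eq_iff)
    finally show ?thesis .
  qed
  have bij: "bij_betw uminus A (counted f (all_ones - rep h))"
  proof (rule bij_betw_byWitness[of _ uminus])
    show "uminus ` A \<subseteq> counted f (all_ones - rep h)"
      using int cls by (auto simp: A_def G_neg)
    show "uminus ` counted f (all_ones - rep h) \<subseteq> A"
    proof
      fix m assume "m \<in> uminus ` counted f (all_ones - rep h)"
      then obtain l where l: "m = - l" "l \<in> counted f (all_ones - rep h)" by blast
      have "l = - m" using l(1) by simp
      then show "m \<in> A" using l(2) int[of m] cls[of m] G_neg[of "- m"] by (auto simp: A_def)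
    qed
  qed auto
  have finA: "finite A" using bij_betw_finite[OF bij] finite_counted[OF f] by blast
  have ry: "?r y = (\<Sum>l | l \<in> A \<and> restr I l = y. f (- l))"
    if y: "y \<in> coord_space I" "\<forall>v\<in>I. 0 \<le> y $ v" for y
  proof -
    have "0 \<le> coord l v" if "restr I l = y" "v \<in> I" for l v
      using y(2) that by (auto simp: restr_nth)
    then have "{l. l \<in> L' \<and> cls l = h \<and> restr I l = y \<and> f (- l) \<noteq> 0} = {l. l \<in> A \<and> restr I l = y}"
      by (auto simp: A_def)
    then show ?thesis by (simp add: reduced_coeff_def)
  qed
  have sub: "restr I ` A \<subseteq> {y \<in> coord_space I. \<forall>v\<in>I. 0 \<le> y $ v}"
    using restr_coord_space by (auto simp: A_def restr_nth)
  have Y: "?Y \<subseteq> restr I ` A"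
  proof
    fix y assume y: "y \<in> ?Y"
    then have "(\<Sum>l | l \<in> A \<and> restr I l = y. f (- l)) \<noteq> 0" using ry[of y] by simp
    then obtain l where "l \<in> {l. l \<in> A \<and> restr I l = y}" "f (- l) \<noteq> 0"
      by (rule sum.not_neutral_contains_not_neutral)
    then show "y \<in> restr I ` A" by blast
  qed
  have "sum ?r ?Y = sum ?r (restr I ` A)"
    using finA Y sub by (intro sum.mono_neutral_left) auto
  also have "\<dots> = (\<Sum>y\<in>restr I ` A. \<Sum>l | l \<in> A \<and> restr I l = y. f (- l))"
    using sub ry by (intro sum.cong) auto
  also have "\<dots> = (\<Sum>l\<in>A. f (- l))" using finA by (rule sum.image_gen[symmetric])
  also have "\<dots> = sum f (counted f (all_ones - rep h))"
    by (rule sum.reindex_bij_betw[OF bij])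
  also have "\<dots> = counting f (all_ones - rep h)" using ur by (simp add: counting_def mod_counting_def)
  finally show ?thesis .
qed

end

definition poly_fun :: "(('v::finite \<Rightarrow> real) \<Rightarrow> real) \<Rightarrow> bool" where
  "poly_fun F \<longleftrightarrow> (\<exists>A c. finite A \<and> (\<forall>y. F y = (\<Sum>\<alpha>\<in>A. c \<alpha> * (\<Prod>v\<in>UNIV. y v ^ \<alpha> v))))"

lemma poly_fun_monomial: "poly_fun (\<lambda>y. k * (\<Prod>v\<in>UNIV. y v ^ \<alpha> v))"
  unfolding poly_fun_def by (intro exI[of _ "{\<alpha>}"] exI[of _ "\<lambda>_. k"]) simp

lemma poly_fun_const: "poly_fun (\<lambda>y. k)"
  using poly_fun_monomial[of k "\<lambda>v. 0"] by simp

lemma poly_fun_add: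
  assumes "poly_fun F" "poly_fun H" shows "poly_fun (\<lambda>y. F y + H y)"
proof -
  obtain A c where A: "finite A" "\<And>y. F y = (\<Sum>\<alpha>\<in>A. c \<alpha> * (\<Prod>v\<in>UNIV. y v ^ \<alpha> v))"
    using assms(1) unfolding poly_fun_def by blast
  obtain B d where B: "finite B" "\<And>y. H y = (\<Sum>\<alpha>\<in>B. d \<alpha> * (\<Prod>v\<in>UNIV. y v ^ \<alpha> v))"
    using assms(2) unfolding poly_fun_def by blast
  let ?e = "\<lambda>\<alpha>. (if \<alpha> \<in> A then c \<alpha> else 0) + (if \<alpha> \<in> B then d \<alpha> else 0)"
  have "F y + H y = (\<Sum>\<alpha>\<in>A \<union> B. ?e \<alpha> * (\<Prod>v\<in>UNIV. y v ^ \<alpha> v))" for y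
  proof -
    have "F y = (\<Sum>\<alpha>\<in>A \<union> B. (if \<alpha> \<in> A then c \<alpha> else 0) * (\<Prod>v\<in>UNIV. y v ^ \<alpha> v))"
      unfolding A(2) using A(1) B(1) by (intro sum.mono_neutral_cong_left) auto
    moreover have "H y = (\<Sum>\<alpha>\<in>A \<union> B. (if \<alpha> \<in> B then d \<alpha> else 0) * (\<Prod>v\<in>UNIV. y v ^ \<alpha> v))"
      unfolding B(2) using A(1) B(1) by (intro sum.mono_neutral_cong_left) auto
    ultimately show ?thesis by (simp add: distrib_right sum.distrib)
  qed
  then show ?thesis unfolding poly_fun_def using A(1) B(1) by (intro exI[of _ "A \<union> B"] exI[of _ ?e]) auto
qed

lemma poly_fun_sum: "(\<And>i. i \<in> A \<Longrightarrow> poly_fun (F i)) \<Longrightarrow> poly_fun (\<lambda>y. \<Sum>i\<in>A. F i y)"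
  by (induction A rule: infinite_finite_induct) (simp_all add: poly_fun_const poly_fun_add)

lemma poly_fun_mult:
  assumes "poly_fun F" "poly_fun H" shows "poly_fun (\<lambda>y. F y * H y)"
proof -
  obtain A c where A: "finite A" "\<And>y. F y = (\<Sum>\<alpha>\<in>A. c \<alpha> * (\<Prod>v\<in>UNIV. y v ^ \<alpha> v))"
    using assms(1) unfolding poly_fun_def by blast
  obtain B d where B: "finite B" "\<And>y. H y = (\<Sum>\<beta>\<in>B. d \<beta> * (\<Prod>v\<in>UNIV. y v ^ \<beta> v))"
    using assms(2) unfolding poly_fun_def by blast
  have "F y * H y = (\<Sum>\<alpha>\<in>A. \<Sum>\<beta>\<in>B. (c \<alpha> * d \<beta>) * (\<Prod>v\<in>UNIV. y v ^ (\<alpha> v + \<beta> v)))" for y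
    unfolding A(2) B(2) sum_product by (simp add: power_add prod.distrib mult_ac)
  moreover have "poly_fun (\<lambda>y. \<Sum>\<alpha>\<in>A. \<Sum>\<beta>\<in>B. (c \<alpha> * d \<beta>) * (\<Prod>v\<in>UNIV. y v ^ (\<alpha> v + \<beta> v)))"
    by (intro poly_fun_sum poly_fun_monomial)
  ultimately show ?thesis by simp
qed

lemma poly_fun_coordinate: "poly_fun (\<lambda>y. y v)"
proof -
  have "y v = 1 * (\<Prod>u\<in>UNIV. y u ^ (if u = v then 1 else 0))" for y :: "'a \<Rightarrow> real"
    by (simp add: if_distrib[of "\<lambda>n. _ ^ n"] cong: if_cong)
  then show ?thesis using poly_fun_monomial[of 1 "\<lambda>u. if u = v then 1 else 0"] by simp
qed

context reduced_lattice
begin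

text \<open>
  On a sufficiently divisible sublattice the periodic parts are constant and an honest polynomial
  remains.
\<close>

lemma qpoly_on_multiples:
  assumes "qpoly f"
  shows "\<exists>D>0. \<exists>F. poly_fun F \<and> (\<forall>l\<in>L. f (scale D l) = F (\<lambda>v. of_rat (coord (scale D l) v)))"
  using assms
proof induction
  case (linear \<phi>)
  have "\<phi> (restr I x) = (\<Sum>v\<in>I. of_rat (coord x v) * \<phi> (axis v 1))" for x
  proof -
    have "restr I x = (\<Sum>v\<in>I. of_rat (coord x v) *\<^sub>R axis v 1)"
      by (auto simp: vec_eq_iff restr_nth axis_def if_distrib[of "\<lambda>y. _ * y"] cong: if_cong)
    then show ?thesis using linear by (simp add: linear_sum linear_scale)
  qed
  moreover have "poly_fun (\<lambda>y. \<Sum>v\<in>I. y v * \<phi> (axis v 1))"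
    by (intro poly_fun_sum poly_fun_mult poly_fun_coordinate poly_fun_const)
  ultimately show ?case
    by (intro exI[of _ 1] conjI exI[of _ "\<lambda>y. \<Sum>v\<in>I. y v * \<phi> (axis v 1)"]) simp_all
next
  case (periodic D p)
  have "p (scale D l) = p 0" if "l \<in> L" for l
    using periodic(2)[of 0 l] that L_subset G_0 by auto
  then show ?case using periodic(1) by (intro exI[of _ D] conjI exI[of _ "\<lambda>y. p 0"]) (simp_all add: poly_fun_const)
next
  case (add f h)
  then obtain D F D' F' where
    D: "D > 0" "poly_fun F" "\<And>l. l \<in> L \<Longrightarrow> f (scale D l) = F (\<lambda>v. of_rat (coord (scale D l) v))"
    and D': "D' > 0" "poly_fun F'" "\<And>l. l \<in> L \<Longrightarrow> h (scale D' l) = F' (\<lambda>v. of_rat (coord (scale D' l) v))"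
    by blast
  have "f (scale (D * D') l) = F (\<lambda>v. of_rat (coord (scale (D * D') l) v))"
    "h (scale (D * D') l) = F' (\<lambda>v. of_rat (coord (scale (D * D') l) v))" if "l \<in> L" for l
    using D(3)[OF subspace_scale[OF subspace_L that, of D']] D'(3)[OF subspace_scale[OF subspace_L that, of D]]
    by (simp_all add: mult.commute)
  then show ?case
    using D(1,2) D'(1,2) by (intro exI[of _ "D * D'"] conjI exI[of _ "\<lambda>y. F y + F' y"]) (simp_all add: poly_fun_add)
next
  case (mult f h)
  then obtain D F D' F' where
    D: "D > 0" "poly_fun F" "\<And>l. l \<in> L \<Longrightarrow> f (scale D l) = F (\<lambda>v. of_rat (coord (scale D l) v))"
    and D': "D' > 0" "poly_fun F'" "\<And>l. l \<in> L \<Longrightarrow> h (scale D' l) = F' (\<lambda>v. of_rat (coord (scale D' l) v))"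
    by blast
  have "f (scale (D * D') l) = F (\<lambda>v. of_rat (coord (scale (D * D') l) v))"
    "h (scale (D * D') l) = F' (\<lambda>v. of_rat (coord (scale (D * D') l) v))" if "l \<in> L" for l
    using D(3)[OF subspace_scale[OF subspace_L that, of D']] D'(3)[OF subspace_scale[OF subspace_L that, of D]]
    by (simp_all add: mult.commute)
  then show ?case
    using D(1,2) D'(1,2) by (intro exI[of _ "D * D'"] conjI exI[of _ "\<lambda>y. F y * F' y"]) (simp_all add: poly_fun_mult)
qed

lemma finite_index_refl: "subspace M \<Longrightarrow> finite_index M M"
proof -
  assume M: "subspace M"
  have "{x + m |m. m \<in> M} = M" if "x \<in> M" for x
  proof
    show "{x + m |m. m \<in> M} \<subseteq> M" using subspace_add[OF M that] by blast
    show "M \<subseteq> {x + m |m. m \<in> M}"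
    proof
      fix y assume "y \<in> M"
      then have "y - x \<in> M" "y = x + (y - x)" using subspace_diff[OF M _ that] by auto
      then show "y \<in> {x + m |m. m \<in> M}" by blast
    qed
  qed
  then have "(\<lambda>x. {x + m |m. m \<in> M}) ` M \<subseteq> {M}" by blast
  then show ?thesis unfolding finite_index_def using M finite_subset by blast
qed

text \<open>
  Coordinates modulo \<open>D\<close> represent the finitely many cosets.
\<close>

lemma finite_index_multiples:
  assumes "D > 0" shows "finite_index (scale D ` L) L"
proof -
  let ?M = "scale D ` L"
  have sub: "subspace ?M"
    unfolding subspace_def
  proof (intro conjI ballI allI)
    show "0 \<in> ?M" using subspace_0[OF subspace_L] by (metis imageI scale_zero_right)
    show "x + y \<in> ?M" if "x \<in> ?M" "y \<in> ?M" for x y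
      using that subspace_add[OF subspace_L] by (auto simp: scale_right_distrib[symmetric])
    show "scale c x \<in> ?M" if "x \<in> ?M" for c x
    proof -
      obtain l where l: "l \<in> L" "x = scale D l" using \<open>x \<in> ?M\<close> by blast
      have "scale c x = scale D (scale c l)" by (simp add: l(2) mult.commute)
      then show ?thesis using subspace_scale[OF subspace_L l(1)] by blast
    qed
  qed
  define R where "R = (UNIV :: 'b set) \<rightarrow>\<^sub>E {0..<D}"
  have finR: "finite R" unfolding R_def by (intro finite_PiE) auto
  have "(\<lambda>x. {x + m |m. m \<in> ?M}) ` L \<subseteq> (\<lambda>k. {(\<Sum>v\<in>UNIV. scale (k v) (E v)) + m |m. m \<in> ?M}) ` R"
  proof
    fix S assume "S \<in> (\<lambda>x. {x + m |m. m \<in> ?M}) ` L"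
    then obtain x where x: "x \<in> L" "S = {x + m |m. m \<in> ?M}" by blast
    obtain k where k: "x = (\<Sum>v\<in>UNIV. scale (k v) (E v))" using L_coords[OF x(1)] by blast
    define q where "q = (\<Sum>v\<in>UNIV. scale (k v div D) (E v))"
    have qL: "q \<in> L" unfolding q_def by (intro subspace_sum[OF subspace_L] subspace_scale[OF subspace_L] E_L)
    define y where "y = (\<Sum>v\<in>UNIV. scale (k v mod D) (E v))"
    have "x = (\<Sum>v\<in>UNIV. scale (k v mod D + D * (k v div D)) (E v))" using k by simp
    also have "\<dots> = y + scale D q"
      unfolding y_def q_def scale_left_distrib sum.distrib scale_sum_right by simp
    finally have xy: "x = y + scale D q" .
    have "{x + m |m. m \<in> ?M} = {y + m |m. m \<in> ?M}"
    proof
      show "{x + m |m. m \<in> ?M} \<subseteq> {y + m |m. m \<in> ?M}"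
      proof clarify
        fix l assume "l \<in> L"
        then have "x + scale D l = y + scale D (q + l)" "q + l \<in> L"
          using subspace_add[OF subspace_L qL] by (simp_all add: xy scale_right_distrib add.assoc)
        then show "\<exists>m. x + scale D l = y + m \<and> m \<in> ?M" by blast
      qed
      show "{y + m |m. m \<in> ?M} \<subseteq> {x + m |m. m \<in> ?M}"
      proof clarify
        fix l assume "l \<in> L"
        then have "y + scale D l = x + scale D (l - q)" "l - q \<in> L"
          using subspace_diff[OF subspace_L _ qL] by (simp_all add: xy scale_right_diff_distrib)
        then show "\<exists>m. y + scale D l = x + m \<and> m \<in> ?M" by blast
      qed
    qed
    moreover have "(\<lambda>v. k v mod D) \<in> R" using assms by (auto simp: R_def)
    ultimately show "S \<in> (\<lambda>k. {(\<Sum>v\<in>UNIV. scale (k v) (E v)) + m |m. m \<in> ?M}) ` R"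
      unfolding x(2) y_def by (rule image_eqI)
  qed
  then have "finite ((\<lambda>x. {x + m |m. m \<in> ?M}) ` L)" by (rule finite_subset) (use finR in simp)
  then show ?thesis
    unfolding finite_index_def using sub subspace_scale[OF subspace_L] by blast
qed

lemma qpoly_quasipolynomial:
  assumes "qpoly f"
  shows "\<exists>M. finite_index M L \<and> quasipolynomial_on M f"
proof -
  obtain D F where D: "D > 0" "poly_fun F" "\<And>l. l \<in> L \<Longrightarrow> f (scale D l) = F (\<lambda>v. of_rat (coord (scale D l) v))"
    using qpoly_on_multiples[OF assms] by blast
  obtain A c where A: "finite A" "\<And>y. F y = (\<Sum>\<alpha>\<in>A. c \<alpha> * (\<Prod>v\<in>UNIV. y v ^ \<alpha> v))"
    using D(2) unfolding poly_fun_def by blast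
  let ?M = "scale D ` L"
  have M: "finite_index ?M L" using finite_index_multiples[OF D(1)] .
  then have "finite_index ?M ?M" using finite_index_refl by (simp add: finite_index_def)
  moreover have "\<forall>l\<in>?M. f l = (\<Sum>\<alpha>\<in>A. c \<alpha> * (\<Prod>v\<in>UNIV. of_rat (coord l v) ^ \<alpha> v))"
    using D(3) A(2) by auto
  ultimately have "quasipolynomial_on ?M f"
    unfolding quasipolynomial_on_def using A(1)
    by (intro exI[of _ A] exI[of _ "\<lambda>\<alpha> l. c \<alpha>"] exI[of _ ?M]) simp
  then show ?thesis using M by blast
qed

text \<open>
  Two of the multiples of \<open>x\<close> lie in the same coset.
\<close>

lemma multiple_in_finite_index:
  assumes "finite_index M N" "subspace N" "x \<in> N"
  obtains D :: int where "D > 0" "scale D x \<in> M"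
proof -
  let ?c = "\<lambda>x. {x + m |m. m \<in> M}"
  have M: "subspace M" "finite (?c ` N)" using assms(1) by (auto simp: finite_index_def)
  have "range (\<lambda>j::nat. ?c (scale (int j) x)) \<subseteq> ?c ` N" using subspace_scale[OF assms(2,3)] by blast
  then have "finite (range (\<lambda>j::nat. ?c (scale (int j) x)))" using M(2) finite_subset by blast
  then have "\<not> inj (\<lambda>j::nat. ?c (scale (int j) x))" using finite_imageD infinite_UNIV_nat by blast
  then obtain i' j' :: nat where ij': "i' \<noteq> j'" "?c (scale (int i') x) = ?c (scale (int j') x)"
    unfolding inj_def by blast
  define i where "i = min i' j'"
  define j where "j = max i' j'"
  have ij: "i < j" "?c (scale (int i) x) = ?c (scale (int j) x)"
    using ij' by (auto simp: i_def j_def min_def max_def)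
  have "scale (int j) x + 0 \<in> ?c (scale (int j) x)" using subspace_0[OF M(1)] by blast
  then have "scale (int j) x \<in> ?c (scale (int i) x)" using ij(2) by simp
  then obtain m where "m \<in> M" "scale (int j) x = scale (int i) x + m" by blast
  then have "scale (int j - int i) x \<in> M" by (simp add: scale_left_diff_distrib)
  then show ?thesis using that[of "int j - int i"] ij(1) by simp
qed

lemma quasipolynomial_ray:
  assumes M: "finite_index M L" and g: "quasipolynomial_on M g" and u: "u \<in> L"
  obtains D p where "D > 0" "\<And>k. scale (D * k) u \<in> M" "\<And>k. g (scale (D * k) u) = poly p (of_int k)"
proof -
  obtain A c N where A: "finite A" "finite_index N M"
    "\<And>\<alpha> l m. \<alpha> \<in> A \<Longrightarrow> l \<in> M \<Longrightarrow> m \<in> N \<Longrightarrow> c \<alpha> (l + m) = c \<alpha> l"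
    "\<And>l. l \<in> M \<Longrightarrow> g l = (\<Sum>\<alpha>\<in>A. c \<alpha> l * (\<Prod>v\<in>UNIV. of_rat (coord l v) ^ \<alpha> v))"
    using g unfolding quasipolynomial_on_def by blast
  have Ms: "subspace M" using M by (simp add: finite_index_def)
  have Ns: "subspace N" "N \<subseteq> M" using A(2) by (simp_all add: finite_index_def)
  obtain D1 where D1: "D1 > 0" "scale D1 u \<in> M" using multiple_in_finite_index[OF M subspace_L u] .
  obtain D2 where D2: "D2 > 0" "scale D2 (scale D1 u) \<in> N" using multiple_in_finite_index[OF A(2) Ms D1(2)] .
  let ?D = "D2 * D1"
  have inN: "scale (?D * k) u \<in> N" for k
    using subspace_scale[OF Ns(1) D2(2), of k] by (simp add: mult_ac)
  let ?p = "\<Sum>\<alpha>\<in>A. smult (c \<alpha> 0) (\<Prod>v\<in>UNIV. [:0, of_int ?D * of_rat (coord u v):] ^ \<alpha> v)"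
  have "g (scale (?D * k) u) = poly ?p (of_int k)" for k
  proof -
    have l: "scale (?D * k) u \<in> M" using inN Ns(2) by blast
    have "c \<alpha> (scale (?D * k) u) = c \<alpha> 0" if "\<alpha> \<in> A" for \<alpha>
      using A(3)[OF that subspace_0[OF Ms] inN[of k]] by simp
    moreover have "u \<in> L'" using u L_subset by blast
    then have "of_rat (coord (scale (?D * k) u) v) = of_int k * (of_int ?D * of_rat (coord u v) :: real)" for v
      by (simp add: coord_scale of_rat_mult)
    ultimately show ?thesis
      unfolding A(4)[OF l] by (simp add: poly_sum poly_prod mult_ac)
  qed
  moreover have "?D > 0" using D1(1) D2(1) by simp
  moreover have "scale (?D * k) u \<in> M" for k using inN Ns(2) by blast
  ultimately show ?thesis using that[of ?D ?p] by simp
qed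

end

section \<open>Modified periodic constants\<close>

context reduced_lattice
begin

text \<open>
  A real relation between the restrictions gives an integral one. The corresponding combination of
  \<open>\<sigma>\<close> has vanishing coordinates on \<open>I\<close>, so a multiple of it lies in the kernel.
\<close>

lemma indep_imp_independent:
  assumes "finite \<sigma>" "\<sigma> \<subseteq> L'" "indep \<sigma>"
  shows "inj_on (restr I) \<sigma> \<and> \<not> real_vector.dependent (restr I ` \<sigma>)"
proof (rule ccontr)
  assume "\<not> ?thesis"
  then obtain c u0 where c: "u0 \<in> \<sigma>" "c u0 \<noteq> 0" "(\<Sum>u\<in>\<sigma>. c u *\<^sub>R restr I u) = 0"
    using family_relation[OF assms(1), of "restr I"] by metis
  have "(\<Sum>u\<in>\<sigma>. c u * of_rat (if v \<in> I then coord u v else 0)) = 0" for v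
    using arg_cong[OF c(3), of "\<lambda>y. y $ v"] by (simp add: restr_nth if_distrib cong: if_cong)
  then obtain k where k: "\<And>v. (\<Sum>u\<in>\<sigma>. of_int (k u) * (if v \<in> I then coord u v else 0)) = 0" "k u0 \<noteq> 0"
    using integer_relation[OF assms(1), of c "\<lambda>u v. if v \<in> I then coord u v else 0" u0] c(1,2) by metis
  let ?x = "\<Sum>u\<in>\<sigma>. scale (k u) u"
  have xL: "?x \<in> L'" using assms(2) by (intro G_sum G_scale) auto
  have x0: "coord ?x v = 0" if v: "v \<in> I" for v
  proof -
    have "coord ?x v = (\<Sum>u\<in>\<sigma>. of_int (k u) * coord u v)"
      using assms(2) by (subst coord_sum) (auto simp: G_scale coord_scale subset_iff intro!: sum.cong)
    then show ?thesis using k(1)[of v] v by simp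
  qed
  obtain m l where m: "m > 0" "scale m ?x = (\<Sum>v\<in>UNIV. scale (l v) (E v))" using multiple_in_L[OF xL] .
  have "scale m ?x \<in> L" unfolding m(2) by (intro subspace_sum[OF subspace_L] subspace_scale[OF subspace_L] E_L)
  then have "scale m ?x \<in> kernel" using x0 coord_scale[OF xL] by (simp add: kernel_def)
  moreover have "scale m ?x = (\<Sum>u\<in>\<sigma>. scale (m * k u) u)" by (simp add: scale_sum_right)
  ultimately have "(\<Sum>u\<in>\<sigma>. scale (m * k u) u) \<in> kernel" by (simp only:)
  then have "m * k u0 = 0"
    using assms(3)[unfolded indep_def, THEN spec, of "\<lambda>u. m * k u"] c(1) by blast
  then show False using m(1) k(2) by simp
qed

lemma L'_finitely_generated: "\<exists>B. finite B \<and> span B = L'"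
  using free_L' by blast

end

text \<open>
  The list \<open>gs\<close> plays the role of the exponents \<open>a\<^sub>i\<close> of the denominator.
\<close>

locale lattice_chamber = reduced_lattice +
  fixes gs :: "'a list" and C :: "(real ^ 'b) set"
  assumes gs_positive: "list_all positive gs"
    and chamber: "C \<in> chambers I (restr I ` (set gs \<union> E ` I))"
begin

definition X :: "'a list" where
  "X = gs @ basis_list"

lemma set_X: "set X = set gs \<union> E ` I"
  by (simp add: X_def basis_list)

lemma sum_X: "sum_list X = sum_list gs + all_ones"
  by (simp add: X_def all_ones_def)

lemma length_X: "length X = length gs + card I"
  by (simp add: X_def basis_list)

lemma X_pos: "list_all pos X"
  using gs_positive positive_pos pos_E by (auto simp: list_all_iff set_X)

lemma X_L': "set X \<subseteq> L'"
  using X_pos by (auto simp: list_all_iff pos_def)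

lemma sum_gs_L': "sum_list gs \<in> L'"
  using X_L' by (intro G_sum_list) (simp add: set_X)

lemma X_nonneg: "g \<in> set X \<Longrightarrow> 0 \<le> coord g v"
  using gs_positive by (auto simp: list_all_iff set_X positive_def coord_E less_imp_le)

sublocale chamber_arrangement I "restr I ` set X" C
proof
  show "finite (restr I ` set X)" by simp
  show "restr I ` set X \<subseteq> coord_space I" using restr_coord_space by blast
  show "axis v 1 \<in> restr I ` set X" if "v \<in> I" for v
    using that restr_E[OF that] by (force simp: set_X)
  show "0 \<le> g $ v" if "g \<in> restr I ` set X" "v \<in> I" for g v
    using that X_nonneg by (auto simp: restr_nth)
  show "0 < (\<Sum>v\<in>I. g $ v)" if "g \<in> restr I ` set X" for g
    using that X_pos by (auto simp: list_all_iff pos_def)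
  show "C \<in> chambers I (restr I ` set X)" using chamber by (simp add: set_X)
qed

text \<open>
  Rational vectors are dense, \<open>C\<close> is open, and denominators can be cleared by scaling.
\<close>

lemma lattice_point_in_C: "\<exists>u\<in>L. restr I u \<in> C"
proof -
  obtain x where x: "x \<in> C" using C_nonempty by blast
  obtain e where e: "e > 0" "\<And>y. y \<in> coord_space I \<Longrightarrow> dist y x < e \<Longrightarrow> y \<in> C"
    using C_open[OF x] by blast
  obtain N :: nat where N: "real CARD('b) / e < real N" using reals_Archimedean2 by blast
  have N0: "0 < real N" using N e(1) by (smt (verit) divide_nonneg_pos of_nat_0_le_iff)
  let ?u = "\<Sum>v\<in>I. scale \<lfloor>real N * x $ v\<rfloor> (E v)"
  have uL: "?u \<in> L" by (intro subspace_sum[OF subspace_L] subspace_scale[OF subspace_L] E_L)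
  have coord_u: "coord ?u v = of_int \<lfloor>real N * x $ v\<rfloor>" if "v \<in> I" for v
    using that E_L' by (simp add: coord_sum G_scale coord_scale coord_E sum_times_delta)
  have close: "\<bar>restr I ?u $ v / real N - x $ v\<bar> \<le> 1 / real N" for v
  proof (cases "v \<in> I")
    case True
    have "\<bar>of_int \<lfloor>real N * x $ v\<rfloor> - real N * x $ v\<bar> \<le> 1" by linarith
    then have "\<bar>(of_int \<lfloor>real N * x $ v\<rfloor> - real N * x $ v) / real N\<bar> \<le> 1 / real N"
      using N0 by (simp add: divide_right_mono)
    then show ?thesis using True N0 by (simp add: restr_nth coord_u diff_divide_distrib)
  next
    case False
    then show ?thesis using C_V[OF x] by (simp add: restr_nth coord_space_def)
  qed
  have "norm ((1 / real N) *\<^sub>R restr I ?u - x) \<le> (\<Sum>v\<in>UNIV. \<bar>((1 / real N) *\<^sub>R restr I ?u - x) $ v\<bar>)"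
    by (rule norm_le_l1_cart)
  also have "\<dots> \<le> (\<Sum>v\<in>(UNIV :: 'b set). 1 / real N)"
    using close by (intro sum_mono) simp
  also have "\<dots> < e" using N N0 e(1) by (simp add: field_simps)
  finally have "(1 / real N) *\<^sub>R restr I ?u \<in> C"
    using e(2) restr_coord_space[of I ?u] real_vector.subspace_scale[OF subspace_V]
    by (simp add: dist_norm)
  from C_scale[OF this N0] have "restr I ?u \<in> C" using N0 by simp
  then show ?thesis using uL by blast
qed

text \<open>
  Choose a lattice vector \<open>u\<close> that points into \<open>C\<close>. On suitable multiples of \<open>u\<close> both
  quasi-polynomials are polynomials in one variable that agree with the counting function at all
  large arguments. Hence they agree at \<open>0\<close>.
\<close>

lemma mpc_unique:
  assumes "is_mpc f h I C p" "is_mpc f h I C q" "h \<in> class_group"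
  shows "p = q"
proof -
  obtain u where u: "u \<in> L" "restr I u \<in> C" using lattice_point_in_C by blast
  have uL': "u \<in> L'" using u(1) L_subset by blast
  have rh: "rep h \<in> L'" using rep[OF assms(3)] by blast
  have ray: "\<exists>D>0. \<exists>P K. poly P 0 = p \<and>
      (\<forall>k\<ge>K. of_int (mod_counting f h I (scale (D * k) u + rep h)) = poly P (of_int k))"
    if p: "is_mpc f h I C p" for p
  proof -
    obtain l0 M g where g: "l0 \<in> C" "finite_index M L" "quasipolynomial_on M g"
      "\<And>l. l \<in> M \<Longrightarrow> restr I (l + rep h) \<in> (\<lambda>y. l0 + y) ` C \<Longrightarrow>
        of_int (mod_counting f h I (l + rep h)) = g l" "p = g 0"
      using p unfolding is_mpc_def by blast
    obtain D P where D: "D > 0" "\<And>k. scale (D * k) u \<in> M" "\<And>k. g (scale (D * k) u) = poly P (of_int k)"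
      using quasipolynomial_ray[OF g(2,3) u(1)] by blast
    have "restr I (rep h) - l0 \<in> coord_space I"
      using restr_coord_space C_V[OF g(1)] real_vector.subspace_diff[OF subspace_V] by blast
    then obtain t where t: "\<And>s. s \<ge> t \<Longrightarrow> s *\<^sub>R restr I u + (restr I (rep h) - l0) \<in> C"
      using C_absorb[OF u(2)] by blast
    have "of_int (mod_counting f h I (scale (D * k) u + rep h)) = poly P (of_int k)" if k: "k \<ge> max 0 \<lceil>t\<rceil>" for k
    proof -
      have "t \<le> of_int k" using k by linarith
      also have "k \<le> D * k" using D(1) k mult_right_mono[of 1 D k] by simp
      then have "real_of_int k \<le> of_int (D * k)" by (simp only: of_int_le_iff)
      finally have 1: "of_int (D * k) *\<^sub>R restr I u + (restr I (rep h) - l0) \<in> C" by (rule t)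
      have eq: "restr I (scale (D * k) u + rep h) = l0 + (of_int (D * k) *\<^sub>R restr I u + (restr I (rep h) - l0))"
        using w_add[OF G_scale[OF uL'] rh] w_scale[OF uL', of "D * k"] by simp
      have "restr I (scale (D * k) u + rep h) \<in> (\<lambda>y. l0 + y) ` C"
        unfolding eq by (rule imageI[OF 1])
      from g(4)[OF D(2) this] show ?thesis by (simp only: D(3))
    qed
    moreover have "poly P 0 = p" using D(3)[of 0] g(5) by simp
    ultimately show ?thesis using D(1) by blast
  qed
  obtain D P K where D: "D > 0" "poly P 0 = p"
    "\<And>k. k \<ge> K \<Longrightarrow> of_int (mod_counting f h I (scale (D * k) u + rep h)) = poly P (of_int k)"
    using ray[OF assms(1)] by blast
  obtain D' P' K' where D': "D' > 0" "poly P' 0 = q"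
    "\<And>k. k \<ge> K' \<Longrightarrow> of_int (mod_counting f h I (scale (D' * k) u + rep h)) = poly P' (of_int k)"
    using ray[OF assms(2)] by blast
  \<comment> \<open>after rescaling, both polynomials describe the values along the multiples of \<open>D * D'\<close> times \<open>u\<close>\<close>
  define R where "R = pcompose P [:0, of_int D':] - pcompose P' [:0, of_int D:]"
  have "poly R (of_int k) = 0" if k: "k \<ge> max 0 (max K K')" for k
  proof -
    have "k \<le> D * k" "k \<le> D' * k"
      using D(1) D'(1) k mult_right_mono[of 1 D k] mult_right_mono[of 1 D' k] by simp_all
    then have "D' * k \<ge> K" "D * k \<ge> K'" using k by linarith+
    then have "poly P (of_int (D' * k)) = poly P' (of_int (D * k))"
      using D(3)[of "D' * k"] D'(3)[of "D * k"] by (simp add: mult.left_commute)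
    then show ?thesis by (simp add: R_def poly_pcompose mult.commute)
  qed
  then have "R = 0" by (rule poly_eq_0_if_eventually)
  then have "poly R 0 = 0" by simp
  then show ?thesis using D(2) D'(2) by (simp add: R_def poly_pcompose)
qed

lemma restr_cone_nonneg:
  assumes "x \<in> convex_cone hull (restr I ` set X)" "v \<in> I"
  shows "0 \<le> x $ v"
proof -
  have "convex_cone {x :: real ^ 'b. 0 \<le> x $ v}" unfolding convex_cone_iff by auto
  moreover have "restr I ` set X \<subseteq> {x. 0 \<le> x $ v}" using X_nonneg by (auto simp: restr_nth)
  ultimately have "convex_cone hull (restr I ` set X) \<subseteq> {x. 0 \<le> x $ v}" by (rule hull_minimal[rotated])
  then show ?thesis using assms(1) by blast
qed

lemma pf_nonzero_nonneg: "pf X x \<noteq> 0 \<Longrightarrow> v \<in> I \<Longrightarrow> x \<in> L' \<and> 0 \<le> coord x v"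
  using pf_supp[OF X_L', of x] restr_cone_nonneg[of "restr I x" v] by (auto simp: restr_nth)

text \<open>
  The generators for the partial fractions, which involve multiples of the given exponents.
\<close>

definition multiples :: "'a set" where
  "multiples = {scale m g |m g. 0 < m \<and> g \<in> set X}"

lemma multiples_L': "multiples \<subseteq> L'"
  using X_L' G_scale by (auto simp: multiples_def)

text \<open>
  Replacing a generator by a positive multiple changes neither cones nor independence.
\<close>

lemma multiples_compatible:
  assumes \<sigma>: "finite \<sigma>" "\<sigma> \<subseteq> multiples" "indep \<sigma>"
  shows "(card \<sigma> = card I \<and> C \<subseteq> convex_cone hull (restr I ` \<sigma>)) \<or> C \<inter> convex_cone hull (restr I ` \<sigma>) = {}"
proof -
  have "\<forall>u\<in>\<sigma>. \<exists>m g. 0 < m \<and> g \<in> set X \<and> u = scale m g"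
    using \<sigma>(2) unfolding multiples_def by blast
  then obtain m g where mg: "\<And>u. u \<in> \<sigma> \<Longrightarrow> 0 < m u \<and> g u \<in> set X \<and> u = scale (m u) (g u)" by metis
  let ?\<tau> = "(\<lambda>u. restr I (g u)) ` \<sigma>"
  have w: "restr I u = of_int (m u) *\<^sub>R restr I (g u)" if "u \<in> \<sigma>" for u
    using mg[OF that] X_L' w_scale[of "g u" "m u"] by (metis subsetD)
  have w': "restr I (g u) = (1 / of_int (m u)) *\<^sub>R restr I u" if "u \<in> \<sigma>" for u
    using w[OF that] mg[OF that] by simp
  have ind: "inj_on (restr I) \<sigma>" "\<not> real_vector.dependent (restr I ` \<sigma>)"
    using indep_imp_independent[OF \<sigma>(1) _ \<sigma>(3)] \<sigma>(2) multiples_L' by auto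
  have cone: "convex_cone hull ?\<tau> = convex_cone hull (restr I ` \<sigma>)"
  proof
    have "restr I (g u) \<in> convex_cone hull (restr I ` \<sigma>)" if "u \<in> \<sigma>" for u
      unfolding w'[OF that] using that mg[OF that] by (intro convex_cone_hull_mul hull_inc) auto
    then show "convex_cone hull ?\<tau> \<subseteq> convex_cone hull (restr I ` \<sigma>)"
      by (intro hull_minimal convex_cone_convex_cone_hull) auto
    have "restr I u \<in> convex_cone hull ?\<tau>" if "u \<in> \<sigma>" for u
      unfolding w[OF that] using that mg[OF that] by (intro convex_cone_hull_mul hull_inc) auto
    then show "convex_cone hull (restr I ` \<sigma>) \<subseteq> convex_cone hull ?\<tau>"
      by (intro hull_minimal convex_cone_convex_cone_hull) auto
  qed
  have sp: "real_vector.span ?\<tau> = real_vector.span (restr I ` \<sigma>)"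
  proof
    have "restr I (g u) \<in> real_vector.span (restr I ` \<sigma>)" if "u \<in> \<sigma>" for u
      unfolding w'[OF that] using that by (intro real_vector.span_scale real_vector.span_base) auto
    then show "real_vector.span ?\<tau> \<subseteq> real_vector.span (restr I ` \<sigma>)"
      by (intro real_vector.span_minimal real_vector.subspace_span) auto
    have "restr I u \<in> real_vector.span ?\<tau>" if "u \<in> \<sigma>" for u
      unfolding w[OF that] using that by (intro real_vector.span_scale real_vector.span_base) auto
    then show "real_vector.span (restr I ` \<sigma>) \<subseteq> real_vector.span ?\<tau>"
      by (intro real_vector.span_minimal real_vector.subspace_span) auto
  qed
  have dim: "dim (restr I ` \<sigma>) = card \<sigma>"
    using dim_eq_card_independent[OF ind(2)] card_image[OF ind(1)] by simp
  have dim': "dim ?\<tau> = card \<sigma>" using sp dim by (metis dim_span)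
  have "card ?\<tau> \<le> card \<sigma>" using \<sigma>(1) by (rule card_image_le)
  moreover have "dim ?\<tau> \<le> card ?\<tau>" using \<sigma>(1) by (intro dim_le_card') auto
  ultimately have card: "card ?\<tau> = dim ?\<tau>" using dim' by simp
  have ind\<tau>: "\<not> real_vector.dependent ?\<tau>"
    using card_eq_dim[OF order_refl card] \<sigma>(1) real_vector.span_superset[of ?\<tau>] by simp
  have sub: "?\<tau> \<subseteq> restr I ` set X" using mg by auto
  show ?thesis
  proof (cases "?\<tau> \<in> bases_in I (restr I ` set X)")
    case True
    have "card \<sigma> = dim (coord_space I)"
      using dim' basesD(4)[OF True] by (metis dim_span)
    also have "\<dots> = card I"
    proof -
      have "dim (coord_space I) = card ((\<lambda>v. axis v (1::real)) ` I)"
        using basesD(1,4)[OF axes_basis] dim_eq_card_independent by (metis dim_span)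
      also have "\<dots> = card I" by (rule card_image) (auto simp: inj_on_def axis_eq_axis)
      finally show ?thesis .
    qed
    finally show ?thesis using C_cone_cases[OF True] cone by auto
  next
    case False
    then show ?thesis using C_avoids_small_cones[OF sub ind\<tau>] cone by simp
  qed
qed

lemma graded_chamber_inside:
  assumes inside: "\<forall>x\<in>C. \<forall>v\<in>I. 0 \<le> x $ v"
  shows "graded_chamber scale L' kernel (restr I) (\<lambda>y. \<Sum>v\<in>I. y $ v) multiples C (card I)"
proof (intro graded_chamber.intro generated_group.intro graded_chamber_axioms.intro generated_group_axioms.intro)
  show "graded_group scale L' kernel (restr I) (\<lambda>y. \<Sum>v\<in>I. y $ v)" by (rule graded_group_axioms)
  show "pos g" if g: "g \<in> multiples" for g
  proof -
    obtain m x where "g = scale m x" "0 < m" "pos x"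
      using g X_pos unfolding multiples_def list_all_iff by blast
    then show ?thesis by (simp add: pos_def G_scale w_scale sum_distrib_left[symmetric])
  qed
  show "scale k g \<in> multiples" if g: "g \<in> multiples" and k: "0 < k" for g k
  proof -
    obtain m x where "g = scale m x" "0 < m" "x \<in> set X"
      using g unfolding multiples_def by blast
    then have "scale k g = scale (k * m) x" "0 < k * m" "x \<in> set X" using k by simp_all
    then show ?thesis unfolding multiples_def by blast
  qed
  show "x + y \<in> C" if "x \<in> C" "y \<in> C" for x y using C_add[OF _ that] inside by blast
  show "r *\<^sub>R x \<in> C" if "0 < r" "x \<in> C" for r x using C_scale[OF that(2,1)] .
  show "\<exists>u\<in>L'. restr I u \<in> C" using lattice_point_in_C L_subset by blast
  show "\<exists>r>0. r *\<^sub>R y + restr I x \<in> C" if "y \<in> C" "x \<in> L'" for y x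
    using C_absorb[OF that(1) restr_coord_space] by blast
  show "(card \<sigma> = card I \<and> C \<subseteq> convex_cone hull (restr I ` \<sigma>)) \<or> C \<inter> convex_cone hull (restr I ` \<sigma>) = {}"
    if "finite \<sigma>" "\<sigma> \<subseteq> multiples" "indep \<sigma>" for \<sigma>
    using that by (rule multiples_compatible)
  show "inj_on (restr I) \<sigma> \<and> \<not> real_vector.dependent (restr I ` \<sigma>)"
    if "finite \<sigma>" "\<sigma> \<subseteq> L'" "indep \<sigma>" for \<sigma>
    using that by (rule indep_imp_independent)
  show "\<exists>B. finite B \<and> span B = L'" by (rule L'_finitely_generated)
qed

text \<open>
  The quasi-polynomial of the definition is \<open>g l = \<Sum>\<^sub>k c\<^sub>k T (l + rep h - b\<^sub>k - all_ones)\<close>. Its value at \<open>0\<close>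
  is computed by reciprocity, and then exactness applies at \<open>b\<^sub>k - rep h - \<Sum>gs\<close>: the subtrahend is
  the point of the zonotope with coefficient \<open>1\<close> at the elements of \<open>gs\<close> and with the coordinates
  of \<open>rep h\<close> as coefficients of the \<open>E\<^sub>v\<close>.
\<close>

lemma mpc_inside:
  fixes b :: "nat \<Rightarrow> 'a" and c :: "nat \<Rightarrow> int"
  assumes inside: "\<forall>x\<in>C. \<forall>v\<in>I. 0 \<le> x $ v" and h: "h \<in> class_group"
    and K: "finite K" "\<And>k. k \<in> K \<Longrightarrow> b k \<in> L'" "\<And>k. k \<in> K \<Longrightarrow> restr I (b k) \<in> C"
    and f: "\<And>x. of_int (counting f x) = (\<Sum>k\<in>K. of_int (c k) * pf X (x - b k - all_ones))"
  shows "is_mpc f h I C ((-1) ^ length gs * (\<Sum>k\<in>K. of_int (c k) * pf X (b k - rep h - sum_list gs)))"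
proof -
  interpret ch: graded_chamber scale L' kernel "restr I" "\<lambda>y. \<Sum>v\<in>I. y $ v" multiples C "card I"
    using inside by (rule graded_chamber_inside)
  note r = rep[OF h]
  have gsL: "sum_list gs \<in> L'" by (rule sum_gs_L')
  have Xm: "set X \<subseteq> multiples"
  proof
    fix g assume "g \<in> set X"
    then have "g = scale 1 g \<and> (0::int) < 1 \<and> g \<in> set X" by simp
    then show "g \<in> multiples" unfolding multiples_def by blast
  qed
  obtain T where T: "qpoly T" "ch.asymptotic (pf X) (reflected_pf X) T" using ch.ex_asymptotic[OF Xm] by blast
  have shiftL: "rep h - b k - all_ones \<in> L'" if "k \<in> K" for k using r(1) K(2)[OF that] all_ones_L' by (intro G_diff)
  have "\<exists>T'. qpoly T' \<and> (\<forall>x\<in>L'. T' x = T (x + (rep h - b k - all_ones)))" if "k \<in> K" for k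
    using qpoly_shift[OF T(1) G_neg[OF shiftL[OF that]]] by (simp only: diff_minus_eq_add)
  then obtain T' where T': "\<And>k. k \<in> K \<Longrightarrow> qpoly (T' k)"
    "\<And>k x. k \<in> K \<Longrightarrow> x \<in> L' \<Longrightarrow> T' k x = T (x + (rep h - b k - all_ones))" by metis
  define g where "g x = (\<Sum>k\<in>K. of_int (c k) * T' k x)" for x
  have "qpoly g" unfolding g_def[abs_def] using T'(1) by (intro qpoly_sum qpoly_scale)
  then obtain M where M: "finite_index M L" "quasipolynomial_on M g" using qpoly_quasipolynomial by blast
  have M_sub: "M \<subseteq> L" using M(1) by (simp add: finite_index_def)
  have exact0: "pf X x = T x" if x: "x \<in> L'" "restr I x \<in> C" for x
  proof (rule ch.pf_exact[OF Xm T _ x(2,1)])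
    show "ch.unit_coeffs X (map (\<lambda>g. (g, 0)) X)" by (simp add: ch.unit_coeffs_def o_def)
    have "ch.combination (map (\<lambda>g. (g, 0)) Y) = 0" for Y by (induction Y) (simp_all add: ch.combination_def)
    then show "restr I x = restr I x - ch.combination (map (\<lambda>g. (g, 0)) X)" by simp
  qed
  obtain u where u: "u \<in> L'" "restr I u \<in> C" using ch.c_point by blast
  have "\<exists>N. \<forall>m\<ge>N. restr I (- b k - all_ones + scale m u) \<in> C" if "k \<in> K" for k
    using ch.ray_enters_chamber[OF u, of "- b k - all_ones"] K(2)[OF that] all_ones_L' G_neg G_diff by blast
  then obtain N where N: "\<And>k m. k \<in> K \<Longrightarrow> m \<ge> N k \<Longrightarrow> restr I (- b k - all_ones + scale m u) \<in> C" by metis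
  obtain N' where N': "\<And>m. m \<ge> N' \<Longrightarrow> restr I (0 + scale m u) \<in> C" using ch.ray_enters_chamber[OF u G_0] by blast
  define m where "m = Max (insert N' (N ` K))"
  have m: "m \<ge> N'" "\<And>k. k \<in> K \<Longrightarrow> m \<ge> N k" using K(1) by (auto simp: m_def)
  \<comment> \<open>so far inside that \<open>l0 - b k - all_ones\<close> restricts to \<open>C\<close> for every \<open>k\<close>\<close>
  define l0 where "l0 = scale m u"
  have l0: "l0 \<in> L'" "restr I l0 \<in> C" "\<And>k. k \<in> K \<Longrightarrow> restr I (- b k - all_ones + l0) \<in> C"
    using N'[OF m(1)] N[OF _ m(2)] u(1) by (auto simp: l0_def G_scale)
  have agree: "of_int (mod_counting f h I (l + rep h)) = g l"
    if l: "l \<in> M" "restr I (l + rep h) \<in> (\<lambda>y. restr I l0 + y) ` C" for l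
  proof -
    have lL: "l \<in> L" "l \<in> L'" using l(1) M_sub L_subset by blast+
    have lr: "l + rep h \<in> L'" using lL(2) r(1) by (rule G_add)
    have "cls (l + rep h) = h" using cls_eq_iff[of "l + rep h" "rep h"] r(2) lL(1) by simp
    then have "of_int (mod_counting f h I (l + rep h)) = real_of_int (counting f (l + rep h))"
      using lr by (simp add: counting_def)
    also have "\<dots> = (\<Sum>k\<in>K. of_int (c k) * pf X (l + rep h - b k - all_ones))" by (rule f)
    also have "\<dots> = g l"
      unfolding g_def
    proof (intro sum.cong refl arg_cong[where f = "\<lambda>y. _ * y"])
      fix k assume k: "k \<in> K"
      obtain y where y: "y \<in> C" "restr I (l + rep h) = restr I l0 + y" using l(2) by blast
      have zL: "l + rep h - b k - all_ones \<in> L'" using lr K(2)[OF k] all_ones_L' by (intro G_diff)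
      have "restr I (l + rep h - b k - all_ones) = y + restr I (- b k - all_ones + l0)"
        using y(2) lr K(2)[OF k] all_ones_L' l0(1) by (simp add: w_diff w_add w_neg G_diff G_neg G_add)
      then have "restr I (l + rep h - b k - all_ones) \<in> C" using ch.c_add[OF y(1) l0(3)[OF k]] by simp
      then have "pf X (l + rep h - b k - all_ones) = T (l + rep h - b k - all_ones)" using exact0[OF zL] by blast
      then show "pf X (l + rep h - b k - all_ones) = T' k l" using T'(2)[OF k lL(2)] by (simp add: algebra_simps)
    qed
    finally show ?thesis .
  qed
  have exact1: "pf X (b k - rep h - sum_list gs) = T (b k - rep h - sum_list gs)" if k: "k \<in> K" for k
  proof (rule ch.pf_exact[OF Xm T _ K(3)[OF k]])
    \<comment> \<open>the zonotope coefficients of \<open>rep h + sum_list gs\<close>\<close>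
    let ?P = "map (\<lambda>g. (g, 1)) gs @ map (\<lambda>g. (g, of_rat (coord (rep h) (inv E g)))) basis_list"
    have "of_rat (coord (rep h) v) \<le> (1 :: real)" "0 \<le> (of_rat (coord (rep h) v) :: real)" for v
      using r(3,4)[of v] by (simp_all add: less_imp_le of_rat_le_1_iff)
    then show "ch.unit_coeffs X ?P" by (auto simp: ch.unit_coeffs_def X_def o_def)
    have 1: "ch.combination (map (\<lambda>g. (g, 1)) gs) = restr I (sum_list gs)"
    proof -
      have "set gs \<subseteq> L'" using X_L' by (simp add: set_X)
      then show ?thesis
        by (induction gs) (simp_all add: ch.combination_def w_0 w_add G_sum_list)
    qed
    have "ch.combination (map (\<lambda>g. (g, of_rat (coord (rep h) (inv E g)))) basis_list)
        = (\<Sum>g\<leftarrow>basis_list. of_rat (coord (rep h) (inv E g)) *\<^sub>R restr I g)"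
      by (simp add: ch.combination_def o_def)
    also have "\<dots> = (\<Sum>g\<in>E ` I. of_rat (coord (rep h) (inv E g)) *\<^sub>R restr I g)"
      using basis_list by (simp add: sum_list_distinct_conv_sum_set)
    also have "\<dots> = (\<Sum>v\<in>I. of_rat (coord (rep h) v) *\<^sub>R axis v 1)"
      using basis_L(1) inj_on_subset[OF basis_L(1) subset_UNIV, of I]
      by (simp add: sum.reindex inv_f_f restr_E cong: sum.cong)
    also have "\<dots> = restr I (rep h)"
      by (auto simp: vec_eq_iff restr_nth axis_def if_distrib[of "\<lambda>y. _ * y"] cong: if_cong)
    finally have "ch.combination ?P = restr I (sum_list gs) + restr I (rep h)"
      using 1 by (simp add: ch.combination_def)
    then show "restr I (b k - rep h - sum_list gs) = restr I (b k) - ch.combination ?P"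
      using K(2)[OF k] r(1) gsL by (simp add: w_diff G_diff)
    show "b k - rep h - sum_list gs \<in> L'" using K(2)[OF k] r(1) gsL by (intro G_diff)
  qed
  have "g 0 = (-1) ^ length gs * (\<Sum>k\<in>K. of_int (c k) * pf X (b k - rep h - sum_list gs))"
    unfolding g_def sum_distrib_left
  proof (rule sum.cong[OF refl])
    fix k assume k: "k \<in> K"
    let ?y = "b k - rep h - sum_list gs"
    have yL: "?y \<in> L'" using K(2)[OF k] r(1) gsL by (intro G_diff)
    have eq: "- ?y - sum_list X = rep h - b k - all_ones" by (simp add: sum_X)
    have rec: "(-1) ^ length X * T (rep h - b k - all_ones) = (-1) ^ card I * T ?y"
      using ch.reciprocity[OF Xm T yL] unfolding eq .
    have sq: "(-1) ^ j * ((-1) ^ j * z) = (z :: real)" for j :: nat and z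
      by (simp add: mult.assoc[symmetric] power_mult_distrib[symmetric])
    have "(-1) ^ card I * ((-1) ^ card I * ((-1) ^ length gs * T (rep h - b k - all_ones))) =
        (-1) ^ card I * ((-1) ^ card I * T ?y)"
      using rec by (simp add: length_X power_add mult_ac)
    then have "(-1) ^ length gs * T (rep h - b k - all_ones) = T ?y" unfolding sq .
    then have "T (rep h - b k - all_ones) = (-1) ^ length gs * T ?y"
      using sq[of "length gs" "T (rep h - b k - all_ones)"] by simp
    then show "of_int (c k) * T' k 0 = (-1) ^ length gs * (of_int (c k) * pf X ?y)"
      using T'(2)[OF k G_0] exact1[OF k] by (simp add: mult.left_commute)
  qed
  then show ?thesis
    unfolding is_mpc_def using l0(2) M agree
    by (intro bexI[of _ "restr I l0"] exI[of _ M] exI[of _ g]) simp_all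
qed

text \<open>
  Outside the orthant the partition function vanishes. A sufficiently negative apex \<open>l0\<close> keeps the
  translated chamber away from all the translates of the orthant that support the counting function,
  so \<open>0\<close> serves as the quasi-polynomial.
\<close>

lemma mpc_outside:
  fixes b :: "nat \<Rightarrow> 'a" and c :: "nat \<Rightarrow> int"
  assumes outside: "\<forall>x\<in>C. \<exists>v\<in>I. x $ v < 0" and h: "h \<in> class_group"
    and K: "finite K" "\<And>k. k \<in> K \<Longrightarrow> b k \<in> L'" "\<And>k. k \<in> K \<Longrightarrow> restr I (b k) \<in> C"
    and f: "\<And>x. of_int (counting f x) = (\<Sum>k\<in>K. of_int (c k) * pf X (x - b k - all_ones))"
  shows "is_mpc f h I C ((-1) ^ length gs * (\<Sum>k\<in>K. of_int (c k) * pf X (b k - rep h - sum_list gs)))"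
proof -
  note r = rep[OF h]
  have gsL: "sum_list gs \<in> L'" by (rule sum_gs_L')
  have "pf X (b k - rep h - sum_list gs) = 0" if k: "k \<in> K" for k
  proof (rule ccontr)
    assume nz: "pf X (b k - rep h - sum_list gs) \<noteq> 0"
    have gs0: "0 \<le> coord (sum_list gs) v" for v
    proof -
      have "set gs \<subseteq> L'" "\<forall>g\<in>set gs. 0 \<le> coord g v" using X_L' X_nonneg by (auto simp: set_X)
      then show ?thesis by (induction gs) (simp_all add: coord_zero coord_add G_sum_list)
    qed
    obtain v where v: "v \<in> I" "restr I (b k) $ v < 0" using outside K(3)[OF k] by blast
    have "0 \<le> coord (b k - rep h - sum_list gs) v" using pf_nonzero_nonneg[OF nz v(1)] by blast
    then have "0 \<le> coord (b k) v - coord (rep h) v - coord (sum_list gs) v"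
      using K(2)[OF k] r(1) gsL by (simp add: coord_diff G_diff)
    then have "0 \<le> coord (b k) v" using gs0[of v] r(3)[of v] by linarith
    then show False using v by (simp add: restr_nth)
  qed
  then have zero: "(-1) ^ length gs * (\<Sum>k\<in>K. of_int (c k) * pf X (b k - rep h - sum_list gs)) = (0 :: real)"
    by simp
  \<comment> \<open>bounds \<open>- (b\<^sub>k + all_ones)\<close> in every coordinate\<close>
  define R where "R = Max (insert 1 ((\<lambda>(k, v). - (real_of_rat (coord (b k) v) + 1)) ` (K \<times> UNIV)))"
  have fin: "finite (insert 1 ((\<lambda>(k, v). - (real_of_rat (coord (b k) v) + 1)) ` (K \<times> UNIV)))" using K(1) by simp
  have R: "1 \<le> R" "\<And>k v. k \<in> K \<Longrightarrow> - (real_of_rat (coord (b k) v) + 1) \<le> R"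
  proof -
    show "1 \<le> R" unfolding R_def using fin by (intro Max_ge) auto
    show "- (real_of_rat (coord (b k) v) + 1) \<le> R" if "k \<in> K" for k v
      unfolding R_def using fin that by (intro Max_ge) auto
  qed
  let ?l0 = "\<chi> v. if v \<in> I then - R else 0"
  have l0: "?l0 \<in> C" using outer_chamber_point[OF outside, of R] R(1) by simp
  have agree: "of_int (mod_counting f h I (l + rep h)) = (0 :: real)"
    if l: "l \<in> L" "restr I (l + rep h) \<in> (\<lambda>y. ?l0 + y) ` C" for l
  proof -
    have lL: "l \<in> L'" using l(1) L_subset by blast
    have lr: "l + rep h \<in> L'" using lL r(1) by (rule G_add)
    obtain y where y: "y \<in> C" "restr I (l + rep h) = ?l0 + y" using l(2) by blast
    obtain v where v: "v \<in> I" "y $ v < 0" using outside y(1) by blast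
    have lv: "real_of_rat (coord (l + rep h) v) < - R"
      using arg_cong[OF y(2), of "\<lambda>z. z $ v"] v by (simp add: restr_nth)
    have "pf X (l + rep h - b k - all_ones) = 0" if k: "k \<in> K" for k
    proof (rule ccontr)
      assume "pf X (l + rep h - b k - all_ones) \<noteq> 0"
      then have "0 \<le> coord (l + rep h - b k - all_ones) v" using pf_nonzero_nonneg v(1) by blast
      then have "coord (b k) v + 1 \<le> coord (l + rep h) v"
        using lr K(2)[OF k] all_ones_L' v(1) by (simp add: coord_diff G_diff coord_all_ones)
      then have "real_of_rat (coord (b k) v + 1) \<le> real_of_rat (coord (l + rep h) v)" by (simp only: of_rat_less_eq)
      then show False using R(2)[OF k, of v] lv by (simp add: of_rat_add)
    qed
    then have "real_of_int (counting f (l + rep h)) = 0" using f[of "l + rep h"] by simp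
    moreover have "cls (l + rep h) = h" using cls_eq_iff[of "l + rep h" "rep h"] r(2) l(1) by simp
    ultimately show ?thesis using lr by (simp add: counting_def)
  qed
  have q: "quasipolynomial_on L (\<lambda>l. 0)"
    unfolding quasipolynomial_on_def using finite_index_refl[OF subspace_L]
    by (intro exI[of _ "{}"] exI[of _ "\<lambda>\<alpha> l. 0"] exI[of _ L]) simp
  show ?thesis
    unfolding zero is_mpc_def using l0 finite_index_refl[OF subspace_L] q agree
    by (intro bexI[of _ ?l0] exI[of _ L] exI[of _ "\<lambda>l. 0"]) simp_all
qed

end

theorem theorem3p6p1:
  fixes scale :: "int \<Rightarrow> 'a::ab_group_add \<Rightarrow> 'a"
    and L L' :: "'a set" and E :: "'v::finite \<Rightarrow> 'a"
    and r n :: nat and \<iota> :: "nat \<Rightarrow> int" and a b :: "nat \<Rightarrow> 'a"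
    and h :: "'a set" and I :: "'v set" and C :: "(real ^ 'v) set"
  defines "restr \<equiv> lattice_pair.restr scale E"
    and "Tz \<equiv> lattice_pair.expansion scale L' E (numerator r \<iota> b) (denominator n a)"
    and "Tz_inf \<equiv> lattice_pair.expansion_infinity scale L' E (numerator r \<iota> b) (denominator n a)"
  defines "r_coeff \<equiv> lattice_pair.reduced_coeff scale L L' E Tz_inf h I"
  assumes "lattice_pair scale L L' E"
    and "\<And>k. k \<in> {1..r} \<Longrightarrow> b k \<in> L'"
    and "\<And>i. i \<in> {1..n} \<Longrightarrow> a i \<in> L'"
    and "\<And>i v. i \<in> {1..n} \<Longrightarrow> 0 < lattice_pair.coord scale E (a i) v"
    and "h \<in> lattice_pair.class_group L L'"
    and "I \<noteq> {}"
    and "C \<in> chambers I (restr I ` (a ` {1..n} \<union> E ` I))"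
    and "\<And>k. k \<in> {1..r} \<Longrightarrow> restr I (b k) \<in> C"
  shows "lattice_pair.mpc scale L L' E Tz h I C =
           of_int (\<Sum>y | y \<in> coord_space I \<and> (\<forall>v\<in>I. 0 \<le> y $ v) \<and> r_coeff y \<noteq> 0. r_coeff y)"
proof -
  interpret reduced_lattice scale L L' E I
    using assms(5,10) by (simp add: reduced_lattice_def reduced_lattice_axioms_def)
  define gs where "gs = map a [1..<Suc n]"
  have a_pos: "positive (a i)" if "i \<in> {1..n}" for i
    using assms(7,8) that by (simp add: positive_def)
  have gs: "list_all positive gs" using a_pos by (auto simp: gs_def list_all_iff)
  have set_gs: "set gs = a ` {1..n}" "length gs = n" by (auto simp: gs_def)
  interpret lattice_chamber scale L L' E I gs C
  proof
    show "list_all positive gs" by (rule gs)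
    show "C \<in> chambers I (lattice_pair.restr scale E I ` (set gs \<union> E ` I))"
      using assms(11) unfolding set_gs(1) assms(1) .
  qed
  have P: "u \<in> L'" if "Poly_Mapping.lookup (numerator r \<iota> b) u \<noteq> 0" for u
  proof -
    have "(\<Sum>k = 1..r. \<iota> k * (if u = b k then 1 else 0)) \<noteq> 0"
      using that unfolding lookup_numerator .
    then obtain k where "k \<in> {1..r}" "\<iota> k * (if u = b k then 1 else 0) \<noteq> 0"
      by (rule sum.not_neutral_contains_not_neutral)
    then show ?thesis using assms(6) by (auto split: if_splits)
  qed
  have Tz: "narrow Tz" "foldr diff_op gs Tz = Poly_Mapping.lookup (numerator r \<iota> b)"
    using expansion_denominator[of n a "numerator r \<iota> b"] a_pos P unfolding Tz_def gs_def by blast+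
  have count: "of_int (counting Tz x) = (\<Sum>k\<in>{1..r}. of_int (\<iota> k) * pf X (x - b k - all_ones))" for x
    unfolding X_def
  proof (rule counting_formula[OF Tz(1) gs finite_atLeastAtMost assms(6)])
    show "foldr diff_op gs Tz = (\<lambda>x. \<Sum>k = 1..r. \<iota> k * (if x = b k then 1 else 0))"
      unfolding Tz(2) by (rule ext) (rule lookup_numerator)
  qed
  obtain f where f: "narrow f" "\<And>l. Tz_inf l = f (- l)"
    "foldr diff_op gs f = (\<lambda>x. (-1) ^ n * Poly_Mapping.lookup (numerator r \<iota> b) (sum_list gs - x))"
    unfolding Tz_inf_def gs_def using expansion_infinity_denominator[of n a "numerator r \<iota> b"] a_pos P by blast
  have gsL: "sum_list gs \<in> L'" by (rule sum_gs_L')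
  let ?p = "(-1) ^ length gs * (\<Sum>k\<in>{1..r}. of_int (\<iota> k) * pf X (b k - rep h - sum_list gs))"
  have "of_int (counting f (all_ones - rep h)) =
      (\<Sum>k\<in>{1..r}. of_int ((-1) ^ n * \<iota> k) * pf (gs @ basis_list) (all_ones - rep h - (sum_list gs - b k) - all_ones))"
  proof (rule counting_formula[OF f(1) gs finite_atLeastAtMost])
    show "sum_list gs - b k \<in> L'" if "k \<in> {1..r}" for k using gsL assms(6)[OF that] by (rule G_diff)
    have "sum_list gs - x = b k \<longleftrightarrow> x = sum_list gs - b k" for x k by (auto simp: algebra_simps)
    then show "foldr diff_op gs f =
        (\<lambda>x. \<Sum>k = 1..r. ((-1) ^ n * \<iota> k) * (if x = sum_list gs - b k then 1 else 0))"
      unfolding f(3) lookup_numerator sum_distrib_left by (simp only: mult.assoc)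
  qed
  also have "\<dots> = ?p"
    unfolding sum_distrib_left X_def[symmetric] by (intro sum.cong) (simp_all add: set_gs(2) algebra_simps)
  finally have val: "of_int (counting f (all_ones - rep h)) = ?p" .
  have "Tz_inf = (\<lambda>l. f (- l))" using f(2) by blast
  then have "of_int (\<Sum>y | y \<in> coord_space I \<and> (\<forall>v\<in>I. 0 \<le> y $ v) \<and> r_coeff y \<noteq> 0. r_coeff y) = ?p"
    using sum_reduced_coeff[OF f(1) assms(9)] val unfolding r_coeff_def by (simp only:)
  moreover have "is_mpc Tz h I C ?p"
    using orthant_cases mpc_inside[OF _ assms(9) finite_atLeastAtMost assms(6) _ count]
      mpc_outside[OF _ assms(9) finite_atLeastAtMost assms(6) _ count] assms(12) unfolding assms(1) by blast
  then have "mpc Tz h I C = ?p"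
    unfolding mpc_def using mpc_unique assms(9) by (intro the_equality) blast+
  ultimately show ?thesis by simp
qed

end
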